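(* Let $d=\frac{\pi}{2}$ and $H\in\mathbb{C}$. Let $(q,h,\beta,\gamma)$ and $(\tilde q,\tilde h,\beta,\gamma)$ be two sets of coefficients with the same $\beta$ and the same $\gamma$, and let $B,B^\infty$ and $\tilde B,\tilde B^\infty$ be the corresponding boundary value problems with this same $H$ and $d$ (see context). Let $m\in\mathbb{N}_0\cup\{-1\}$, and suppose that $q,\tilde q$ are $C^m$ near $\frac{\pi}{2}$ and that $q=\tilde q$ a.e. on $\left[\frac{\pi}{2},\pi\right]$. Suppose that at least one of the following holds: (i) $\sigma(B)$ and $\sigma(\tilde B)$ coincide except for $\left[\frac{m+2}{2}\right]$ eigenvalues, i.e. there are sets $\Lambda,\tilde\Lambda\subset\mathbb{N}_0$ with $\#\Lambda=\#\tilde\Lambda=\left[\frac{m+2}{2}\right]$ such that $\{\lambda_n\}_{n\in\mathbb{N}_0\setminus\Lambda}$ and $\{\tilde\lambda_n\}_{n\in\mathbb{N}_0\setminus\tilde\Lambda}$ coincide, counted with repetitions; (ii) $\sigma(B^\infty)$ and $\sigma(\tilde B^\infty)$ coincide except for $\left[\frac{m+1}{2}\right]$ eigenvalues, i.e. there are sets $\Lambda,\tilde\Lambda\subset\mathbb{N}_0$ with $\#\Lambda=\#\tilde\Lambda=\left[\frac{m+1}{2}\right]$ such that $\{\lambda_n^\infty\}_{n\in\mathbb{N}_0\setminus\Lambda}$ and $\{\tilde\lambda_n^\infty\}_{n\in\mathbb{N}_0\setminus\tilde\Lambda}$ coincide, counted with repetitions. Then $h=\tilde h$ and $q=\tilde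 q$ a.e. on $[0,\pi]$.
   Context: For coefficients $q\in L^1([0,\pi];\mathbb{C})$, $h,H,\gamma\in\mathbb{C}$, $\beta\in\mathbb{R}$ with $\beta>0$, and $d\in(0,\pi)$, consider the equation $-y''+q(x)y=\lambda y$ on $(0,\pi)$ with the boundary condition $y'(0)-hy(0)=0$ and the jump conditions $y(d+0)=\beta y(d-0)$, $y'(d+0)=\beta^{-1}y'(d-0)+\gamma y(d-0)$. Problem $B$ has in addition the condition $y'(\pi)+Hy(\pi)=0$; problem $B^\infty$ has instead the condition $y(\pi)=0$. Let $\varphi(x,\lambda)$ be the solution of the equation satisfying the jump conditions and $\varphi(0,\lambda)=1,\varphi'(0,\lambda)=h$. The eigenvalues of $B$ and $B^\infty$ are the zeros of the entire functions $\Delta(\lambda)=\varphi'(\pi,\lambda)+H\varphi(\pi,\lambda)$ and $\Delta^\infty(\lambda)=-\varphi(\pi,\lambda)$, respectively; the algebraic multiplicity of an eigenvalue is its order as a zero. $\sigma(B)=\{\lambda_n\}_{n\in\mathbb{N}_0}$ and $\sigma(B^\infty)=\{\lambda_n^\infty\}_{n\in\mathbb{N}_0}$ are the sequences of all eigenvalues, repeated according to algebraic multiplicity, ordered by nondecreasing modulus, with identical eigenvalues adjacent. Symbols with a tilde denote the corresponding objects for $(\tilde q,\tilde h,H,\beta,\gamma,d)$. "$C^m$ near $\frac\pi2$" means $C^m$ in a neighbourhood of $\frac\pi2$; by convention $C^{-1}$ means $L^1$ (no extra smoothness). $[\,\cdot\,]$ denotes the integer part. *)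

theory Defs
  imports "HOL-Complex_Analysis.Complex_Analysis"
begin

definition abs_continuous_on :: "real set \<Rightarrow> (real \<Rightarrow> complex) \<Rightarrow> bool" where
  "abs_continuous_on S f \<longleftrightarrow>
     (\<forall>\<epsilon>>0. \<exists>\<delta>>0. \<forall>(n::nat) (a::nat \<Rightarrow> real) (b::nat \<Rightarrow> real).
        (\<forall>i<n. a i \<le> b i \<and> {a i..b i} \<subseteq> S) \<and>
        (\<forall>i<n. \<forall>j<n. i \<noteq> j \<longrightarrow> {a i<..<b i} \<inter> {a j<..<b j} = {}) \<and>
        (\<Sum>i<n. b i - a i) < \<delta>
        \<longrightarrow> (\<Sum>i<n. norm (f (b i) - f (a i))) < \<epsilon>)"

(* First derivative on [0,pi], one-sided at the two endpoints. *)
definition D1 :: "(real \<Rightarrow> complex) \<Rightarrow> real \<Rightarrow> complex" where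
  "D1 y x = vector_derivative y (at x within {0..pi})"

(* Since q is only integrable, the equation holds almost everywhere and y' is absolutely
   continuous on each side of d. The value of y at d itself is irrelevant. *)
definition sl_solution :: "(real \<Rightarrow> complex) \<Rightarrow> real \<Rightarrow> complex \<Rightarrow> (real \<Rightarrow> complex) \<Rightarrow> bool" where
  "sl_solution q d lam y \<longleftrightarrow>
     (\<forall>x\<in>{0..pi} - {d}. y differentiable (at x within {0..pi})) \<and>
     abs_continuous_on {0..<d} (D1 y) \<and>
     abs_continuous_on {d<..pi} (D1 y) \<and>
     (AE x in lebesgue. x \<in> {0<..<pi} - {d} \<longrightarrow>
        (\<exists>y2. (D1 y has_vector_derivative y2) (at x) \<and> - y2 + q x * y x = lam * y x))"

definition jump_conditions :: "real \<Rightarrow> complex \<Rightarrow> real \<Rightarrow> (real \<Rightarrow> complex) \<Rightarrow> bool" where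
  "jump_conditions \<beta> \<gamma> d y \<longleftrightarrow>
     (\<exists>yl yr yl' yr'.
        (y \<longlongrightarrow> yl) (at_left d) \<and> (y \<longlongrightarrow> yr) (at_right d) \<and>
        (D1 y \<longlongrightarrow> yl') (at_left d) \<and> (D1 y \<longlongrightarrow> yr') (at_right d) \<and>
        yr = of_real \<beta> * yl \<and>
        yr' = inverse (of_real \<beta>) * yl' + \<gamma> * yl)"

(* The conditions determine the solution on [0,pi] - {d}; the choice operator only fixes
   irrelevant values at d and outside [0,pi]. *)
definition phi :: "(real \<Rightarrow> complex) \<Rightarrow> complex \<Rightarrow> real \<Rightarrow> complex \<Rightarrow> real \<Rightarrow> complex \<Rightarrow> real \<Rightarrow> complex" where
  "phi q h \<beta> \<gamma> d lam =
     (SOME y. sl_solution q d lam y \<and> jump_conditions \<beta> \<gamma> d y \<and> y 0 = 1 \<and> D1 y 0 = h)"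

definition Delta :: "(real \<Rightarrow> complex) \<Rightarrow> complex \<Rightarrow> complex \<Rightarrow> real \<Rightarrow> complex \<Rightarrow> real \<Rightarrow> complex \<Rightarrow> complex" where
  "Delta q h H \<beta> \<gamma> d lam = D1 (phi q h \<beta> \<gamma> d lam) pi + H * phi q h \<beta> \<gamma> d lam pi"

definition Delta_inf :: "(real \<Rightarrow> complex) \<Rightarrow> complex \<Rightarrow> real \<Rightarrow> complex \<Rightarrow> real \<Rightarrow> complex \<Rightarrow> complex" where
  "Delta_inf q h \<beta> \<gamma> d lam = - phi q h \<beta> \<gamma> d lam pi"

(* l enumerates the zeros of F, each repeated according to its order as a zero, by nondecreasing
   modulus and with equal entries adjacent. Ties in modulus may be broken arbitrarily. *)
definition eigenvalue_seq :: "(complex \<Rightarrow> complex) \<Rightarrow> (nat \<Rightarrow> complex) \<Rightarrow> bool" where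
  "eigenvalue_seq F l \<longleftrightarrow>
     (\<forall>n. F (l n) = 0) \<and>
     (\<forall>z. F z = 0 \<longrightarrow> finite {n. l n = z} \<and> int (card {n. l n = z}) = zorder F z) \<and>
     mono (\<lambda>n. norm (l n)) \<and>
     (\<forall>i j k. i \<le> j \<and> j \<le> k \<and> l i = l k \<longrightarrow> l j = l i)"

definition coincide_except :: "nat \<Rightarrow> (nat \<Rightarrow> complex) \<Rightarrow> (nat \<Rightarrow> complex) \<Rightarrow> bool" where
  "coincide_except k l l' \<longleftrightarrow>
     (\<exists>\<Lambda> \<Lambda>'. finite \<Lambda> \<and> card \<Lambda> = k \<and> finite \<Lambda>' \<and> card \<Lambda>' = k \<and>
        (\<exists>p. bij_betw p (UNIV - \<Lambda>) (UNIV - \<Lambda>') \<and> (\<forall>n\<in>UNIV - \<Lambda>. l n = l' (p n))))"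

definition Cm_on :: "nat \<Rightarrow> real set \<Rightarrow> (real \<Rightarrow> complex) \<Rightarrow> bool" where
  "Cm_on m S g \<longleftrightarrow>
     (\<exists>D. D 0 = g \<and>
        (\<forall>j<m. \<forall>x\<in>S. (D j has_vector_derivative D (Suc j) x) (at x)) \<and>
        continuous_on S (D m))"

(* Functions in L^1 are given up to null sets, so smoothness is that of some representative;
   for m = -1 this is plain integrability. *)
definition Cm_near :: "int \<Rightarrow> real \<Rightarrow> (real \<Rightarrow> complex) \<Rightarrow> bool" where
  "Cm_near m c q \<longleftrightarrow>
     (\<exists>\<epsilon>>0.
        if m = -1 then q absolutely_integrable_on ball c \<epsilon>
        else \<exists>g. Cm_on (nat m) (ball c \<epsilon>) g \<and>
                 (AE x in lebesgue. x \<in> ball c \<epsilon> \<longrightarrow> q x = g x))"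

end

theory Submission
  imports Defs "HOL-Real_Asymp.Real_Asymp"
begin

text \<open>
  Write \<open>lam = \<rho>\<^sup>2\<close> and let \<open>y\<close>, \<open>yt\<close> be the solutions on \<open>[0, \<pi>/2]\<close> with initial values
  \<open>(1, h)\<close> and \<open>(1, ht)\<close>. Both problems look the same to the right of \<open>\<pi>/2\<close>, so at a common
  eigenvalue the Wronskian \<open>F\<close> of \<open>y\<close> and \<open>yt\<close> at \<open>\<pi>/2\<close> vanishes, with multiplicity. Hence
  \<open>P * F / Delta\<close> is entire for a polynomial \<open>P\<close> whose degree is the number of missing
  eigenvalues. It is of polynomial growth on a sequence of squares in the \<open>\<rho>\<close>-plane, so it is a
  polynomial; on the imaginary \<open>\<rho>\<close>-axis it tends to 0, because \<open>F\<close> is a constant plus the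
  integral of \<open>(qt - q) * y * yt\<close> and \<open>qt - q\<close> vanishes to order \<open>m\<close> at \<open>\<pi>/2\<close>. So \<open>F = 0\<close>, that
  is, the two m-functions at \<open>\<pi>/2\<close> agree. A Borg-Marchenko argument in the manner of Bennewitz
  then gives \<open>y\<^sup>2 = yt\<^sup>2\<close> for a suitable \<open>lam\<close>, and \<open>y\<close> determines \<open>h\<close> and \<open>q\<close>.
\<close>

section \<open>Absolute continuity and the Lebesgue differentiation theorem\<close>

text \<open>The integer parts in the hypotheses come from counting powers of \<open>\<rho>\<close>.
  Away from its zeros \<open>Delta\<close> has size
  \<open>\<bar>\<rho>\<bar> * exp (2 * d * \<bar>Im \<rho>\<bar>)\<close>, and
  \<open>Delta_inf\<close> lacks the factor \<open>\<bar>\<rho>\<bar>\<close>. On the imaginary axis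
  \<open>F\<close> is of smaller order than \<open>\<bar>\<rho>\<bar> powi (- m - 1) * exp (2 * d *
  \<bar>Im \<rho>\<bar>)\<close>, while a polynomial of degree \<open>k\<close> in
  \<open>lam\<close> costs \<open>\<bar>\<rho>\<bar> ^ (2 * k)\<close>. So \<open>k\<close> missing
  eigenvalues are affordable when \<open>2 * k \<le> m + 2\<close> for the first problem and
  \<open>2 * k \<le> m + 1\<close> for the second. The exponentials cancel because
  \<open>d = pi / 2\<close> cuts the interval into halves of equal length, which gives
  \<open>F\<close> and the characteristic functions the same exponential type.

  The obstacle is that \<open>q\<close> is merely integrable and complex. Derivatives of
  \<open>y'\<close> exist only almost everywhere, so solutions are handled in integrated form;
  eigenvalues may be multiple and nonreal, so common zeros are handled by local
  divisibility.\<close>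

lemma abs_continuous_on_subset:
  "abs_continuous_on S f \<Longrightarrow> T \<subseteq> S \<Longrightarrow> abs_continuous_on T f"
  unfolding abs_continuous_on_def
  by (elim all_forward imp_forward ex_forward conj_forward) (auto dest: subset_trans)

text \<open>The definition numbers its intervals by an initial segment of the naturals, whereas a
  tagged division is a finite set of pairs. Restating the condition over arbitrary finite index sets
  spares every later proof this renumbering.\<close>

lemma abs_continuous_on_finite_family:
  assumes "abs_continuous_on S f" "e > 0"
  obtains \<delta> where "\<delta> > 0"
    "\<And>(I::'i set) u v. finite I \<Longrightarrow> (\<And>i. i \<in> I \<Longrightarrow> u i \<le> v i \<and> {u i..v i} \<subseteq> S) \<Longrightarrow>
      (\<And>i j. i \<in> I \<Longrightarrow> j \<in> I \<Longrightarrow> i \<noteq> j \<Longrightarrow> {u i<..<v i} \<inter> {u j<..<v j} = {}) \<Longrightarrow>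
      (\<Sum>i\<in>I. v i - u i) < \<delta> \<Longrightarrow> (\<Sum>i\<in>I. norm (f (v i) - f (u i))) < e"
proof -
  obtain \<delta> where d0: "\<delta> > 0" and d: "\<forall>(n::nat) a b. (\<forall>i<n. a i \<le> b i \<and> {a i..b i} \<subseteq> S) \<and>
        (\<forall>i<n. \<forall>j<n. i \<noteq> j \<longrightarrow> {a i<..<b i} \<inter> {a j<..<b j} = {}) \<and>
        (\<Sum>i<n. b i - a i) < \<delta> \<longrightarrow> (\<Sum>i<n. norm (f (b i) - f (a i))) < e"
    using assms(1)[unfolded abs_continuous_on_def, THEN spec, THEN mp, OF assms(2)] by (elim exE conjE)
  show ?thesis
  proof (rule that[OF d0])
    fix I :: "'i set" and u v
    assume I: "finite I" and uv: "\<And>i. i \<in> I \<Longrightarrow> u i \<le> v i \<and> {u i..v i} \<subseteq> S"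
      and dis: "\<And>i j. i \<in> I \<Longrightarrow> j \<in> I \<Longrightarrow> i \<noteq> j \<Longrightarrow> {u i<..<v i} \<inter> {u j<..<v j} = {}"
      and s: "(\<Sum>i\<in>I. v i - u i) < \<delta>"
    obtain p where p: "bij_betw p {..<card I} I"
      using ex_bij_betw_nat_finite[OF I] by (auto simp: atLeast0LessThan)
    have re: "(\<Sum>i<card I. g (p i)) = (\<Sum>i\<in>I. g i)" for g :: "'i \<Rightarrow> real"
      by (rule sum.reindex_bij_betw[OF p])
    have pin: "p i \<in> I" if "i < card I" for i
      using p that by (auto simp: bij_betw_def)
    have pne: "p i \<noteq> p j" if "i < card I" "j < card I" "i \<noteq> j" for i j
      using p that by (auto simp: bij_betw_def inj_on_def)
    have "(\<Sum>i<card I. norm (f (v (p i)) - f (u (p i)))) < e"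
    proof (rule d[rule_format], intro conjI allI impI)
      show "(\<Sum>i<card I. v (p i) - u (p i)) < \<delta>" using s re[of "\<lambda>i. v i - u i"] by simp
    qed (use uv pin dis pne in auto)
    then show "(\<Sum>i\<in>I. norm (f (v i) - f (u i))) < e"
      using re[of "\<lambda>i. norm (f (v i) - f (u i))"] by simp
  qed
qed

text \<open>Direct gauge proof: intervals tagged in \<open>N\<close> are forced into an open set of small measure,
  where absolute continuity bounds the increments of \<open>f\<close>.\<close>

theorem abs_continuous_FTC:
  fixes f :: "real \<Rightarrow> complex"
  assumes ab: "a \<le> b" and ac: "abs_continuous_on {a..b} f" and N: "negligible N"
    and deriv: "\<And>x. x \<in> {a..b} - N \<Longrightarrow> (f has_vector_derivative g x) (at x within {a..b})"
  shows "(g has_integral f b - f a) {a..b}"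
proof -
  \<comment> \<open>With value 0 on \<open>N\<close>, an interval tagged in \<open>N\<close>
    contributes just its increment of \<open>f\<close> to the error.\<close>
  define g0 where "g0 x = (if x \<in> N then 0 else g x)" for x
  have "(g0 has_integral f b - f a) (cbox a b)"
    unfolding has_integral
  proof (intro allI impI)
    fix e :: real assume e: "e > 0"
    \<comment> \<open>Intervals tagged in \<open>N\<close> may use up \<open>e / 2\<close> in total;
      the others share \<open>e / 2\<close> in proportion to their length. The \<open>+ 1\<close>
      covers \<open>a = b\<close>.\<close>
    define e' where "e' = e / (2 * (b - a + 1))"
    have e': "e' > 0" using e ab by (simp add: e'_def)
    obtain \<delta> where d0: "\<delta> > 0" and dl:
      "\<And>(I::(real \<times> real set) set) u v. finite I \<Longrightarrow> (\<And>i. i \<in> I \<Longrightarrow> u i \<le> v i \<and> {u i..v i} \<subseteq> {a..b}) \<Longrightarrow>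
      (\<And>i j. i \<in> I \<Longrightarrow> j \<in> I \<Longrightarrow> i \<noteq> j \<Longrightarrow> {u i<..<v i} \<inter> {u j<..<v j} = {}) \<Longrightarrow>
      (\<Sum>i\<in>I. v i - u i) < \<delta> \<Longrightarrow> (\<Sum>i\<in>I. norm (f (v i) - f (u i))) < e / 2"
      by (rule abs_continuous_on_finite_family[OF ac half_gt_zero[OF e], where ?'i="real \<times> real set"]) blast
    obtain U where U: "open U" "N \<subseteq> U" "U - N \<in> lmeasurable" "emeasure lebesgue (U - N) < ennreal \<delta>"
      using sets_lebesgue_outer_open[OF negligible_imp_sets[OF N] d0] by blast
    have Ueq: "U = (U - N) \<union> N" using U by auto
    have Um: "U \<in> lmeasurable"
      by (subst Ueq) (intro fmeasurable.Un U(3) negligible_imp_measurable N)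
    have "measure lebesgue U \<le> measure lebesgue (U - N) + measure lebesgue N"
      by (subst Ueq) (intro measure_Un_le fmeasurableD U negligible_imp_measurable N)
    also have "measure lebesgue N = 0" by (rule negligible_imp_measure0[OF N])
    also have "measure lebesgue (U - N) < \<delta>"
      using U(3,4) d0 by (simp add: emeasure_eq_measure2 ennreal_less_iff)
    finally have Ud: "measure lebesgue U < \<delta>" by simp
    have "\<forall>x. \<exists>r>0. x \<in> {a..b} - N \<longrightarrow>
         (\<forall>y\<in>{a..b}. norm (y-x) < r \<longrightarrow> norm (f y - f x - (y-x) *\<^sub>R g x) \<le> e' * norm (y-x))"
      using deriv[unfolded has_vector_derivative_def has_derivative_within_alt] e' by (metis zero_less_one)
    then obtain r where r: "\<And>x. 0 < r x"
                 "\<And>x y. \<lbrakk>x \<in> {a..b} - N; y \<in> {a..b}; norm (y-x) < r x\<rbrakk>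
                        \<Longrightarrow> norm (f y - f x - (y-x) *\<^sub>R g x) \<le> e' * norm (y-x)"
      by metis
    define G where "G x = (if x \<in> N then U else ball x (r x))" for x
    show "\<exists>\<gamma>. gauge \<gamma> \<and> (\<forall>\<D>. \<D> tagged_division_of cbox a b \<and> \<gamma> fine \<D> \<longrightarrow>
          norm ((\<Sum>(x, K)\<in>\<D>. measure lborel K *\<^sub>R g0 x) - (f b - f a)) < e)"
    proof (intro exI conjI allI impI)
      show "gauge G"
        using U r by (auto simp: gauge_def G_def)
      fix D assume D: "D tagged_division_of cbox a b \<and> G fine D"
      then have tag: "D tagged_division_of cbox a b" and fine: "G fine D" by auto
      have finD: "finite D" using tag by auto
      define lo where "lo = (\<lambda>i::real \<times> real set. Inf (snd i))"
      define hi where "hi = (\<lambda>i::real \<times> real set. Sup (snd i))"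
      have K: "\<exists>u v. u \<le> v \<and> snd i = {u..v} \<and> a \<le> u \<and> v \<le> b \<and> lo i = u \<and> hi i = v \<and> fst i \<in> {u..v}
               \<and> {u..v} \<subseteq> G (fst i)"
        if "i \<in> D" for i
      proof -
        obtain x k where i: "i = (x,k)" by force
        have "x \<in> k" "k \<subseteq> cbox a b" "\<exists>a b. k = cbox a b" "k \<subseteq> G x"
          using tagged_division_ofD(2-4)[OF tag, of x k] fineD[OF fine, of x k] that by (auto simp: i)
        then obtain u v where "k = {u..v}" by auto
        with \<open>x \<in> k\<close> \<open>k \<subseteq> cbox a b\<close> \<open>k \<subseteq> G x\<close> show ?thesis
          by (intro exI[of _ u] exI[of _ v]) (auto simp: i lo_def hi_def)
      qed
      define A where "A = {i \<in> D. fst i \<in> N}"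
      define B where "B = D - A"
      have AB: "finite A" "finite B" "A \<inter> B = {}" "D = A \<union> B" using finD by (auto simp: A_def B_def)
      have disj: "interior (snd i) \<inter> interior (snd j) = {}" if "i \<in> D" "j \<in> D" "i \<noteq> j" for i j
        using tag that by (metis prod.collapse tagged_division_ofD(5))
      have disjo: "{lo i<..<hi i} \<inter> {lo j<..<hi j} = {}" if "i \<in> D" "j \<in> D" "i \<noteq> j" for i j
        using disj[OF that] K[OF that(1)] K[OF that(2)] by auto
      have sumA: "(\<Sum>i\<in>A. norm (f (hi i) - f (lo i))) < e / 2"
      proof (rule dl)
        show "finite A" by fact
        show "lo i \<le> hi i \<and> {lo i..hi i} \<subseteq> {a..b}" if "i \<in> A" for i
          using K[of i] that by (auto simp: A_def)
        show "{lo i<..<hi i} \<inter> {lo j<..<hi j} = {}" if "i \<in> A" "j \<in> A" "i \<noteq> j" for i j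
          using disjo that by (auto simp: A_def)
        have "(\<Sum>i\<in>A. hi i - lo i) = (\<Sum>i\<in>A. measure lebesgue {lo i<..<hi i})"
          by (rule sum.cong) (use K in \<open>auto simp: A_def\<close>)
        also have "\<dots> = measure lebesgue (\<Union>i\<in>A. {lo i<..<hi i})"
        proof (rule measure_negligible_finite_Union_image[symmetric])
          show "pairwise (\<lambda>x y. negligible ({lo x<..<hi x} \<inter> {lo y<..<hi y})) A"
            unfolding pairwise_def using disjo by (simp add: A_def)
        qed (use AB in \<open>auto intro: lmeasurable_interval\<close>)
        also have "\<dots> \<le> measure lebesgue U"
        proof (rule measure_mono_fmeasurable)
          show "(\<Union>i\<in>A. {lo i<..<hi i}) \<subseteq> U"
          proof (clarify)
            fix x i assume "(i::real \<times> real set) \<in> A" "x \<in> {lo i<..<hi i}"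
            then show "x \<in> U" using K[of i] by (force simp: A_def G_def)
          qed
          show "(\<Union>i\<in>A. {lo i<..<hi i}) \<in> sets lebesgue" using AB by auto
        qed fact
        finally show "(\<Sum>i\<in>A. hi i - lo i) < \<delta>" using Ud by simp
      qed
      have eB: "norm (measure lborel (snd i) *\<^sub>R g0 (fst i) - (f (hi i) - f (lo i))) \<le> e' * (hi i - lo i)" if iB: "i \<in> B" for i
      proof -
        have iD: "i \<in> D" and nN: "fst i \<notin> N" using iB by (auto simp: B_def A_def)
        obtain u v where uv: "u \<le> v" "snd i = {u..v}" "a \<le> u" "v \<le> b" "lo i = u" "hi i = v" "fst i \<in> {u..v}"
               "{u..v} \<subseteq> G (fst i)" using K[OF iD] by blast
        let ?x = "fst i"
        have xab: "?x \<in> {a..b} - N" using uv nN by auto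
        have ub: "norm (u - ?x) < r ?x" "norm (v - ?x) < r ?x"
        proof -
          have "u \<in> G ?x" "v \<in> G ?x" using uv(1,8) by (meson atLeastAtMost_iff order_refl subsetD)+
          then have "u \<in> ball ?x (r ?x)" "v \<in> ball ?x (r ?x)" using nN by (simp_all add: G_def)
          then show "norm (u - ?x) < r ?x" "norm (v - ?x) < r ?x" by (auto simp: dist_real_def)
        qed
        \<comment> \<open>Both endpoints are compared with the tag. As the tag lies between them,
          the two errors add up to \<open>e' * (v - u)\<close>.\<close>
        have "norm (measure lborel (snd i) *\<^sub>R g0 ?x - (f v - f u))
            = norm ((f u - f ?x - (u - ?x) *\<^sub>R g ?x) - (f v - f ?x - (v - ?x) *\<^sub>R g ?x))"
          using uv nN by (simp add: g0_def algebra_simps)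
        also have "\<dots> \<le> norm (f u - f ?x - (u - ?x) *\<^sub>R g ?x) + norm (f v - f ?x - (v - ?x) *\<^sub>R g ?x)"
          by (rule norm_triangle_ineq4)
        also have "\<dots> \<le> e' * norm (u - ?x) + e' * norm (v - ?x)"
          by (intro add_mono r(2) xab ub) (use uv in auto)
        also have "\<dots> = e' * (v - u)" using uv by (auto simp: algebra_simps)
        finally show ?thesis using uv by simp
      qed
      have tel: "(\<Sum>i\<in>D. f (hi i) - f (lo i)) = f b - f a" "(\<Sum>i\<in>D. hi i - lo i) = b - a"
        using additive_tagged_division_1[of a b D f] additive_tagged_division_1[of a b D "\<lambda>x. x"] ab tag
        by (simp_all add: split_def lo_def hi_def)
      have "(\<Sum>(x, K)\<in>D. measure lborel K *\<^sub>R g0 x) - (f b - f a)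
          = (\<Sum>i\<in>D. measure lborel (snd i) *\<^sub>R g0 (fst i) - (f (hi i) - f (lo i)))"
        by (simp only: split_def tel(1)[symmetric] sum_subtractf)
      also have "\<dots> = (\<Sum>i\<in>A. - (f (hi i) - f (lo i))) + (\<Sum>i\<in>B. measure lborel (snd i) *\<^sub>R g0 (fst i) - (f (hi i) - f (lo i)))"
        unfolding AB(4) sum.union_disjoint[OF AB(1-3)]
        by (intro arg_cong2[where f="(+)"] sum.cong) (auto simp: A_def g0_def)
      finally have eq: "(\<Sum>(x, K)\<in>D. measure lborel K *\<^sub>R g0 x) - (f b - f a) = \<dots>" .
      have "norm (\<Sum>i\<in>A. - (f (hi i) - f (lo i))) \<le> (\<Sum>i\<in>A. norm (f (hi i) - f (lo i)))"
        by (rule sum_norm_le) (simp add: norm_minus_commute)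
      moreover have "norm (\<Sum>i\<in>B. measure lborel (snd i) *\<^sub>R g0 (fst i) - (f (hi i) - f (lo i))) \<le> (\<Sum>i\<in>B. e' * (hi i - lo i))"
        by (rule sum_norm_le) (use eB in auto)
      moreover have "(\<Sum>i\<in>B. e' * (hi i - lo i)) \<le> (\<Sum>i\<in>D. e' * (hi i - lo i))"
        by (rule sum_mono2) (use finD e' K in \<open>fastforce simp: B_def\<close>)+
      moreover have "(\<Sum>i\<in>D. e' * (hi i - lo i)) = e' * (b - a)"
        using tel by (simp add: sum_distrib_left[symmetric])
      moreover have "e' * (b - a) \<le> e / 2" unfolding e'_def using e ab by (simp add: field_simps)
      ultimately show "norm ((\<Sum>(x, K)\<in>D. measure lborel K *\<^sub>R g0 x) - (f b - f a)) < e"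
        unfolding eq using sumA by (intro le_less_trans[OF norm_triangle_ineq]) linarith
    qed
  qed
  then have "(g0 has_integral f b - f a) {a..b}" by simp
  then show ?thesis
    by (rule has_integral_spike[OF N, rotated]) (auto simp: g0_def)
qed

text \<open>The excess of \<open>g\<close> over the level \<open>k\<close> tends to 0 pointwise and
  is dominated by \<open>g\<close>. This splits an integrable function into a bounded part and a
  part of small integral.\<close>

lemma integral_tail_above_level:
  fixes g :: "real \<Rightarrow> real"
  assumes g: "g integrable_on {a..b}" and pos: "\<And>x. x \<in> {a..b} \<Longrightarrow> 0 \<le> g x" and e: "e > 0"
  obtains k :: nat where "(\<lambda>x. g x - min (g x) k) integrable_on {a..b}"
    "integral {a..b} (\<lambda>x. g x - min (g x) k) < e"
proof -
  have ga: "g absolutely_integrable_on {a..b}"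
    by (rule nonnegative_absolutely_integrable_1[OF g pos])
  have int: "(\<lambda>x. g x - min (g x) (real k)) integrable_on {a..b}" for k
    by (rule integrable_diff[OF g set_lebesgue_integral_eq_integral(1)[OF absolutely_integrable_min_1[OF ga]]])
      (simp add: absolutely_integrable_on_const)
  have "(\<lambda>k. integral {a..b} (\<lambda>x. g x - min (g x) (real k))) \<longlonglongrightarrow> integral {a..b} (\<lambda>x. 0)"
  proof (rule dominated_convergence(2)[OF int g])
    show "(\<lambda>k. g x - min (g x) (real k)) \<longlonglongrightarrow> 0" if "x \<in> {a..b}" for x
    proof (rule tendsto_eventually)
      obtain K :: nat where "g x \<le> real K" using real_arch_simple by blast
      then show "\<forall>\<^sub>F k in sequentially. g x - min (g x) (real k) = 0"
        by (intro eventually_sequentiallyI[of K]) (auto simp: min_def)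
    qed
  qed (use pos in auto)
  then have "(\<lambda>k. integral {a..b} (\<lambda>x. g x - min (g x) (real k))) \<longlonglongrightarrow> 0" by simp
  from order_tendstoD(2)[OF this e] obtain k where "integral {a..b} (\<lambda>x. g x - min (g x) (real k)) < e"
    using eventually_happens'[OF sequentially_bot] by blast
  with int show ?thesis by (rule that)
qed

text \<open>Split \<open>g\<close> at a high level \<open>k\<close>. On disjoint intervals the
  excess \<open>w\<close> contributes at most its small total integral, and the bounded part at most
  \<open>k\<close> times the total length; hence \<open>\<delta> = e / (2 * (k + 1))\<close>, with
  \<open>+ 1\<close> because \<open>k\<close> may be 0.\<close>

lemma abs_continuous_on_dominated:
  fixes F :: "real \<Rightarrow> complex" and g :: "real \<Rightarrow> real"
  assumes g: "g integrable_on {a..b}" and pos: "\<And>x. x \<in> {a..b} \<Longrightarrow> 0 \<le> g x"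
    and dom: "\<And>u v. a \<le> u \<Longrightarrow> u \<le> v \<Longrightarrow> v \<le> b \<Longrightarrow> norm (F v - F u) \<le> integral {u..v} g"
  shows "abs_continuous_on {a..b} F"
  unfolding abs_continuous_on_def
proof (intro allI impI)
  fix e :: real assume e: "e > 0"
  obtain k :: nat where k: "(\<lambda>x. g x - min (g x) k) integrable_on {a..b}"
    "integral {a..b} (\<lambda>x. g x - min (g x) k) < e/2"
    using integral_tail_above_level[OF g pos, of "e/2"] e by auto
  define w where "w x = g x - min (g x) (real k)" for x
  have wpos: "0 \<le> w x" for x by (simp add: w_def)
  have wint: "w integrable_on {a..b}" using k(1) unfolding w_def .
  show "\<exists>\<delta>>0. \<forall>(n::nat) u v. (\<forall>i<n. u i \<le> v i \<and> {u i..v i} \<subseteq> {a..b}) \<and>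
        (\<forall>i<n. \<forall>j<n. i \<noteq> j \<longrightarrow> {u i<..<v i} \<inter> {u j<..<v j} = {}) \<and>
        (\<Sum>i<n. v i - u i) < \<delta> \<longrightarrow> (\<Sum>i<n. norm (F (v i) - F (u i))) < e"
  proof (intro exI[of _ "e / (2 * (real k + 1))"] conjI allI impI)
    show "e / (2 * (real k + 1)) > 0" using e by (auto intro!: divide_pos_pos)
    fix n :: nat and u v :: "nat \<Rightarrow> real"
    assume H: "(\<forall>i<n. u i \<le> v i \<and> {u i..v i} \<subseteq> {a..b}) \<and>
        (\<forall>i<n. \<forall>j<n. i \<noteq> j \<longrightarrow> {u i<..<v i} \<inter> {u j<..<v j} = {}) \<and>
        (\<Sum>i<n. v i - u i) < e / (2 * (real k + 1))"
    have uv: "u i \<le> v i" "a \<le> u i" "v i \<le> b" if "i < n" for i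
    proof -
      have "u i \<le> v i" "{u i..v i} \<subseteq> {a..b}" using H that by auto
      then show "u i \<le> v i" "a \<le> u i" "v i \<le> b" by auto
    qed
    have dis: "{u i<..<v i} \<inter> {u j<..<v j} = {}" if "i < n" "j < n" "i \<noteq> j" for i j using H that by blast
    have wi: "w integrable_on {u i..v i}" if "i < n" for i
      by (rule integrable_on_subinterval[OF wint]) (use uv[OF that] in auto)
    have gi: "g integrable_on {u i..v i}" if "i < n" for i
      by (rule integrable_on_subinterval[OF g]) (use uv[OF that] in auto)
    have "norm (F (v i) - F (u i)) \<le> integral {u i..v i} w + real k * (v i - u i)" if i: "i < n" for i
    proof -
      have "norm (F (v i) - F (u i)) \<le> integral {u i..v i} g" using dom uv[OF i] by auto
      also have "\<dots> \<le> integral {u i..v i} (\<lambda>x. w x + real k)"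
        by (rule integral_le[OF gi[OF i] integrable_add[OF wi[OF i]]]) (auto simp: w_def)
      also have "\<dots> = integral {u i..v i} w + real k * (v i - u i)"
        using wi[OF i] uv[OF i] by (subst integral_add) auto
      finally show ?thesis .
    qed
    then have "(\<Sum>i<n. norm (F (v i) - F (u i))) \<le> (\<Sum>i<n. integral {u i..v i} w + real k * (v i - u i))"
      by (intro sum_mono) auto
    also have "\<dots> = (\<Sum>i<n. integral {u i..v i} w) + real k * (\<Sum>i<n. v i - u i)"
      by (simp add: sum.distrib sum_distrib_left)
    finally have 1: "(\<Sum>i<n. norm (F (v i) - F (u i))) \<le> \<dots>" .
    \<comment> \<open>Only the open intervals are disjoint, so the integrals are moved to them
      before the integrands are added up pointwise.\<close>
    have hI: "((\<lambda>x. if x \<in> {u i<..<v i} then w x else 0) has_integral integral {u i..v i} w) {a..b}" if i: "i < n" for i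
    proof -
      have "(w has_integral integral {u i..v i} w) {u i<..<v i}"
        using integrable_integral[OF wi[OF i]] by (simp add: has_integral_Icc_iff_Ioo)
      then show ?thesis
        by (subst has_integral_restrict) (use uv[OF i] in auto)
    qed
    have "(\<Sum>i<n. integral {u i..v i} w) \<le> integral {a..b} w"
    proof (rule has_integral_le)
      show "((\<lambda>x. \<Sum>i<n. if x \<in> {u i<..<v i} then w x else 0) has_integral (\<Sum>i<n. integral {u i..v i} w)) {a..b}"
        by (rule has_integral_sum) (use hI in auto)
      show "(w has_integral integral {a..b} w) {a..b}" using wint by blast
      fix x assume "x \<in> {a..b}"
      show "(\<Sum>i<n. if x \<in> {u i<..<v i} then w x else 0) \<le> w x"
      proof (cases "\<exists>j<n. x \<in> {u j<..<v j}")
        case True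
        then obtain j where j: "j < n" "x \<in> {u j<..<v j}" by auto
        have "(\<Sum>i<n. if x \<in> {u i<..<v i} then w x else 0) = (\<Sum>i<n. if i = j then w x else 0)"
        proof (rule sum.cong[OF refl])
          fix i assume i: "i \<in> {..<n}"
          show "(if x \<in> {u i<..<v i} then w x else 0) = (if i = j then w x else 0)"
            using dis[of i j] i j by (cases "i = j") auto
        qed
        then show ?thesis using j by simp
      next
        case False
        then have "(\<Sum>i<n. if x \<in> {u i<..<v i} then w x else 0) = 0" by (intro sum.neutral) auto
        then show ?thesis using wpos by simp
      qed
    qed
    also have "\<dots> < e / 2" using k by (simp add: w_def[abs_def])
    finally have 2: "(\<Sum>i<n. integral {u i..v i} w) < e / 2" .
    have s0: "0 \<le> (\<Sum>i<n. v i - u i)" by (rule sum_nonneg) (use uv in auto)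
    have "real k * (\<Sum>i<n. v i - u i) \<le> (real k + 1) * (\<Sum>i<n. v i - u i)"
      using s0 by (intro mult_right_mono) auto
    also have "\<dots> \<le> (real k + 1) * (e / (2 * (real k + 1)))"
      using H by (intro mult_left_mono) auto
    also have "\<dots> = e / 2" by (simp add: field_simps)
    finally show "(\<Sum>i<n. norm (F (v i) - F (u i))) < e" using 1 2 by linarith
  qed
qed

text \<open>By Vitali, disjoint intervals on which the difference quotient is off by more than
  \<open>1 / (k + 1)\<close> cover the bad set; the Henstock lemma bounds their total length.\<close>

theorem indefinite_integral_has_derivative_ae:
  fixes f :: "real \<Rightarrow> complex"
  assumes f: "f integrable_on {a..b}"
  shows "negligible {x \<in> {a..b}. \<not> ((\<lambda>u. integral {a..u} f) has_vector_derivative f x) (at x within {a..b})}"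
    (is "negligible ?bad")
proof -
  define F where "F u = integral {a..u} f" for u
  define E where "E k = {x \<in> {a..b}. \<forall>\<delta>>0. \<exists>y\<in>{a..b}. 0 < \<bar>y - x\<bar> \<and> \<bar>y - x\<bar> < \<delta> \<and>
      norm (F y - F x - (y - x) *\<^sub>R f x) > \<bar>y - x\<bar> / (real k + 1)}" for k :: nat
  have Fdiff: "integral {u..v} f = F v - F u" if "a \<le> u" "u \<le> v" "v \<le> b" for u v
    using Henstock_Kurzweil_Integration.integral_combine[of a u v f] that integrable_on_subinterval[OF f, of a v]
    by (auto simp: F_def algebra_simps)
  have "negligible (E k)" for k
    unfolding negligible_outer_le
  proof (intro allI impI)
    fix e :: real assume e: "e > 0"
    have "e / (real k + 1) > 0" using e by (auto intro!: divide_pos_pos)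
    then obtain \<gamma> where \<gamma>: "gauge \<gamma>" and hen: "\<And>p. \<lbrakk>p tagged_partial_division_of (cbox a b); \<gamma> fine p\<rbrakk> \<Longrightarrow>
             (\<Sum>(x,K)\<in>p. norm (measure lborel K *\<^sub>R f x - integral K f)) < e / (real k + 1)"
      by (rule Henstock_lemma[OF f[folded box_real(2)]]) blast
    \<comment> \<open>An index is a pair of a tag \<open>x\<close> and a point \<open>y\<close>
      witnessing the bad quotient at \<open>x\<close>. \<open>J\<close> is the closed interval with
      these endpoints, written as a ball to fit the covering theorem.\<close>
    define c where "c = (\<lambda>i::real\<times>real. (fst i + snd i) / 2)"
    define r where "r = (\<lambda>i::real\<times>real. \<bar>snd i - fst i\<bar> / 2)"
    define J where "J = (\<lambda>i. cball (c i) (r i))"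
    have cb: "J i = {min (fst i) (snd i)..max (fst i) (snd i)}" for i
      by (auto simp: J_def c_def r_def dist_real_def min_def max_def abs_if field_simps split: if_splits)
    define X where "X = {i. fst i \<in> {a..b} \<and> snd i \<in> {a..b} \<and> fst i \<noteq> snd i \<and> J i \<subseteq> \<gamma> (fst i) \<and>
       norm (F (snd i) - F (fst i) - (snd i - fst i) *\<^sub>R f (fst i)) > \<bar>snd i - fst i\<bar> / (real k + 1)}"
    have fine_cover: "\<exists>i. i \<in> X \<and> x \<in> J i \<and> r i < d" if x: "x \<in> E k" and d: "0 < d" for x d
    proof -
      obtain t where t: "t > 0" "ball x t \<subseteq> \<gamma> x"
        using \<gamma> unfolding gauge_def by (meson openE)
      have "min t d > 0" using t d by auto
      with x obtain y where y: "y \<in> {a..b}" "0 < \<bar>y - x\<bar>" "\<bar>y - x\<bar> < min t d"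
        "norm (F y - F x - (y - x) *\<^sub>R f x) > \<bar>y - x\<bar> / (real k + 1)"
        unfolding E_def by blast
      have "J (x,y) \<subseteq> ball x t"
        unfolding cb using y by (auto simp: dist_real_def)
      then have "(x,y) \<in> X" using x y t by (auto simp: X_def E_def)
      moreover have "x \<in> J (x,y)" unfolding cb by auto
      moreover have "r (x,y) < d" using y d by (simp add: r_def)
      ultimately show ?thesis by blast
    qed
    have rpos: "0 < r i" if "i \<in> X" for i using that by (auto simp: X_def r_def)
    obtain C where C: "countable C" "C \<subseteq> X"
     "pairwise (\<lambda>i j. disjnt (J i) (J j)) C"
     "negligible (E k - (\<Union>i \<in> C. J i))"
      unfolding J_def by (rule Vitali_covering_theorem_cballs[OF rpos fine_cover[unfolded J_def]])
    define T where "T = (\<Union>i \<in> C. J i)"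
    have fin: "measure lebesgue (\<Union>i\<in>D. J i) \<le> e" if D: "finite D" "D \<subseteq> C" for D
    proof -
      \<comment> \<open>Different indices have disjoint intervals and each interval contains its
        tag, so no tagged interval arises twice and a sum over \<open>D\<close> is a Henstock
        sum.\<close>
      have inj: "inj_on (\<lambda>i. (fst i, J i)) D"
      proof (rule inj_onI)
        fix i j assume ij: "i \<in> D" "j \<in> D" "(fst i, J i) = (fst j, J j)"
        show "i = j"
        proof (rule ccontr)
          assume "i \<noteq> j"
          then have "disjnt (J i) (J j)"
            using pairwiseD[OF C(3), of i j] D(2) ij(1,2) by blast
          moreover have "fst i \<in> J i" unfolding cb by auto
          ultimately show False using ij(3) by (simp add: disjnt_iff)
        qed
      qed
      let ?p = "(\<lambda>i. (fst i, J i)) ` D"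
      have tag: "?p tagged_partial_division_of (cbox a b)"
        unfolding tagged_partial_division_of_def
      proof (intro conjI allI impI)
        show "finite ?p" using D by auto
        show "x \<in> K" "K \<subseteq> cbox a b" "\<exists>a b. K = cbox a b" if "(x,K) \<in> ?p" for x K
        proof -
          obtain i where i: "i \<in> D" "x = fst i" "K = J i" using \<open>(x,K) \<in> ?p\<close> by auto
          have "i \<in> X" using i D C by auto
          then show "x \<in> K" "K \<subseteq> cbox a b" using i unfolding cb X_def by auto
          show "\<exists>a b. K = cbox a b" using i unfolding cb by (metis box_real(2))
        qed
        show "interior K1 \<inter> interior K2 = {}"
          if H: "(x1, K1) \<in> ?p \<and> (x2, K2) \<in> ?p \<and> (x1, K1) \<noteq> (x2, K2)" for x1 K1 x2 K2
        proof -
          obtain i j where ij: "i \<in> D" "j \<in> D" "i \<noteq> j" "K1 = J i" "K2 = J j"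
            using H by auto
          then have "disjnt K1 K2" using pairwiseD[OF C(3), of i j] D(2) by blast
          then show ?thesis using interior_subset[of K1] interior_subset[of K2] by (auto simp: disjnt_def)
        qed
      qed
      have fine: "\<gamma> fine ?p" using D C by (force simp: fine_def X_def)
      have est: "\<bar>snd i - fst i\<bar> / (real k + 1) \<le> norm (measure lborel (J i) *\<^sub>R f (fst i) - integral (J i) f)"
        if "i \<in> D" for i
      proof -
        have iX: "i \<in> X" using that D C by auto
        show ?thesis
        proof (cases "fst i \<le> snd i")
          case True
          then have "J i = {fst i..snd i}" unfolding cb by auto
          moreover have "integral {fst i..snd i} f = F (snd i) - F (fst i)"
            by (rule Fdiff) (use iX True in \<open>auto simp: X_def\<close>)
          ultimately show ?thesis using iX True
            by (simp add: X_def norm_minus_commute)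
        next
          case False
          then have Ji: "J i = {snd i..fst i}" unfolding cb by auto
          have Fi: "integral {snd i..fst i} f = F (fst i) - F (snd i)"
            by (rule Fdiff) (use iX False in \<open>auto simp: X_def\<close>)
          have mi: "measure lborel {snd i..fst i} *\<^sub>R f (fst i) - (F (fst i) - F (snd i)) = F (snd i) - F (fst i) - (snd i - fst i) *\<^sub>R f (fst i)"
            using False by (simp add: algebra_simps)
          show ?thesis using iX unfolding Ji Fi mi by (simp add: X_def)
        qed
      qed
      have "measure lebesgue (\<Union>i\<in>D. J i) \<le> (\<Sum>i\<in>D. measure lebesgue (J i))"
        by (rule measure_UNION_le[OF D(1)]) (simp add: J_def)
      also have "\<dots> = (\<Sum>i\<in>D. \<bar>snd i - fst i\<bar>)"
        unfolding cb by (intro sum.cong) (auto simp: min_def max_def)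
      also have "\<dots> = (real k + 1) * (\<Sum>i\<in>D. \<bar>snd i - fst i\<bar> / (real k + 1))"
        unfolding sum_divide_distrib[symmetric] by (simp add: field_simps)
      also have "\<dots> \<le> (real k + 1) * (\<Sum>i\<in>D. norm (measure lborel (J i) *\<^sub>R f (fst i) - integral (J i) f))"
        by (intro mult_left_mono sum_mono est) auto
      also have "(\<Sum>i\<in>D. norm (measure lborel (J i) *\<^sub>R f (fst i) - integral (J i) f))
          = (\<Sum>(x,K)\<in>?p. norm (measure lborel K *\<^sub>R f x - integral K f))"
        by (subst sum.reindex[OF inj]) (simp add: o_def)
      also have "(real k + 1) * \<dots> \<le> (real k + 1) * (e / (real k + 1))"
        by (intro mult_left_mono less_imp_le hen tag fine) auto
      finally show ?thesis by simp
    qed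
    have Tm: "T \<in> lmeasurable" "measure lebesgue T \<le> e"
      unfolding T_def by (rule fmeasurable_UN_bound[OF C(1) _ fin] measure_UN_bound[OF C(1) _ fin]; simp add: J_def)+
    show "\<exists>T. E k \<subseteq> T \<and> T \<in> lmeasurable \<and> measure lebesgue T \<le> e"
    proof (intro exI conjI)
      show "E k \<subseteq> (E k - T) \<union> T" by auto
      have n: "negligible (E k - T)" using C(4) by (simp add: T_def)
      show "(E k - T) \<union> T \<in> lmeasurable"
        by (intro fmeasurable.Un Tm negligible_imp_measurable n)
      have "measure lebesgue ((E k - T) \<union> T) \<le> measure lebesgue (E k - T) + measure lebesgue T"
        by (intro measure_Un_le fmeasurableD Tm negligible_imp_measurable n)
      then show "measure lebesgue ((E k - T) \<union> T) \<le> e"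
        using Tm negligible_imp_measure0[OF n] by simp
    qed
  qed
  then have "negligible (\<Union>k. E k)" by (intro negligible_countable_Union) auto
  moreover have "?bad \<subseteq> (\<Union>k. E k)"
  proof
    fix x assume x: "x \<in> ?bad"
    then have xab: "x \<in> {a..b}" and nd: "\<not> (F has_vector_derivative f x) (at x within {a..b})"
      by (auto simp: F_def[abs_def])
    obtain \<epsilon> where eps: "\<epsilon> > 0" and H: "\<And>d. d > 0 \<Longrightarrow> \<exists>y\<in>{a..b}. norm (y - x) < d \<and> norm (F y - F x - (y-x) *\<^sub>R f x) > \<epsilon> * norm (y-x)"
      using nd unfolding has_vector_derivative_def has_derivative_within_alt
      by (auto simp: bounded_linear_scaleR_left not_le Bex_def) 
    obtain k :: nat where k: "1 / (real k + 1) < \<epsilon>" using eps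
      by (metis add.commute nat_approx_posE of_nat_Suc)
    have "x \<in> E k"
      unfolding E_def
    proof (intro CollectI conjI allI impI xab)
      fix d :: real assume "d > 0"
      then obtain y where y: "y\<in>{a..b}" "norm (y - x) < d" "norm (F y - F x - (y-x) *\<^sub>R f x) > \<epsilon> * norm (y-x)"
        using H by blast
      have ne: "y \<noteq> x" using y(3) by auto
      have "\<bar>y - x\<bar> / (real k + 1) \<le> \<epsilon> * norm (y - x)"
        using mult_right_mono[OF less_imp_le[OF k], of "\<bar>y - x\<bar>"] by simp
      with y ne show "\<exists>y\<in>{a..b}. 0 < \<bar>y - x\<bar> \<and> \<bar>y - x\<bar> < d \<and> \<bar>y - x\<bar> / (real k + 1) < norm (F y - F x - (y - x) *\<^sub>R f x)"
        by (intro bexI[of _ y]) auto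
    qed
    then show "x \<in> (\<Union>k. E k)" by blast
  qed
  ultimately show ?thesis by (rule negligible_subset)
qed

section \<open>Indefinite integrals\<close>

lemma absolutely_integrable_continuous_mult:
  fixes f g :: "real \<Rightarrow> complex"
  assumes "continuous_on {a..b} f" "g absolutely_integrable_on {a..b}"
  shows "(\<lambda>x. f x * g x) absolutely_integrable_on {a..b}"
proof (rule absolutely_integrable_bounded_measurable_product[of "(*)"])
  show "f \<in> borel_measurable (lebesgue_on {a..b})"
    using assms(1) by (intro continuous_imp_measurable_on_sets_lebesgue) auto
  show "bounded (f ` {a..b})"
    using assms(1) by (intro compact_imp_bounded compact_continuous_image) auto
qed (use assms bilinear_times in auto)

lemma absolutely_integrable_continuous_mult':
  fixes f g :: "real \<Rightarrow> complex"
  assumes "continuous_on {a..b} f" "g absolutely_integrable_on {a..b}"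
  shows "(\<lambda>x. g x * f x) absolutely_integrable_on {a..b}"
  using absolutely_integrable_continuous_mult[OF assms] by (simp add: mult.commute)

lemma absolutely_integrable_norm':
  fixes f :: "real \<Rightarrow> complex"
  shows "f absolutely_integrable_on S \<Longrightarrow> (\<lambda>x. norm (f x)) integrable_on S"
  using absolutely_integrable_on_def by blast

text \<open>Absolutely continuous functions, carried together with a fixed representative of the
  derivative. The calculus rules can then name the derivative by a formula, and null sets show up
  only when a derivative is read off pointwise or exchanged for another representative.\<close>

definition indef_integral :: "real \<Rightarrow> real \<Rightarrow> (real \<Rightarrow> complex) \<Rightarrow> (real \<Rightarrow> complex) \<Rightarrow> bool" where
  "indef_integral a b f f' \<longleftrightarrow>
     f' absolutely_integrable_on {a..b} \<and> (\<forall>x\<in>{a..b}. f x = f a + integral {a..x} f')"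

lemma indef_integral_abs_integrable:
  "indef_integral a b f f' \<Longrightarrow> f' absolutely_integrable_on {a..b}"
  by (simp add: indef_integral_def)

lemma indef_integral_integrable:
  "indef_integral a b f f' \<Longrightarrow> f' integrable_on {a..b}"
  by (simp add: indef_integral_def absolutely_integrable_on_def)

lemma indef_integral_eq:
  "indef_integral a b f f' \<Longrightarrow> x \<in> {a..b} \<Longrightarrow> f x = f a + integral {a..x} f'"
  unfolding indef_integral_def by blast

lemma indef_integral_has_integral:
  assumes "indef_integral a b f f'" "a \<le> u" "u \<le> v" "v \<le> b"
  shows "(f' has_integral (f v - f u)) {u..v}"
proof -
  have f': "f' integrable_on {a..b}" by (rule indef_integral_integrable[OF assms(1)])
  have "f' integrable_on {a..v}" "f' integrable_on {u..v}"
    using assms(2-4) by (auto intro: integrable_on_subinterval[OF f'])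
  then have "integral {a..u} f' + integral {u..v} f' = integral {a..v} f'"
    using assms by (intro Henstock_Kurzweil_Integration.integral_combine) auto
  moreover have "f v = f a + integral {a..v} f'" "f u = f a + integral {a..u} f'"
    using assms by (auto intro: indef_integral_eq[OF assms(1)])
  ultimately have "integral {u..v} f' = f v - f u" by (simp add: algebra_simps)
  with \<open>f' integrable_on {u..v}\<close> show ?thesis by (metis integrable_integral)
qed

lemma indef_integralI:
  assumes "f' absolutely_integrable_on {a..b}" "\<And>x. x \<in> {a..b} \<Longrightarrow> (f' has_integral (f x - f a)) {a..x}"
  shows "indef_integral a b f f'"
  unfolding indef_integral_def
proof (intro conjI ballI)
  fix x assume "x \<in> {a..b}"
  with assms(2) have "integral {a..x} f' = f x - f a" by blast
  then show "f x = f a + integral {a..x} f'" by simp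
qed fact

lemma indef_integral_of_integral:
  assumes "f absolutely_integrable_on {a..b}"
  shows "indef_integral a b (\<lambda>x. c + integral {a..x} f) f"
  using assms by (simp add: indef_integral_def)

lemma indef_integral_continuous:
  assumes "indef_integral a b f f'" shows "continuous_on {a..b} f"
proof -
  have "continuous_on {a..b} (\<lambda>x. f a + integral {a..x} f')"
    using assms by (intro continuous_intros indefinite_integral_continuous_1 indef_integral_integrable)
  then show ?thesis
    by (rule continuous_on_eq) (rule indef_integral_eq[OF assms, symmetric])
qed

lemma indef_integral_bound:
  assumes "indef_integral a b f f'" "a \<le> u" "u \<le> v" "v \<le> b"
  shows "norm (f v - f u) \<le> integral {u..v} (\<lambda>x. norm (f' x))"
proof -
  have hi: "(f' has_integral (f v - f u)) {u..v}" by (rule indef_integral_has_integral[OF assms])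
  have "f' absolutely_integrable_on {u..v}"
    by (rule absolutely_integrable_on_subinterval[OF indef_integral_abs_integrable[OF assms(1)]]) (use assms(2-) in auto)
  then have "norm (integral {u..v} f') \<le> integral {u..v} (\<lambda>x. norm (f' x))"
    by (intro integral_norm_bound_integral absolutely_integrable_norm' absolutely_integrable_imp_integrable)
      (auto intro: set_lebesgue_integral_eq_integral)
  then show ?thesis using integral_unique[OF hi] by simp
qed

lemma indef_integral_AC:
  assumes "indef_integral a b f f'" shows "abs_continuous_on {a..b} f"
proof (rule abs_continuous_on_dominated)
  show "(\<lambda>x. norm (f' x)) integrable_on {a..b}"
    by (intro absolutely_integrable_norm' indef_integral_abs_integrable[OF assms])
  show "norm (f v - f u) \<le> integral {u..v} (\<lambda>x. norm (f' x))" if "a \<le> u" "u \<le> v" "v \<le> b" for u v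
    by (rule indef_integral_bound[OF assms that])
qed auto

lemma indef_integral_deriv_ae:
  assumes "indef_integral a b f f'"
  obtains N where "negligible N"
    "\<And>x. x \<in> {a..b} - N \<Longrightarrow> (f has_vector_derivative f' x) (at x within {a..b})"
proof -
  let ?N = "{x \<in> {a..b}. \<not> ((\<lambda>u. integral {a..u} f') has_vector_derivative f' x) (at x within {a..b})}"
  show ?thesis
  proof
    show "negligible ?N"
      by (rule indefinite_integral_has_derivative_ae) (rule indef_integral_integrable[OF assms])
    fix x assume x: "x \<in> {a..b} - ?N"
    then have "((\<lambda>u. f a + integral {a..u} f') has_vector_derivative 0 + f' x) (at x within {a..b})"
      by (intro has_vector_derivative_add has_vector_derivative_const) auto
    then show "(f has_vector_derivative f' x) (at x within {a..b})"
      by (intro has_vector_derivative_transform[of x "{a..b}" f "\<lambda>u. f a + integral {a..u} f'"])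
        (use x in \<open>auto intro: indef_integral_eq[OF assms]\<close>)
  qed
qed

text \<open>The entrance from the epsilon-delta notion of the definitions:
  \<open>abs_continuous_FTC\<close>, applied on each \<open>{a..x}\<close>, recovers
  \<open>f\<close> from its almost-everywhere derivative.\<close>

lemma indef_integral_AC_I:
  assumes ac: "abs_continuous_on {a..b} f" and N: "negligible N"
    and deriv: "\<And>x. x \<in> {a..b} - N \<Longrightarrow> (f has_vector_derivative f' x) (at x within {a..b})"
    and f': "f' absolutely_integrable_on {a..b}"
  shows "indef_integral a b f f'"
proof (rule indef_integralI[OF f'])
  fix x assume x: "x \<in> {a..b}"
  show "(f' has_integral (f x - f a)) {a..x}"
  proof (rule abs_continuous_FTC[OF _ _ N])
    show "abs_continuous_on {a..x} f" by (rule abs_continuous_on_subset[OF ac]) (use x in auto)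
    show "(f has_vector_derivative f' t) (at t within {a..x})" if "t \<in> {a..x} - N" for t
      by (rule has_vector_derivative_within_subset[OF deriv]) (use x that in auto)
  qed (use x in auto)
qed

text \<open>Off two null sets the pointwise product rule applies, so the point is absolute
  continuity of the product. It follows from a common bound \<open>M\<close> of the factors, which
  dominates increments by \<open>M * (norm f' + norm g')\<close>. This is the integration by parts
  of all that follows.\<close>

lemma indef_integral_mult:
  assumes f: "indef_integral a b f f'" and g: "indef_integral a b g g'"
  shows "indef_integral a b (\<lambda>x. f x * g x) (\<lambda>x. f' x * g x + f x * g' x)"
proof -
  obtain N1 where N1: "negligible N1" "\<And>x. x \<in> {a..b} - N1 \<Longrightarrow> (f has_vector_derivative f' x) (at x within {a..b})"
    by (rule indef_integral_deriv_ae[OF f]) blast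
  obtain N2 where N2: "negligible N2" "\<And>x. x \<in> {a..b} - N2 \<Longrightarrow> (g has_vector_derivative g' x) (at x within {a..b})"
    by (rule indef_integral_deriv_ae[OF g]) blast
  have cf: "continuous_on {a..b} f" and cg: "continuous_on {a..b} g"
    using f g by (auto intro: indef_integral_continuous)
  have f': "f' absolutely_integrable_on {a..b}" and g': "g' absolutely_integrable_on {a..b}"
    by (rule indef_integral_abs_integrable[OF f] indef_integral_abs_integrable[OF g])+
  have "bounded (f ` {a..b})" "bounded (g ` {a..b})"
    using cf cg by (auto intro!: compact_imp_bounded compact_continuous_image)
  then obtain Mf Mg where Mfg: "\<And>x. x \<in> {a..b} \<Longrightarrow> norm (f x) \<le> Mf" "\<And>x. x \<in> {a..b} \<Longrightarrow> norm (g x) \<le> Mg"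
    unfolding bounded_iff by blast
  define M where "M = max 0 (max Mf Mg)"
  have M: "norm (f x) \<le> M" "norm (g x) \<le> M" if "x \<in> {a..b}" for x
    using Mfg(1)[OF that] Mfg(2)[OF that] by (auto simp: M_def)
  have M0: "0 \<le> M" by (simp add: M_def)
  have nf: "(\<lambda>x. norm (f' x)) integrable_on {a..b}" "(\<lambda>x. norm (g' x)) integrable_on {a..b}"
    using f' g' by (auto intro: absolutely_integrable_norm')
  show ?thesis
  proof (rule indef_integral_AC_I[OF _ negligible_Un[OF N1(1) N2(1)]])
    show "abs_continuous_on {a..b} (\<lambda>x. f x * g x)"
    proof (rule abs_continuous_on_dominated)
      show "(\<lambda>x. M * (norm (f' x) + norm (g' x))) integrable_on {a..b}"
        using nf by (intro integrable_on_mult_right integrable_add)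
      show "0 \<le> M * (norm (f' x) + norm (g' x))" for x using M0 by simp
      fix u v assume uv: "a \<le> u" "u \<le> v" "v \<le> b"
      have sub: "(\<lambda>x. norm (f' x)) integrable_on {u..v}" "(\<lambda>x. norm (g' x)) integrable_on {u..v}"
        using uv by (auto intro: integrable_on_subinterval[OF nf(1)] integrable_on_subinterval[OF nf(2)])
      have "f v * g v - f u * g u = (f v - f u) * g v + f u * (g v - g u)" by (simp add: algebra_simps)
      then have "norm (f v * g v - f u * g u) \<le> norm (f v - f u) * norm (g v) + norm (f u) * norm (g v - g u)"
        by (metis norm_mult norm_triangle_ineq)
      also have "\<dots> \<le> integral {u..v} (\<lambda>x. norm (f' x)) * M + M * integral {u..v} (\<lambda>x. norm (g' x))"
        using uv M0 by (intro add_mono mult_mono indef_integral_bound[OF f] indef_integral_bound[OF g] M)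
          (auto intro: integral_nonneg sub)
      also have "\<dots> = integral {u..v} (\<lambda>x. M * (norm (f' x) + norm (g' x)))"
        using integral_add[OF sub] by (simp add: distrib_left[symmetric] mult.commute)
      finally show "norm (f v * g v - f u * g u) \<le> \<dots>" .
    qed
    show "((\<lambda>x. f x * g x) has_vector_derivative f' x * g x + f x * g' x) (at x within {a..b})"
      if "x \<in> {a..b} - (N1 \<union> N2)" for x
      using has_vector_derivative_mult[OF N1(2) N2(2), of x] that by (simp add: add.commute)
    show "(\<lambda>x. f' x * g x + f x * g' x) absolutely_integrable_on {a..b}"
      by (intro set_integral_add absolutely_integrable_continuous_mult absolutely_integrable_continuous_mult' cf cg f' g')
  qed
qed

lemma indef_integral_add:
  assumes "indef_integral a b f f'" "indef_integral a b g g'"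
  shows "indef_integral a b (\<lambda>x. f x + g x) (\<lambda>x. f' x + g' x)"
proof (rule indef_integralI)
  show "(\<lambda>x. f' x + g' x) absolutely_integrable_on {a..b}"
    by (rule set_integral_add(1)[OF indef_integral_abs_integrable[OF assms(1)] indef_integral_abs_integrable[OF assms(2)]])
  fix x assume "x \<in> {a..b}"
  then have "((\<lambda>x. f' x + g' x) has_integral (f x - f a) + (g x - g a)) {a..x}"
    by (intro has_integral_add indef_integral_has_integral[OF assms(1)] indef_integral_has_integral[OF assms(2)]) auto
  then show "((\<lambda>x. f' x + g' x) has_integral (f x + g x - (f a + g a))) {a..x}"
    by (simp add: algebra_simps)
qed

lemma indef_integral_cmult:
  assumes "indef_integral a b f f'"
  shows "indef_integral a b (\<lambda>x. c * f x) (\<lambda>x. c * f' x)"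
proof (rule indef_integralI)
  show "(\<lambda>x. c * f' x) absolutely_integrable_on {a..b}"
    by (intro set_integrable_mult_right indef_integral_abs_integrable[OF assms])
  fix x assume "x \<in> {a..b}"
  then have "((\<lambda>x. c * f' x) has_integral c * (f x - f a)) {a..x}"
    by (intro has_integral_mult_right indef_integral_has_integral[OF assms(1)]) auto
  then show "((\<lambda>x. c * f' x) has_integral (c * f x - c * f a)) {a..x}"
    by (simp add: algebra_simps)
qed

lemma indef_integral_diff:
  assumes "indef_integral a b f f'" "indef_integral a b g g'"
  shows "indef_integral a b (\<lambda>x. f x - g x) (\<lambda>x. f' x - g' x)"
  using indef_integral_add[OF assms(1) indef_integral_cmult[OF assms(2), of "-1"]] by simp

lemma indef_integral_C1:
  assumes "\<And>x. x \<in> {a..b} \<Longrightarrow> (f has_vector_derivative f' x) (at x within {a..b})" "continuous_on {a..b} f'"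
  shows "indef_integral a b f f'"
proof (rule indef_integralI)
  show "f' absolutely_integrable_on {a..b}" by (rule absolutely_integrable_continuous_real[OF assms(2)])
  show "(f' has_integral (f x - f a)) {a..x}" if "x \<in> {a..b}" for x
    using that by (intro fundamental_theorem_of_calculus)
      (auto intro: has_vector_derivative_within_subset[OF assms(1)])
qed

lemma indef_integral_subinterval:
  assumes "indef_integral a b f f'" "a \<le> u" "v \<le> b"
  shows "indef_integral u v f f'"
proof (rule indef_integralI)
  show "f' absolutely_integrable_on {u..v}"
    by (rule absolutely_integrable_on_subinterval[OF indef_integral_abs_integrable[OF assms(1)]]) (use assms(2-) in auto)
  show "(f' has_integral (f x - f u)) {u..x}" if "x \<in> {u..v}" for x
    using that assms by (intro indef_integral_has_integral[OF assms(1)]) auto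
qed

lemma indef_integral_cong:
  assumes "indef_integral a b f f'" "\<And>x. x \<in> {a..b} \<Longrightarrow> f x = g x"
    "negligible N" "\<And>x. x \<in> {a..b} - N \<Longrightarrow> f' x = g' x"
  shows "indef_integral a b g g'"
proof (rule indef_integralI)
  show "g' absolutely_integrable_on {a..b}"
    by (rule absolutely_integrable_spike[OF indef_integral_abs_integrable[OF assms(1)] assms(3)]) (use assms(4) in auto)
  fix x assume x: "x \<in> {a..b}"
  have "(f' has_integral (f x - f a)) {a..x}"
    using x by (intro indef_integral_has_integral[OF assms(1)]) auto
  then have "(g' has_integral (f x - f a)) {a..x}"
    by (rule has_integral_spike[OF assms(3), rotated]) (use assms(4) x in auto)
  then show "(g' has_integral (g x - g a)) {a..x}" using assms(2) x by simp
qed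

lemma indef_integral_zero_imp_ae:
  assumes "indef_integral a b (\<lambda>x. 0) f'"
  obtains N where "negligible N" "\<And>x. x \<in> {a<..<b} - N \<Longrightarrow> f' x = 0"
proof -
  obtain N where N: "negligible N" "\<And>x. x \<in> {a..b} - N \<Longrightarrow> ((\<lambda>x. 0) has_vector_derivative f' x) (at x within {a..b})"
    by (rule indef_integral_deriv_ae[OF assms]) blast
  show ?thesis
  proof
    show "f' x = 0" if x: "x \<in> {a<..<b} - N" for x
    proof -
      have "((\<lambda>x. 0) has_vector_derivative f' x) (at x)"
        using N(2)[of x] x by (metis DiffD1 DiffD2 DiffI at_within_Icc_at atLeastAtMost_iff greaterThanLessThan_iff less_imp_le)
      then show ?thesis by (rule vector_derivative_unique_at) simp
    qed
  qed fact
qed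

section \<open>The Sturm-Liouville system\<close>

text \<open>The kernel \<open>x - t\<close> is twofold integration of \<open>p * y\<close>. Hence a
  fixed-point equation with an affine inhomogeneity is \<open>y'' = p * y\<close> with initial
  values built in.\<close>

definition volterra :: "(real \<Rightarrow> complex) \<Rightarrow> real \<Rightarrow> (real \<Rightarrow> complex) \<Rightarrow> real \<Rightarrow> complex" where
  "volterra p a y x = integral {a..x} (\<lambda>t. of_real (x - t) * (p t * y t))"

lemma volterra_integrable:
  fixes p y k :: "real \<Rightarrow> complex"
  assumes "p absolutely_integrable_on {a..b}" "continuous_on {a..b} y" "continuous_on {a..b} k" "x \<in> {a..b}"
  shows "(\<lambda>t. k t * (p t * y t)) absolutely_integrable_on {a..x}"
proof -
  have "(\<lambda>t. k t * (p t * y t)) absolutely_integrable_on {a..b}"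
    by (rule absolutely_integrable_continuous_mult[OF assms(3) absolutely_integrable_continuous_mult'[OF assms(2,1)]])
  then show ?thesis
    by (rule absolutely_integrable_on_subinterval) (use assms(4) in auto)
qed

lemma abs_integrable_imp_integrable:
  fixes f :: "real \<Rightarrow> complex"
  shows "f absolutely_integrable_on S \<Longrightarrow> f integrable_on S"
  using absolutely_integrable_on_def by blast

lemma volterra_has_integral:
  assumes "p absolutely_integrable_on {a..b}" "continuous_on {a..b} y" "x \<in> {a..b}"
  shows "((\<lambda>t. of_real (x - t) * (p t * y t)) has_integral volterra p a y x) {a..x}"
  unfolding volterra_def
  by (intro integrable_integral abs_integrable_imp_integrable volterra_integrable[OF assms(1,2) _ assms(3)] continuous_intros)

text \<open>In the maximum norm weighted by \<open>exp (\<kappa> * (t - a))\<close> the operator has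
  norm at most \<open>\<integral>\<bar>p\<bar> / \<kappa>\<close>, because
  \<open>s \<le> exp (\<kappa> * s) / \<kappa>\<close> absorbs the kernel. A large
  \<open>\<kappa>\<close> makes it a contraction on the whole interval at once.\<close>

lemma volterra_bound:
  assumes p: "p absolutely_integrable_on {a..b}" and y: "continuous_on {a..b} y" and x: "x \<in> {a..b}"
    and \<kappa>: "\<kappa> > 0" and W: "\<And>t. t \<in> {a..b} \<Longrightarrow> norm (y t) \<le> W * exp (\<kappa> * (t - a))"
  shows "norm (volterra p a y x) \<le> W * exp (\<kappa> * (x - a)) * (integral {a..b} (\<lambda>t. norm (p t)) / \<kappa>)"
proof -
  have np: "(\<lambda>t. norm (p t)) integrable_on {a..b}" by (rule absolutely_integrable_norm'[OF p])
  have npx: "(\<lambda>t. norm (p t)) integrable_on {a..x}"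
    by (rule integrable_on_subinterval[OF np]) (use x in auto)
  have W0: "0 \<le> W" using W[of a] x by (auto intro: order_trans[OF norm_ge_zero])
  let ?C = "W * exp (\<kappa> * (x - a)) / \<kappa>"
  have "norm (volterra p a y x) \<le> integral {a..x} (\<lambda>t. ?C * norm (p t))"
    unfolding volterra_def
  proof (rule integral_norm_bound_integral)
    show "(\<lambda>t. of_real (x - t) * (p t * y t)) integrable_on {a..x}"
      using volterra_has_integral[OF p y x] by blast
    show "(\<lambda>t. ?C * norm (p t)) integrable_on {a..x}" by (rule integrable_on_mult_right[OF npx])
    fix t assume t: "t \<in> {a..x}"
    have "\<kappa> * (x - t) \<le> exp (\<kappa> * (x - t))"
      using exp_ge_add_one_self[of "\<kappa> * (x - t)"] by linarith
    then have "\<kappa> * (x - t) * exp (\<kappa> * (t - a)) \<le> exp (\<kappa> * (x - t)) * exp (\<kappa> * (t - a))"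
      by (intro mult_right_mono) auto
    also have "\<dots> = exp (\<kappa> * (x - a))" by (simp add: mult_exp_exp algebra_simps)
    finally have e: "(x - t) * exp (\<kappa> * (t - a)) \<le> exp (\<kappa> * (x - a)) / \<kappa>"
      using \<kappa> by (simp add: field_simps)
    have "norm (of_real (x - t) * (p t * y t)) = (x - t) * norm (y t) * norm (p t)"
      using t by (simp only: norm_mult norm_of_real) simp
    also have "\<dots> \<le> (x - t) * (W * exp (\<kappa> * (t - a))) * norm (p t)"
      using t x by (intro mult_right_mono mult_left_mono W) auto
    also have "\<dots> = W * ((x - t) * exp (\<kappa> * (t - a))) * norm (p t)" by simp
    also have "\<dots> \<le> W * (exp (\<kappa> * (x - a)) / \<kappa>) * norm (p t)"
      by (intro mult_right_mono mult_left_mono e W0) auto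
    finally show "norm (of_real (x - t) * (p t * y t)) \<le> ?C * norm (p t)" by simp
  qed
  also have "\<dots> = ?C * integral {a..x} (\<lambda>t. norm (p t))" by simp
  also have "\<dots> \<le> ?C * integral {a..b} (\<lambda>t. norm (p t))"
    using W0 \<kappa> x by (intro mult_left_mono integral_subset_le npx np) auto
  finally show ?thesis by (simp add: field_simps)
qed

text \<open>Integration by parts for \<open>(x - t) * g t\<close>, where \<open>g\<close> is the
  inner integral. The first factor vanishes at \<open>x\<close> and the second at \<open>a\<close>,
  so there are no boundary terms.\<close>

lemma volterra_eq_double_integral:
  assumes p: "p absolutely_integrable_on {a..b}" and y: "continuous_on {a..b} y" and x: "x \<in> {a..b}"
  shows "((\<lambda>s. integral {a..s} (\<lambda>t. p t * y t)) has_integral volterra p a y x) {a..x}"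
proof -
  let ?g = "\<lambda>s. integral {a..s} (\<lambda>t. p t * y t)"
  have py: "(\<lambda>t. p t * y t) absolutely_integrable_on {a..b}"
    by (rule absolutely_integrable_continuous_mult'[OF y p])
  have g: "indef_integral a b ?g (\<lambda>t. p t * y t)"
    using indef_integral_of_integral[OF py, of 0] by simp
  have k: "indef_integral a b (\<lambda>t. complex_of_real (x - t)) (\<lambda>t. - 1)"
    by (rule indef_integral_C1) (auto intro!: derivative_eq_intros continuous_intros)
  have "((\<lambda>t. - 1 * ?g t + complex_of_real (x - t) * (p t * y t)) has_integral
          (of_real (x - x) * ?g x - of_real (x - a) * ?g a)) {a..x}"
    using indef_integral_has_integral[OF indef_integral_mult[OF k g], of a x] x by auto
  then have 1: "((\<lambda>t. - 1 * ?g t + complex_of_real (x - t) * (p t * y t)) has_integral 0) {a..x}" by simp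
  from has_integral_diff[OF volterra_has_integral[OF p y x] 1]
  show ?thesis by simp
qed

lemma volterra_continuous:
  assumes p: "p absolutely_integrable_on {a..b}" and y: "continuous_on {a..b} y"
  shows "continuous_on {a..b} (volterra p a y)"
proof -
  let ?g = "\<lambda>s. integral {a..s} (\<lambda>t. p t * y t)"
  have py: "(\<lambda>t. p t * y t) absolutely_integrable_on {a..b}"
    by (rule absolutely_integrable_continuous_mult'[OF y p])
  have "continuous_on {a..b} ?g"
    by (intro indefinite_integral_continuous_1 abs_integrable_imp_integrable py)
  then have "continuous_on {a..b} (\<lambda>x. integral {a..x} ?g)"
    by (rule indefinite_integral_continuous_1[OF integrable_continuous_interval])
  then show ?thesis
    by (rule continuous_on_eq)
      (use volterra_eq_double_integral[OF p y] in \<open>auto intro: integral_unique\<close>)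
qed

lemma volterra_diff:
  assumes p: "p absolutely_integrable_on {a..b}" and "continuous_on {a..b} y" "continuous_on {a..b} z" "x \<in> {a..b}"
  shows "volterra p a (\<lambda>t. y t - z t) x = volterra p a y x - volterra p a z x"
proof -
  have "((\<lambda>t. of_real (x - t) * (p t * (y t - z t))) has_integral (volterra p a y x - volterra p a z x)) {a..x}"
    using has_integral_diff[OF volterra_has_integral[OF p assms(2,4)] volterra_has_integral[OF p assms(3,4)]]
    by (simp add: algebra_simps)
  then show ?thesis unfolding volterra_def by (rule integral_unique)
qed

text \<open>For \<open>\<kappa> \<ge> 2 * \<integral>\<bar>p\<bar>\<close> the operator has weighted
  norm at most \<open>1/2\<close>. Evaluating the equation where the weighted modulus of
  \<open>y\<close> attains its maximum \<open>W\<close> gives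
  \<open>W \<le> M + W / 2\<close>.\<close>

lemma volterra_solution_bound:
  assumes p: "p absolutely_integrable_on {a..b}" and y: "continuous_on {a..b} y"
    and eq: "\<And>x. x \<in> {a..b} \<Longrightarrow> y x = f x + volterra p a y x"
    and f: "\<And>x. x \<in> {a..b} \<Longrightarrow> norm (f x) \<le> M"
    and \<kappa>: "\<kappa> > 0" "2 * integral {a..b} (\<lambda>t. norm (p t)) \<le> \<kappa>" and x: "x \<in> {a..b}"
  shows "norm (y x) \<le> 2 * M * exp (\<kappa> * (x - a))"
proof -
  let ?w = "\<lambda>t. norm (y t) * exp (- (\<kappa> * (t - a)))"
  have "continuous_on {a..b} ?w" by (intro continuous_intros y)
  moreover have "{a..b} \<noteq> {}" using x by auto
  ultimately obtain s where s: "s \<in> {a..b}" "\<And>t. t \<in> {a..b} \<Longrightarrow> ?w t \<le> ?w s"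
    using continuous_attains_sup[of "{a..b}" ?w] by auto
  define W where "W = ?w s"
  have W: "norm (y t) \<le> W * exp (\<kappa> * (t - a))" if "t \<in> {a..b}" for t
  proof -
    have "?w t * exp (\<kappa> * (t - a)) \<le> W * exp (\<kappa> * (t - a))"
      unfolding W_def by (intro mult_right_mono s(2)[OF that]) auto
    then show ?thesis by (simp add: mult.assoc mult_exp_exp)
  qed
  have W0: "0 \<le> W" by (simp add: W_def)
  have Mp: "0 \<le> M" using f[OF x] by (rule order_trans[OF norm_ge_zero])
  let ?e = "exp (\<kappa> * (s - a))"
  have e1: "1 \<le> ?e" using \<kappa> s by auto
  have "W * ?e = norm (y s)" by (simp add: W_def mult.assoc mult_exp_exp)
  also have "\<dots> \<le> norm (f s) + norm (volterra p a y s)"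
    by (subst eq[OF s(1)]) (rule norm_triangle_ineq)
  also have "\<dots> \<le> M * ?e + W * ?e * (1/2)"
  proof (intro add_mono)
    show "norm (f s) \<le> M * ?e" using f[OF s(1)] mult_left_mono[OF e1 Mp] by simp
    have "norm (volterra p a y s) \<le> W * ?e * (integral {a..b} (\<lambda>t. norm (p t)) / \<kappa>)"
      by (rule volterra_bound[OF p y s(1) \<kappa>(1) W])
    also have "\<dots> \<le> W * ?e * (1/2)"
      using \<kappa> W0 by (intro mult_left_mono) (auto simp: field_simps)
    finally show "norm (volterra p a y s) \<le> W * ?e * (1/2)" .
  qed
  finally have "?e * W \<le> ?e * (2 * M)" by (simp add: field_simps)
  then have "W \<le> 2 * M" by simp
  with W[OF x] show ?thesis by (meson exp_ge_zero mult_right_mono order_trans)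
qed

text \<open>The Neumann series. With \<open>\<kappa> = 2 * P + 1\<close> each application of the
  operator halves the weighted norm, so the iterates \<open>Z n\<close> are summable uniformly on
  the interval.\<close>

lemma volterra_solution_exists:
  assumes p: "p absolutely_integrable_on {a..b}" and f: "continuous_on {a..b} f"
  obtains y where "continuous_on {a..b} y" "\<And>x. x \<in> {a..b} \<Longrightarrow> y x = f x + volterra p a y x"
proof -
  define P where "P = integral {a..b} (\<lambda>t. norm (p t))"
  define \<kappa> where "\<kappa> = 2 * P + 1"
  have P0: "0 \<le> P" unfolding P_def by (rule integral_nonneg) (auto intro: absolutely_integrable_norm'[OF p])
  have \<kappa>: "\<kappa> > 0" "P / \<kappa> \<le> 1/2" using P0 by (auto simp: \<kappa>_def field_simps)
  have "bounded (f ` {a..b})" by (intro compact_imp_bounded compact_continuous_image f) auto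
  then obtain M0 where "\<And>t. t \<in> {a..b} \<Longrightarrow> norm (f t) \<le> M0" unfolding bounded_iff by blast
  then have M: "norm (f t) \<le> max 0 M0" if "t \<in> {a..b}" for t using that by fastforce
  define M where "M = max 0 M0"
  have M0: "0 \<le> M" by (simp add: M_def)
  define Z where "Z = (\<lambda>n. (volterra p a ^^ n) f)"
  have Z0: "Z 0 = f" and ZS: "Z (Suc n) = volterra p a (Z n)" for n by (simp_all add: Z_def)
  have Zc: "continuous_on {a..b} (Z n)" for n
    by (induction n) (simp_all add: Z0 ZS f volterra_continuous[OF p])
  have Zb: "norm (Z n x) \<le> (M * (1/2)^n) * exp (\<kappa> * (x - a))" if "x \<in> {a..b}" for n x
    using that
  proof (induction n arbitrary: x)
    case 0
    have "1 \<le> exp (\<kappa> * (x - a))" using \<kappa> 0 by auto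
    then have "M * 1 \<le> M * exp (\<kappa> * (x - a))" using M0 by (intro mult_left_mono)
    then show ?case using M[OF 0] by (simp add: Z0 M_def)
  next
    case (Suc n)
    have "norm (Z (Suc n) x) \<le> (M * (1/2)^n) * exp (\<kappa> * (x - a)) * (P / \<kappa>)"
      unfolding ZS P_def by (rule volterra_bound[OF p Zc Suc.prems \<kappa>(1) Suc.IH])
    also have "\<dots> \<le> (M * (1/2)^n) * exp (\<kappa> * (x - a)) * (1/2)"
      using \<kappa> M0 by (intro mult_left_mono) auto
    finally show ?case by simp
  qed
  define B where "B = exp (\<kappa> * (b - a))"
  define y where "y x = (\<Sum>n. Z n x)" for x
  have ul: "uniform_limit {a..b} (\<lambda>n x. \<Sum>i<n. Z i x) y sequentially"
    unfolding y_def
  proof (rule Weierstrass_m_test[of "{a..b}" Z "\<lambda>n. M * B * (1/2)^n"])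
    fix n x assume x: "x \<in> {a..b}"
    have "exp (\<kappa> * (x - a)) \<le> B" using x \<kappa> by (simp add: B_def)
    then have "M * (1/2)^n * exp (\<kappa> * (x - a)) \<le> M * (1/2)^n * B" using M0 by (intro mult_left_mono) auto
    with Zb[OF x, of n] show "norm (Z n x) \<le> M * B * (1/2)^n" by (simp add: mult_ac)
  qed (intro summable_mult summable_geometric, simp)
  have Sc: "continuous_on {a..b} (\<lambda>x. \<Sum>i<n. Z i x)" for n by (intro continuous_intros Zc)
  have yc: "continuous_on {a..b} y"
    by (rule uniform_limit_theorem[OF _ ul]) (auto intro!: Sc always_eventually)
  have VS: "(\<Sum>i<Suc n. Z i x) = f x + volterra p a (\<lambda>x. \<Sum>i<n. Z i x) x" if x: "x \<in> {a..b}" for n x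
  proof -
    have "((\<lambda>t. \<Sum>i<n. of_real (x - t) * (p t * Z i t)) has_integral (\<Sum>i<n. volterra p a (Z i) x)) {a..x}"
      by (intro has_integral_sum volterra_has_integral[OF p Zc x]) auto
    then have "volterra p a (\<lambda>x. \<Sum>i<n. Z i x) x = (\<Sum>i<n. Z (Suc i) x)"
      unfolding volterra_def[of p a "\<lambda>x. \<Sum>i<n. Z i x"] by (simp add: ZS sum_distrib_left integral_unique)
    then show ?thesis by (simp only: sum.lessThan_Suc_shift Z0)
  qed
  show ?thesis
  proof (rule that[OF yc])
    fix x assume x: "x \<in> {a..b}"
    \<comment> \<open>One \<open>e\<close> is the tail of the series, and \<open>e * B\<close> is
      the effect of the operator on a tail, as the operator has weighted norm at most 1 and the
      weight is at most \<open>B\<close>.\<close>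
    have "norm (y x - (f x + volterra p a y x)) \<le> e * (1 + B)" if e: "e > 0" for e
    proof -
      obtain N where N: "\<And>n t. n \<ge> N \<Longrightarrow> t \<in> {a..b} \<Longrightarrow> dist (\<Sum>i<n. Z i t) (y t) < e"
        using uniform_limitD[OF ul e] unfolding eventually_sequentially by blast
      let ?S = "\<lambda>x. \<Sum>i<N. Z i x"
      have 1: "norm (y x - (\<Sum>i<Suc N. Z i x)) \<le> e"
        using N[of "Suc N" x] x by (simp add: dist_norm norm_minus_commute)
      have "norm (volterra p a (\<lambda>t. ?S t - y t) x) \<le> e * exp (\<kappa> * (x - a)) * (P / \<kappa>)"
        unfolding P_def
      proof (rule volterra_bound[OF p _ x \<kappa>(1)])
        show "continuous_on {a..b} (\<lambda>t. ?S t - y t)" by (intro continuous_on_diff Sc yc)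
        fix t assume t: "t \<in> {a..b}"
        have "1 \<le> exp (\<kappa> * (t - a))" using \<kappa> t by auto
        then have "e * 1 \<le> e * exp (\<kappa> * (t - a))" using e by (intro mult_left_mono) auto
        then show "norm (?S t - y t) \<le> e * exp (\<kappa> * (t - a))" using N[of N t] t by (simp add: dist_norm)
      qed
      also have "\<dots> \<le> e * B * 1"
        using \<kappa> e x P0 by (intro mult_mono) (auto simp: B_def)
      finally have "norm (volterra p a ?S x - volterra p a y x) \<le> e * B"
        using volterra_diff[OF p Sc yc x] by simp
      moreover have "y x - (f x + volterra p a y x) = (y x - (\<Sum>i<Suc N. Z i x)) + (volterra p a ?S x - volterra p a y x)"
        unfolding VS[OF x] by simp
      ultimately have "norm (y x - (f x + volterra p a y x)) \<le> e + e * B"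
        using norm_triangle_mono[OF 1] by metis
      then show ?thesis by (simp add: distrib_left)
    qed
    then have "norm (y x - (f x + volterra p a y x)) \<le> 0 + e" if "e > 0" for e
    proof -
      have "1 + B > 0" by (simp add: B_def add_pos_pos)
      then show ?thesis using \<open>\<And>e. e > 0 \<Longrightarrow> norm _ \<le> _\<close>[of "e / (1 + B)"] that by simp
    qed
    then have "norm (y x - (f x + volterra p a y x)) \<le> 0" by (rule field_le_epsilon)
    then show "y x = f x + volterra p a y x" by simp
  qed
qed

text \<open>The equation \<open>- y'' + q * y = lam * y\<close> as a first-order system in
  integrated form, which makes sense for integrable \<open>q\<close>. Taking \<open>y'\<close> as a
  separate argument keeps the notion local: it restricts to subintervals and includes one-sided
  values at both ends.\<close>

definition sl_system :: "(real \<Rightarrow> complex) \<Rightarrow> complex \<Rightarrow> real \<Rightarrow> real \<Rightarrow> (real \<Rightarrow> complex) \<Rightarrow> (real \<Rightarrow> complex) \<Rightarrow> bool" where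
  "sl_system q lam a b y y' \<longleftrightarrow>
     indef_integral a b y y' \<and> indef_integral a b y' (\<lambda>t. (q t - lam) * y t)"

lemma sl_systemD:
  assumes "sl_system q lam a b y y'"
  shows "indef_integral a b y y'" "indef_integral a b y' (\<lambda>t. (q t - lam) * y t)"
    "continuous_on {a..b} y" "continuous_on {a..b} y'"
  using assms by (auto simp: sl_system_def intro: indef_integral_continuous)

lemma sl_system_subinterval:
  "sl_system q lam a b y y' \<Longrightarrow> a \<le> u \<Longrightarrow> v \<le> b \<Longrightarrow> sl_system q lam u v y y'"
  unfolding sl_system_def by (blast intro: indef_integral_subinterval)

lemma sl_system_lincomb:
  assumes "sl_system q lam a b y y'" "sl_system q lam a b z z'"
  shows "sl_system q lam a b (\<lambda>x. c * y x + e * z x) (\<lambda>x. c * y' x + e * z' x)"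
  unfolding sl_system_def
proof
  show "indef_integral a b (\<lambda>x. c * y x + e * z x) (\<lambda>x. c * y' x + e * z' x)"
    by (intro indef_integral_add indef_integral_cmult sl_systemD(1)[OF assms(1)] sl_systemD(1)[OF assms(2)])
  have "indef_integral a b (\<lambda>x. c * y' x + e * z' x) (\<lambda>t. c * ((q t - lam) * y t) + e * ((q t - lam) * z t))"
    by (intro indef_integral_add indef_integral_cmult sl_systemD(2)[OF assms(1)] sl_systemD(2)[OF assms(2)])
  then show "indef_integral a b (\<lambda>x. c * y' x + e * z' x) (\<lambda>t. (q t - lam) * (c * y t + e * z t))"
    by (simp add: algebra_simps)
qed

lemma sl_system_ae_cong:
  assumes "sl_system q lam a b y y'" "negligible N" "\<And>x. x \<in> {a..b} - N \<Longrightarrow> q x = qt x"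
  shows "sl_system qt lam a b y y'"
  unfolding sl_system_def
  by (intro conjI sl_systemD(1)[OF assms(1)] indef_integral_cong[OF sl_systemD(2)[OF assms(1)] refl assms(2)])
    (simp add: assms(3))

text \<open>Lagrange's identity: the terms in \<open>y' * z'\<close> and in \<open>lam\<close>
  cancel. With equal potentials the Wronskian is constant; with different ones this is how
  \<open>qt - q\<close> enters \<open>F\<close>.\<close>

lemma wronskian_deriv:
  assumes "sl_system q lam a b y y'" "sl_system qt lam a b z z'"
  shows "indef_integral a b (\<lambda>x. y x * z' x - y' x * z x) (\<lambda>x. (qt x - q x) * (y x * z x))"
proof -
  have "indef_integral a b (\<lambda>x. y x * z' x - y' x * z x)
     (\<lambda>x. (y' x * z' x + y x * ((qt x - lam) * z x)) - ((q x - lam) * y x * z x + y' x * z' x))"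
    by (intro indef_integral_diff indef_integral_mult sl_systemD[OF assms(1)] sl_systemD[OF assms(2)])
  then show ?thesis by (simp add: algebra_simps)
qed

lemma wronskian_const:
  assumes "sl_system q lam a b y y'" "sl_system q lam a b z z'" "u \<in> {a..b}" "v \<in> {a..b}"
  shows "y u * z' u - y' u * z u = y v * z' v - y' v * z v"
proof -
  have "indef_integral a b (\<lambda>x. y x * z' x - y' x * z x) (\<lambda>x. 0)"
    using wronskian_deriv[OF assms(1,2)] by simp
  from indef_integral_eq[OF this assms(3)] indef_integral_eq[OF this assms(4)] show ?thesis by simp
qed

section \<open>Existence and uniqueness for the initial value problem\<close>

lemma shifted_abs_integrable:
  fixes q :: "real \<Rightarrow> complex"
  assumes "q absolutely_integrable_on {a..b}"
  shows "(\<lambda>t. q t - lam) absolutely_integrable_on {a..b}"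
  by (rule set_integral_diff(1)[OF assms]) (rule absolutely_integrable_continuous_real, simp)

lemma sl_system_volterra:
  assumes q: "q absolutely_integrable_on {a..b}" and S: "sl_system q lam a b y y'" and x: "x \<in> {a..b}"
  shows "y x = (y a + y' a * of_real (x - a)) + volterra (\<lambda>t. q t - lam) a y x"
proof -
  have p: "(\<lambda>t. q t - lam) absolutely_integrable_on {a..b}" by (rule shifted_abs_integrable[OF q])
  let ?g = "\<lambda>s. integral {a..s} (\<lambda>t. (q t - lam) * y t)"
  have y': "y' s = y' a + ?g s" if "s \<in> {a..b}" for s
    by (rule indef_integral_eq[OF sl_systemD(2)[OF S] that])
  have "((\<lambda>s. y' a + ?g s) has_integral (y' a * of_real (x - a) + volterra (\<lambda>t. q t - lam) a y x)) {a..x}"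
    using has_integral_add[OF has_integral_const_real[of "y' a" a x] volterra_eq_double_integral[OF p sl_systemD(3)[OF S] x]] x
    by (simp add: scaleR_conv_of_real mult.commute)
  then have "(y' has_integral (y' a * of_real (x - a) + volterra (\<lambda>t. q t - lam) a y x)) {a..x}"
    by (rule has_integral_eq[rotated]) (rule y'[symmetric], use x in auto)
  moreover have "(y' has_integral (y x - y a)) {a..x}"
    by (rule indef_integral_has_integral[OF sl_systemD(1)[OF S]]) (use x in auto)
  ultimately have "y x - y a = y' a * of_real (x - a) + volterra (\<lambda>t. q t - lam) a y x"
    by (rule has_integral_unique[rotated])
  then show ?thesis by (simp add: algebra_simps)
qed

lemma sl_system_exists:
  assumes q: "q absolutely_integrable_on {a..b}" and ab: "a \<le> b"
  obtains y y' where "sl_system q lam a b y y'" "y a = \<alpha>" "y' a = \<eta>"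
proof -
  let ?p = "\<lambda>t. q t - lam"
  have p: "?p absolutely_integrable_on {a..b}" by (rule shifted_abs_integrable[OF q])
  obtain y where yc: "continuous_on {a..b} y"
    and y: "\<And>x. x \<in> {a..b} \<Longrightarrow> y x = (\<alpha> + \<eta> * of_real (x - a)) + volterra ?p a y x"
    by (rule volterra_solution_exists[OF p, of "\<lambda>x. \<alpha> + \<eta> * of_real (x - a)"]) (auto intro!: continuous_intros)
  define y' where "y' = (\<lambda>s. \<eta> + integral {a..s} (\<lambda>t. ?p t * y t))"
  have py: "(\<lambda>t. ?p t * y t) absolutely_integrable_on {a..b}"
    by (rule absolutely_integrable_continuous_mult'[OF yc p])
  have S2: "indef_integral a b y' (\<lambda>t. ?p t * y t)"
    unfolding y'_def by (rule indef_integral_of_integral[OF py])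
  have ya: "y a = \<alpha>" "y' a = \<eta>" using y[of a] ab by (simp_all add: y'_def volterra_def)
  have S1: "indef_integral a b y y'"
  proof (rule indef_integralI)
    show "y' absolutely_integrable_on {a..b}"
      by (rule absolutely_integrable_continuous_real[OF indef_integral_continuous[OF S2]])
    fix x assume x: "x \<in> {a..b}"
    have "(y' has_integral (\<eta> * of_real (x - a) + volterra ?p a y x)) {a..x}"
      unfolding y'_def
      using has_integral_add[OF has_integral_const_real[of \<eta> a x] volterra_eq_double_integral[OF p yc x]] x
      by (simp add: scaleR_conv_of_real mult.commute)
    then show "(y' has_integral (y x - y a)) {a..x}"
      using y[OF x] ya by simp
  qed
  show ?thesis by (rule that[of y y']) (simp_all add: sl_system_def S1 S2 ya)
qed

text \<open>The difference has zero initial values, so its Volterra equation is homogeneous and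
  \<open>volterra_solution_bound\<close> applies with \<open>M = 0\<close>.\<close>

lemma sl_system_unique:
  assumes q: "q absolutely_integrable_on {a..b}"
    and S: "sl_system q lam a b y y'" "sl_system q lam a b z z'" "y a = z a" "y' a = z' a" and x: "x \<in> {a..b}"
  shows "y x = z x" "y' x = z' x"
proof -
  have D: "sl_system q lam a b (\<lambda>x. 1 * y x + (-1) * z x) (\<lambda>x. 1 * y' x + (-1) * z' x)"
    by (rule sl_system_lincomb[OF S(1,2)])
  let ?w = "\<lambda>x. 1 * y x + (-1) * z x"
  let ?P = "integral {a..b} (\<lambda>t. norm (q t - lam))"
  have p: "(\<lambda>t. q t - lam) absolutely_integrable_on {a..b}" by (rule shifted_abs_integrable[OF q])
  have P0: "0 \<le> ?P" by (rule integral_nonneg) (auto intro: absolutely_integrable_norm'[OF p])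
  have w: "?w s = 0" if s: "s \<in> {a..b}" for s
  proof -
    have "norm (?w s) \<le> 2 * 0 * exp ((2 * ?P + 1) * (s - a))"
    proof (rule volterra_solution_bound[OF p sl_systemD(3)[OF D] _ _ _ _ s])
      show "?w x = 0 + volterra (\<lambda>t. q t - lam) a ?w x" if "x \<in> {a..b}" for x
        using sl_system_volterra[OF q D that] S(3,4) by simp
    qed (use P0 in auto)
    then show ?thesis by simp
  qed
  then show "y x = z x" using x by fastforce
  have "1 * y' x + (-1) * z' x = integral {a..x} (\<lambda>t. (q t - lam) * ?w t)"
    using indef_integral_eq[OF sl_systemD(2)[OF D] x] S(4) by simp
  also have "\<dots> = integral {a..x} (\<lambda>t. 0)"
    by (rule integral_cong) (use w x in auto)
  finally show "y' x = z' x" by simp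
qed

text \<open>The solution with values \<open>\<alpha>\<close> and \<open>\<eta>\<close> at the left
  end, as a pair of function and derivative. A name is needed to speak of its dependence on
  \<open>lam\<close>; for integrable \<open>q\<close> the choice is free only outside
  \<open>{a..b}\<close>.\<close>

definition sl_sol :: "(real \<Rightarrow> complex) \<Rightarrow> real \<Rightarrow> real \<Rightarrow> complex \<Rightarrow> complex \<Rightarrow> complex \<Rightarrow> (real \<Rightarrow> complex) \<times> (real \<Rightarrow> complex)" where
  "sl_sol q a b \<alpha> \<eta> lam = (SOME Y. sl_system q lam a b (fst Y) (snd Y) \<and> fst Y a = \<alpha> \<and> snd Y a = \<eta>)"

lemma sl_sol:
  assumes q: "q absolutely_integrable_on {a..b}" and ab: "a \<le> b"
  shows "sl_system q lam a b (fst (sl_sol q a b \<alpha> \<eta> lam)) (snd (sl_sol q a b \<alpha> \<eta> lam))"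
    "fst (sl_sol q a b \<alpha> \<eta> lam) a = \<alpha>" "snd (sl_sol q a b \<alpha> \<eta> lam) a = \<eta>"
proof -
  obtain y y' where "sl_system q lam a b y y'" "y a = \<alpha>" "y' a = \<eta>"
    by (rule sl_system_exists[OF q ab]) blast
  then have "\<exists>Y. sl_system q lam a b (fst Y) (snd Y) \<and> fst Y a = \<alpha> \<and> snd Y a = \<eta>"
    by (intro exI[of _ "(y, y')"]) simp
  from someI_ex[OF this] show "sl_system q lam a b (fst (sl_sol q a b \<alpha> \<eta> lam)) (snd (sl_sol q a b \<alpha> \<eta> lam))"
    "fst (sl_sol q a b \<alpha> \<eta> lam) a = \<alpha>" "snd (sl_sol q a b \<alpha> \<eta> lam) a = \<eta>"
    unfolding sl_sol_def by blast+
qed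

section \<open>Analytic dependence on the spectral parameter\<close>

lemma continuous_bounded_interval:
  fixes f :: "real \<Rightarrow> complex"
  assumes "continuous_on {a..b} f"
  obtains B where "0 \<le> B" "\<And>t. t \<in> {a..b} \<Longrightarrow> norm (f t) \<le> B"
proof -
  have "bounded (f ` {a..b})" by (intro compact_imp_bounded compact_continuous_image assms) auto
  then obtain B where "\<And>t. t \<in> {a..b} \<Longrightarrow> norm (f t) \<le> B" unfolding bounded_iff by blast
  then have "norm (f t) \<le> max 0 B" if "t \<in> {a..b}" for t using that by fastforce
  then show ?thesis by (intro that[of "max 0 B"]) auto
qed

text \<open>The candidate derivative \<open>Z\<close> of the solution in the spectral parameter solves the linearised
  equation, and the error \<open>E\<close> of the difference quotient solves the equation at \<open>lam\<close> with a
  right-hand side of size \<open>\<bar>lam - lam0\<bar>\<close>.\<close>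

lemma sl_sol_difference_quotient:
  fixes q :: "real \<Rightarrow> complex"
  assumes q: "q absolutely_integrable_on {a..b}" and ab: "a \<le> b"
  obtains Z Z' C where
    "\<And>lam x. 0 < norm (lam - lam0) \<Longrightarrow> norm (lam - lam0) \<le> 1 \<Longrightarrow> x \<in> {a..b} \<Longrightarrow>
       norm ((fst (sl_sol q a b \<alpha> \<eta> lam) x - fst (sl_sol q a b \<alpha> \<eta> lam0) x) / (lam - lam0) - Z x) \<le> C * norm (lam - lam0)"
    "\<And>lam x. 0 < norm (lam - lam0) \<Longrightarrow> norm (lam - lam0) \<le> 1 \<Longrightarrow> x \<in> {a..b} \<Longrightarrow>
       norm ((snd (sl_sol q a b \<alpha> \<eta> lam) x - snd (sl_sol q a b \<alpha> \<eta> lam0) x) / (lam - lam0) - Z' x) \<le> C * norm (lam - lam0)"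
proof -
  define y where "y lam = fst (sl_sol q a b \<alpha> \<eta> lam)" for lam
  define y' where "y' lam = snd (sl_sol q a b \<alpha> \<eta> lam)" for lam
  have S: "sl_system q lam a b (y lam) (y' lam)" and ini: "y lam a = \<alpha>" "y' lam a = \<eta>" for lam
    using sl_sol[OF q ab] by (simp_all add: y_def y'_def)
  have yc: "continuous_on {a..b} (y lam)" for lam by (rule sl_systemD(3)[OF S])
  define p where "p lam t = q t - lam" for lam t
  have p: "p lam absolutely_integrable_on {a..b}" for lam
    unfolding p_def[abs_def] by (rule shifted_abs_integrable[OF q])
  have one: "(\<lambda>t. 1::complex) absolutely_integrable_on {a..b}"
    by (rule absolutely_integrable_continuous_real) simp
  let ?V = "volterra (\<lambda>t. 1) a"
  have fc: "continuous_on {a..b} (\<lambda>x. - ?V (y lam0) x)"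
    by (intro continuous_on_minus volterra_continuous[OF one yc])
  obtain Z where Zc: "continuous_on {a..b} Z"
    and Z: "\<And>x. x \<in> {a..b} \<Longrightarrow> Z x = - ?V (y lam0) x + volterra (p lam0) a Z x"
    by (rule volterra_solution_exists[OF p fc]) blast
  define Z' where "Z' x = integral {a..x} (\<lambda>t. p lam0 t * Z t - y lam0 t)" for x
  obtain V0 where V0: "0 \<le> V0" "\<And>t. t \<in> {a..b} \<Longrightarrow> norm (?V Z t) \<le> V0"
    by (rule continuous_bounded_interval[OF volterra_continuous[OF one Zc]]) blast
  obtain W0 where W0: "0 \<le> W0" "\<And>t. t \<in> {a..b} \<Longrightarrow> norm (integral {a..t} Z) \<le> W0"
    by (rule continuous_bounded_interval[OF indefinite_integral_continuous_1[OF integrable_continuous_interval[OF Zc]]]) blast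
  \<comment> \<open>\<open>Pm\<close> bounds the integral of \<open>norm (q t - lam)\<close> for
    every \<open>lam\<close> in the unit disc around \<open>lam0\<close>, so one
    \<open>\<kappa>\<close> and one \<open>C\<close> serve the whole disc.\<close>
  define Pm where "Pm = integral {a..b} (\<lambda>t. norm (q t) + (norm lam0 + 1))"
  have nq: "(\<lambda>t. norm (q t)) integrable_on {a..b}" by (rule absolutely_integrable_norm'[OF q])
  have Pint: "(\<lambda>t. norm (q t) + (norm lam0 + 1)) integrable_on {a..b}"
    by (intro integrable_add nq integrable_const_ivl)
  have Pm0: "0 \<le> Pm" unfolding Pm_def by (rule integral_nonneg[OF Pint]) simp
  define \<kappa> where "\<kappa> = 2 * Pm + 1"
  define C1 where "C1 = 2 * V0 * exp (\<kappa> * (b - a))"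
  have C1: "0 \<le> C1" using V0 by (simp add: C1_def)
  define C where "C = C1 + (Pm * C1 + W0)"
  have main: "norm ((y lam x - y lam0 x) / (lam - lam0) - Z x) \<le> C * norm (lam - lam0) \<and>
              norm ((y' lam x - y' lam0 x) / (lam - lam0) - Z' x) \<le> C * norm (lam - lam0)"
    if lam: "0 < norm (lam - lam0)" "norm (lam - lam0) \<le> 1" and x: "x \<in> {a..b}" for lam x
  proof -
    define d where "d = lam - lam0"
    have d: "d \<noteq> 0" "norm d \<le> 1" using lam by (auto simp: d_def)
    define E where "E t = (y lam t - y lam0 t) / d - Z t" for t
    have Ec: "continuous_on {a..b} E"
      unfolding E_def by (intro continuous_intros yc Zc) (use d in auto)
    \<comment> \<open>Since \<open>p lam\<close> is \<open>p lam0 - d\<close>, subtracting the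
      linearised equation from the difference quotient leaves \<open>d * Z\<close> as the only term
      outside the equation for \<open>E\<close>.\<close>
    have comb: "p lam t * E t = (p lam t * y lam t - p lam0 t * y lam0 t) / d - (p lam0 t * Z t - y lam0 t) + d * Z t" for t
      using d(1) by (simp add: E_def p_def d_def field_simps)
    have npl: "(\<lambda>t. norm (p lam t)) integrable_on {a..b}" by (rule absolutely_integrable_norm'[OF p])
    have Ple: "integral {a..b} (\<lambda>t. norm (p lam t)) \<le> Pm"
      unfolding Pm_def
    proof (rule integral_le[OF npl Pint])
      fix t
      have "norm lam \<le> norm lam0 + 1" using norm_triangle_sub[of lam lam0] d(2) by (simp add: d_def)
      then show "norm (p lam t) \<le> norm (q t) + (norm lam0 + 1)"
        unfolding p_def using norm_triangle_ineq4[of "q t" lam] by linarith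
    qed
    have E1: "E s = - d * ?V Z s + volterra (p lam) a E s" if s: "s \<in> {a..b}" for s
    proof -
      let ?k = "\<lambda>t. complex_of_real (s - t)"
      let ?L = "\<alpha> + \<eta> * of_real (s - a)"
      have A: "((\<lambda>t. ?k t * (p lam t * y lam t)) has_integral (y lam s - ?L)) {a..s}"
        using volterra_has_integral[OF p yc s] sl_system_volterra[OF q S s] by (simp add: ini p_def[abs_def])
      have B: "((\<lambda>t. ?k t * (p lam0 t * y lam0 t)) has_integral (y lam0 s - ?L)) {a..s}"
        using volterra_has_integral[OF p yc s] sl_system_volterra[OF q S s] by (simp add: ini p_def[abs_def])
      have "((\<lambda>t. (1 / d) * (?k t * (p lam t * y lam t) - ?k t * (p lam0 t * y lam0 t))
             - (?k t * (p lam0 t * Z t) - ?k t * (1 * y lam0 t)) + d * (?k t * (1 * Z t))) has_integral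
          ((1 / d) * ((y lam s - ?L) - (y lam0 s - ?L)) - (volterra (p lam0) a Z s - ?V (y lam0) s) + d * ?V Z s)) {a..s}"
        by (intro has_integral_add has_integral_diff has_integral_mult_right A B
            volterra_has_integral[OF p Zc s] volterra_has_integral[OF one yc s] volterra_has_integral[OF one Zc s])
      also have "(\<lambda>t. (1 / d) * (?k t * (p lam t * y lam t) - ?k t * (p lam0 t * y lam0 t))
             - (?k t * (p lam0 t * Z t) - ?k t * (1 * y lam0 t)) + d * (?k t * (1 * Z t))) = (\<lambda>t. ?k t * (p lam t * E t))"
        unfolding comb by (simp add: algebra_simps diff_divide_distrib)
      finally have "volterra (p lam) a E s = (1 / d) * ((y lam s - ?L) - (y lam0 s - ?L))
          - (volterra (p lam0) a Z s - ?V (y lam0) s) + d * ?V Z s"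
        unfolding volterra_def[of "p lam"] by (rule integral_unique)
      moreover have "volterra (p lam0) a Z s = Z s + ?V (y lam0) s" using Z[OF s] by simp
      ultimately show ?thesis unfolding E_def[of s] by (simp add: algebra_simps diff_divide_distrib)
    qed
    have Eb: "norm (E s) \<le> C1 * norm d" if s: "s \<in> {a..b}" for s
    proof -
      have "norm (E s) \<le> 2 * (norm d * V0) * exp (\<kappa> * (s - a))"
      proof (rule volterra_solution_bound[OF p Ec E1 _ _ _ s])
        show "norm (- d * ?V Z u) \<le> norm d * V0" if "u \<in> {a..b}" for u
          using V0(2)[OF that] by (simp add: norm_mult mult_left_mono)
      qed (use Ple Pm0 in \<open>auto simp: \<kappa>_def\<close>)
      also have "\<dots> \<le> 2 * (norm d * V0) * exp (\<kappa> * (b - a))"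
        using V0 s Pm0 by (intro mult_left_mono) (auto simp: \<kappa>_def)
      finally show ?thesis by (simp add: C1_def mult_ac)
    qed
    have int: "(\<lambda>t. p l t * u t) integrable_on {a..x}" if "continuous_on {a..b} u" for l u
      using volterra_integrable[OF p that _ x, of "\<lambda>t. 1" l] by (simp add: abs_integrable_imp_integrable)
    have cint: "u integrable_on {a..x}" if "continuous_on {a..b} u" for u :: "real \<Rightarrow> complex"
      by (rule integrable_continuous_interval[OF continuous_on_subset[OF that]]) (use x in auto)
    have py: "((\<lambda>t. p l t * y l t) has_integral (y' l x - \<eta>)) {a..x}" for l
      using indef_integral_has_integral[OF sl_systemD(2)[OF S], of a x l] x by (simp add: ini p_def)
    have "((\<lambda>t. (1/d) * (p lam t * y lam t - p lam0 t * y lam0 t) - (p lam0 t * Z t - y lam0 t) + d * Z t) has_integral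
        ((1/d) * ((y' lam x - \<eta>) - (y' lam0 x - \<eta>)) - Z' x + d * integral {a..x} Z)) {a..x}"
      unfolding Z'_def
      by (intro has_integral_add has_integral_diff has_integral_mult_right py integrable_integral integrable_diff int cint Zc yc)
    then have "((\<lambda>t. p lam t * E t) has_integral ((y' lam x - y' lam0 x) / d - Z' x + d * integral {a..x} Z)) {a..x}"
      unfolding comb by simp
    then have eq: "(y' lam x - y' lam0 x) / d - Z' x = integral {a..x} (\<lambda>t. p lam t * E t) - d * integral {a..x} Z"
      by (simp add: integral_unique)
    have "norm (integral {a..x} (\<lambda>t. p lam t * E t)) \<le> integral {a..x} (\<lambda>t. norm (p lam t) * (C1 * norm d))"
    proof (rule integral_norm_bound_integral[OF int[OF Ec]])
      show "(\<lambda>t. norm (p lam t) * (C1 * norm d)) integrable_on {a..x}"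
        by (intro integrable_on_mult_left integrable_on_subinterval[OF npl]) (use x in auto)
      show "norm (p lam t * E t) \<le> norm (p lam t) * (C1 * norm d)" if "t \<in> {a..x}" for t
        using Eb[of t] that x by (auto simp: norm_mult intro!: mult_left_mono)
    qed
    also have "\<dots> = integral {a..x} (\<lambda>t. norm (p lam t)) * (C1 * norm d)" by simp
    also have "integral {a..x} (\<lambda>t. norm (p lam t)) \<le> integral {a..b} (\<lambda>t. norm (p lam t))"
      by (intro integral_subset_le integrable_on_subinterval[OF npl] npl) (use x in auto)
    also note Ple
    finally have 1: "norm (integral {a..x} (\<lambda>t. p lam t * E t)) \<le> Pm * (C1 * norm d)"
      using C1 by (simp add: mult_right_mono)
    have "norm ((y' lam x - y' lam0 x) / d - Z' x) \<le> Pm * (C1 * norm d) + norm d * W0"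
      unfolding eq using W0(2)[OF x]
      by (intro order_trans[OF norm_triangle_ineq4] add_mono 1) (simp add: norm_mult mult_left_mono)
    also have "\<dots> \<le> C * norm d" using C1 by (simp add: C_def algebra_simps)
    finally have 2: "norm ((y' lam x - y' lam0 x) / d - Z' x) \<le> C * norm d" .
    have "norm (E x) \<le> C1 * norm d" by (rule Eb[OF x])
    also have "\<dots> \<le> C * norm d" using C1 Pm0 W0 by (intro mult_right_mono) (auto simp: C_def)
    finally show ?thesis using 2 by (simp add: E_def d_def)
  qed
  show ?thesis
    by (rule that[of Z C Z']) (use main in \<open>auto simp: y_def y'_def\<close>)
qed

lemma has_field_derivative_from_bound:
  fixes f :: "complex \<Rightarrow> complex"
  assumes "\<And>w. 0 < norm (w - z) \<Longrightarrow> norm (w - z) \<le> 1 \<Longrightarrow> norm ((f w - f z) / (w - z) - D) \<le> C * norm (w - z)"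
  shows "(f has_field_derivative D) (at z)"
  unfolding has_field_derivative_iff
proof (rule Lim_transform_bound[THEN LIM_zero_cancel])
  show "eventually (\<lambda>w. norm ((f w - f z) / (w - z) - D) \<le> norm (C * norm (w - z))) (at z)"
    unfolding eventually_at
    by (intro exI[of _ 1]) (auto simp: dist_norm intro!: order_trans[OF assms])
  have "((\<lambda>w. C * norm (w - z)) \<longlongrightarrow> C * norm (z - z)) (at z)" by (intro tendsto_intros)
  then show "((\<lambda>w. C * norm (w - z)) \<longlongrightarrow> 0) (at z)" by simp
qed

theorem sl_sol_holomorphic:
  fixes q :: "real \<Rightarrow> complex"
  assumes q: "q absolutely_integrable_on {a..b}" and ab: "a \<le> b" and x: "x \<in> {a..b}"
  shows "(\<lambda>lam. fst (sl_sol q a b \<alpha> \<eta> lam) x) holomorphic_on UNIV"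
    "(\<lambda>lam. snd (sl_sol q a b \<alpha> \<eta> lam) x) holomorphic_on UNIV"
proof -
  have "(\<exists>D. ((\<lambda>lam. fst (sl_sol q a b \<alpha> \<eta> lam) x) has_field_derivative D) (at lam0)) \<and>
       (\<exists>D. ((\<lambda>lam. snd (sl_sol q a b \<alpha> \<eta> lam) x) has_field_derivative D) (at lam0))" for lam0
    by (rule sl_sol_difference_quotient[OF q ab, of lam0 \<alpha> \<eta>])
      (blast intro: has_field_derivative_from_bound x)
  then show "(\<lambda>lam. fst (sl_sol q a b \<alpha> \<eta> lam) x) holomorphic_on UNIV"
    "(\<lambda>lam. snd (sl_sol q a b \<alpha> \<eta> lam) x) holomorphic_on UNIV"
    by (auto simp: holomorphic_on_def field_differentiable_def)
qed

section \<open>The discontinuous boundary value problem\<close>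

lemma abs_continuous_on_cong:
  assumes "abs_continuous_on S f" "\<And>x. x \<in> S \<Longrightarrow> f x = g x"
  shows "abs_continuous_on S g"
  unfolding abs_continuous_on_def
proof (intro allI impI)
  fix e :: real assume "e > 0"
  from assms(1)[unfolded abs_continuous_on_def, THEN spec, THEN mp, OF this]
  obtain \<delta> where d: "\<delta> > 0" "\<forall>(n::nat) a b. (\<forall>i<n. a i \<le> b i \<and> {a i..b i} \<subseteq> S) \<and>
        (\<forall>i<n. \<forall>j<n. i \<noteq> j \<longrightarrow> {a i<..<b i} \<inter> {a j<..<b j} = {}) \<and>
        (\<Sum>i<n. b i - a i) < \<delta> \<longrightarrow> (\<Sum>i<n. norm (f (b i) - f (a i))) < e"
    by (elim exE conjE)
  show "\<exists>\<delta>>0. \<forall>(n::nat) a b. (\<forall>i<n. a i \<le> b i \<and> {a i..b i} \<subseteq> S) \<and>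
        (\<forall>i<n. \<forall>j<n. i \<noteq> j \<longrightarrow> {a i<..<b i} \<inter> {a j<..<b j} = {}) \<and>
        (\<Sum>i<n. b i - a i) < \<delta> \<longrightarrow> (\<Sum>i<n. norm (g (b i) - g (a i))) < e"
  proof (intro exI[of _ \<delta>] conjI allI impI d(1))
    fix n :: nat and a b :: "nat \<Rightarrow> real"
    assume H: "(\<forall>i<n. a i \<le> b i \<and> {a i..b i} \<subseteq> S) \<and>
        (\<forall>i<n. \<forall>j<n. i \<noteq> j \<longrightarrow> {a i<..<b i} \<inter> {a j<..<b j} = {}) \<and> (\<Sum>i<n. b i - a i) < \<delta>"
    have fg: "f (a i) = g (a i)" "f (b i) = g (b i)" if "i < n" for i
    proof -
      have "a i \<le> b i" "{a i..b i} \<subseteq> S" using H that by auto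
      then have "a i \<in> S" "b i \<in> S" by auto
      then show "f (a i) = g (a i)" "f (b i) = g (b i)" by (auto simp: assms(2))
    qed
    have "(\<Sum>i<n. norm (g (b i) - g (a i))) = (\<Sum>i<n. norm (f (b i) - f (a i)))"
      by (rule sum.cong) (simp_all add: fg)
    also have "\<dots> < e" using d(2) H by blast
    finally show "(\<Sum>i<n. norm (g (b i) - g (a i))) < e" .
  qed
qed

lemma abs_continuous_on_imp_continuous:
  assumes "abs_continuous_on {u..v} f" shows "continuous_on {u..v} f"
  unfolding continuous_on_iff
proof (intro ballI allI impI)
  fix x e :: real assume x: "x \<in> {u..v}" and e: "e > 0"
  obtain \<delta> where d: "\<delta> > 0" and D: "\<And>(I::unit set) a b. finite I \<Longrightarrow> (\<And>i. i \<in> I \<Longrightarrow> a i \<le> b i \<and> {a i..b i} \<subseteq> {u..v}) \<Longrightarrow>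
      (\<And>i j. i \<in> I \<Longrightarrow> j \<in> I \<Longrightarrow> i \<noteq> j \<Longrightarrow> {a i<..<b i} \<inter> {a j<..<b j} = {}) \<Longrightarrow>
      (\<Sum>i\<in>I. b i - a i) < \<delta> \<Longrightarrow> (\<Sum>i\<in>I. norm (f (b i) - f (a i))) < e"
    by (rule abs_continuous_on_finite_family[OF assms e]) blast
  show "\<exists>d>0. \<forall>x'\<in>{u..v}. dist x' x < d \<longrightarrow> dist (f x') (f x) < e"
  proof (intro exI[of _ \<delta>] conjI ballI impI d)
    fix x' assume x': "x' \<in> {u..v}" "dist x' x < \<delta>"
    have "(\<Sum>i\<in>{()}. norm (f (max x x') - f (min x x'))) < e"
      by (rule D) (use x x' in \<open>auto simp: dist_real_def max_def min_def\<close>)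
    then show "dist (f x') (f x) < e"
      by (auto simp: dist_norm max_def min_def norm_minus_commute split: if_splits)
  qed
qed

lemma D1_eq:
  assumes "(y has_vector_derivative y') (at x within {0..pi})" "x \<in> {0..pi}"
  shows "D1 y x = y'"
  unfolding D1_def using assms by (intro vector_derivative_within_cbox[of 0 pi, unfolded box_real]) auto

text \<open>A compact interval that avoids \<open>d\<close> meets neither the jump nor the open ends
  of the two pieces on which \<open>D1 y\<close> is absolutely continuous. What happens at
  \<open>d\<close> is recovered afterwards by one-sided limits.\<close>

lemma sl_solution_imp_system:
  assumes q: "q absolutely_integrable_on {0..pi}" and sol: "sl_solution q d lam y"
    and uv: "0 \<le> u" "u \<le> v" "v \<le> pi" "v < d \<or> d < u"
  shows "sl_system q lam u v y (D1 y)"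
proof -
  have dn: "d \<notin> {u..v}" using uv by auto
  have ac: "abs_continuous_on {u..v} (D1 y)"
  proof (cases "v < d")
    case True
    have "abs_continuous_on {0..<d} (D1 y)" using sol by (simp add: sl_solution_def)
    then show ?thesis by (rule abs_continuous_on_subset) (use uv True in auto)
  next
    case False
    have "abs_continuous_on {d<..pi} (D1 y)" using sol by (simp add: sl_solution_def)
    then show ?thesis by (rule abs_continuous_on_subset) (use uv False in auto)
  qed
  have der: "(y has_vector_derivative D1 y x) (at x within {u..v})" if "x \<in> {u..v}" for x
  proof -
    have "y differentiable (at x within {0..pi})"
      using sol that uv dn by (auto simp: sl_solution_def)
    then have "(y has_vector_derivative D1 y x) (at x within {0..pi})"
      unfolding D1_def by (simp add: vector_derivative_works)
    then show ?thesis by (rule has_vector_derivative_within_subset) (use uv in auto)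
  qed
  have I1: "indef_integral u v y (D1 y)"
    by (rule indef_integral_C1[OF der abs_continuous_on_imp_continuous[OF ac]])
  have "AE x in lebesgue. x \<in> {0<..<pi} - {d} \<longrightarrow>
        (\<exists>y2. (D1 y has_vector_derivative y2) (at x) \<and> - y2 + q x * y x = lam * y x)"
    using sol by (simp add: sl_solution_def)
  then obtain N where N: "negligible N" "{x. \<not> (x \<in> {0<..<pi} - {d} \<longrightarrow>
        (\<exists>y2. (D1 y has_vector_derivative y2) (at x) \<and> - y2 + q x * y x = lam * y x))} \<subseteq> N"
    unfolding eventually_ae_filter_negligible by blast
  have I2: "indef_integral u v (D1 y) (\<lambda>t. (q t - lam) * y t)"
  proof (rule indef_integral_AC_I[OF ac])
    \<comment> \<open>The equation is assumed only inside \<open>{0<..<pi}\<close>, so the endpoints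
      join the exceptional set.\<close>
    show "negligible (N \<union> {0, pi})" using N(1) by (intro negligible_Un) auto
    have "q absolutely_integrable_on {u..v}"
      by (rule absolutely_integrable_on_subinterval[OF q]) (use uv in auto)
    then show "(\<lambda>t. (q t - lam) * y t) absolutely_integrable_on {u..v}"
      by (intro absolutely_integrable_continuous_mult'[OF indef_integral_continuous[OF I1] shifted_abs_integrable])
    fix x assume x: "x \<in> {u..v} - (N \<union> {0, pi})"
    then have xin: "x \<in> {0<..<pi} - {d}" using uv dn by (auto simp: order_less_le)
    have "x \<notin> N" using x by auto
    then have "x \<in> {0<..<pi} - {d} \<longrightarrow>
        (\<exists>y2. (D1 y has_vector_derivative y2) (at x) \<and> - y2 + q x * y x = lam * y x)"
      using N(2) by blast
    then obtain y2 where y2: "(D1 y has_vector_derivative y2) (at x)" "- y2 + q x * y x = lam * y x"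
      using xin by blast
    have "y2 = (q x - lam) * y x" using y2(2) by (simp add: algebra_simps add_eq_0_iff)
    then show "(D1 y has_vector_derivative (q x - lam) * y x) (at x within {u..v})"
      using has_vector_derivative_at_within[OF y2(1)] by simp
  qed
  show ?thesis using I1 I2 by (simp add: sl_system_def)
qed

lemma sl_system_has_derivative:
  assumes "sl_system q lam a b y y'" "x \<in> {a..b}"
  shows "(y has_vector_derivative y' x) (at x within {a..b})"
proof -
  have S: "indef_integral a b y y'" "continuous_on {a..b} y'" using sl_systemD[OF assms(1)] by auto
  have "((\<lambda>u. y a + integral {a..u} y') has_vector_derivative 0 + y' x) (at x within {a..b})"
    by (intro has_vector_derivative_add has_vector_derivative_const integral_has_vector_derivative S(2) assms(2))
  then show ?thesis
    by (intro has_vector_derivative_transform[of x "{a..b}" y "\<lambda>u. y a + integral {a..u} y'"] assms(2))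
      (auto intro: indef_integral_eq[OF S(1)])
qed

text \<open>This ensures that the choice in \<open>phi\<close> picks a genuine solution: solve on
  the left, read the initial values on the right off the jump conditions, and glue.\<close>

lemma phi_exists:
  assumes q: "q absolutely_integrable_on {0..pi}" and d: "0 < d" "d < pi"
  shows "\<exists>y. sl_solution q d lam y \<and> jump_conditions \<beta> \<gamma> d y \<and> y 0 = 1 \<and> D1 y 0 = h"
proof -
  have qL: "q absolutely_integrable_on {0..d}" and qR: "q absolutely_integrable_on {d..pi}"
    using d by (auto intro: absolutely_integrable_on_subinterval[OF q])
  obtain l l' where L: "sl_system q lam 0 d l l'" "l 0 = 1" "l' 0 = h"
    by (rule sl_system_exists[OF qL]) (use d in auto)
  obtain r r' where R: "sl_system q lam d pi r r'" "r d = of_real \<beta> * l d" "r' d = inverse (of_real \<beta>) * l' d + \<gamma> * l d"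
    by (rule sl_system_exists[OF qR]) (use d in auto)
  define y where "y x = (if x < d then l x else r x)" for x
  define y' where "y' x = (if x < d then l' x else r' x)" for x
  have der: "(y has_vector_derivative y' x) (at x within {0..pi})" if x: "x \<in> {0..pi} - {d}" for x
  proof (cases "x < d")
    case True
    have "(l has_vector_derivative l' x) (at x within {0..d})"
      by (rule sl_system_has_derivative[OF L(1)]) (use x True in auto)
    moreover have "at x within {0..d} = at x within {0..pi}"
      by (rule at_within_nhd[of x "{..<d}"]) (use True d in auto)
    ultimately have "(l has_vector_derivative y' x) (at x within {0..pi})" using True by (simp add: y'_def)
    then show ?thesis
      by (rule has_vector_derivative_transform_within[of _ _ _ _ "d - x"])
        (use x True in \<open>auto simp: y_def dist_real_def\<close>)
  next
    case False
    have "(r has_vector_derivative r' x) (at x within {d..pi})"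
      by (rule sl_system_has_derivative[OF R(1)]) (use x False in auto)
    moreover have "at x within {d..pi} = at x within {0..pi}"
      by (rule at_within_nhd[of x "{d<..}"]) (use False x d in auto)
    ultimately have "(r has_vector_derivative y' x) (at x within {0..pi})" using False by (simp add: y'_def)
    then show ?thesis
      by (rule has_vector_derivative_transform_within[of _ _ _ _ "x - d"])
        (use x False in \<open>auto simp: y_def dist_real_def\<close>)
  qed
  have D: "D1 y x = y' x" if "x \<in> {0..pi} - {d}" for x using D1_eq[OF der[OF that]] that by auto
  have lc: "continuous_on {0..d} l" "continuous_on {0..d} l'" and rc: "continuous_on {d..pi} r" "continuous_on {d..pi} r'"
    using sl_systemD[OF L(1)] sl_systemD[OF R(1)] by auto
  have "sl_solution q d lam y"
    unfolding sl_solution_def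
  proof (intro conjI ballI)
    show "y differentiable (at x within {0..pi})" if "x \<in> {0..pi} - {d}" for x
      using der[OF that] by (auto simp: has_vector_derivative_def differentiable_def)
    show "abs_continuous_on {0..<d} (D1 y)"
    proof (rule abs_continuous_on_cong)
      show "abs_continuous_on {0..<d} l'"
        by (rule abs_continuous_on_subset[OF indef_integral_AC[OF sl_systemD(2)[OF L(1)]]]) auto
    qed (use D d in \<open>auto simp: y'_def\<close>)
    show "abs_continuous_on {d<..pi} (D1 y)"
    proof (rule abs_continuous_on_cong)
      show "abs_continuous_on {d<..pi} r'"
        by (rule abs_continuous_on_subset[OF indef_integral_AC[OF sl_systemD(2)[OF R(1)]]]) auto
    qed (use D d in \<open>auto simp: y'_def\<close>)
    obtain N1 where N1: "negligible N1" "\<And>x. x \<in> {0..d} - N1 \<Longrightarrow> (l' has_vector_derivative (q x - lam) * l x) (at x within {0..d})"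
      by (rule indef_integral_deriv_ae[OF sl_systemD(2)[OF L(1)]]) blast
    obtain N2 where N2: "negligible N2" "\<And>x. x \<in> {d..pi} - N2 \<Longrightarrow> (r' has_vector_derivative (q x - lam) * r x) (at x within {d..pi})"
      by (rule indef_integral_deriv_ae[OF sl_systemD(2)[OF R(1)]]) blast
    have *: "(D1 y has_vector_derivative (q x - lam) * y x) (at x)" if x: "x \<in> {0<..<pi} - {d} - (N1 \<union> N2)" for x
    proof (cases "x < d")
      case True
      have "at x within {0..d} = at x" by (rule at_within_Icc_at) (use x True in auto)
      then have "(l' has_vector_derivative (q x - lam) * y x) (at x)"
        using N1(2)[of x] x True by (auto simp: y_def)
      then show ?thesis
        by (rule has_vector_derivative_transform_within_open[of _ _ _ "{0<..<d}"])
          (use True x d D in \<open>auto simp: y'_def\<close>)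
    next
      case False
      have "at x within {d..pi} = at x" by (rule at_within_Icc_at) (use x False in auto)
      then have "(r' has_vector_derivative (q x - lam) * y x) (at x)"
        using N2(2)[of x] x False by (auto simp: y_def)
      then show ?thesis
        by (rule has_vector_derivative_transform_within_open[of _ _ _ "{d<..<pi}"])
          (use False x d D in \<open>auto simp: y'_def\<close>)
    qed
    show "AE x in lebesgue. x \<in> {0<..<pi} - {d} \<longrightarrow>
        (\<exists>y2. (D1 y has_vector_derivative y2) (at x) \<and> - y2 + q x * y x = lam * y x)"
      unfolding eventually_ae_filter_negligible
    proof (intro exI[of _ "N1 \<union> N2"] conjI negligible_Un N1(1) N2(1) subsetI)
      fix x assume "x \<in> {x. \<not> (x \<in> {0<..<pi} - {d} \<longrightarrow>
        (\<exists>y2. (D1 y has_vector_derivative y2) (at x) \<and> - y2 + q x * y x = lam * y x))}"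
      then have x: "x \<in> {0<..<pi} - {d}" and no: "\<not> (\<exists>y2. (D1 y has_vector_derivative y2) (at x) \<and> - y2 + q x * y x = lam * y x)"
        by auto
      show "x \<in> N1 \<union> N2"
      proof (rule ccontr)
        assume "x \<notin> N1 \<union> N2"
        then have "(D1 y has_vector_derivative (q x - lam) * y x) (at x)" using * x by blast
        moreover have "- ((q x - lam) * y x) + q x * y x = lam * y x" by (simp add: algebra_simps)
        ultimately show False using no by blast
      qed
    qed
  qed
  moreover have "jump_conditions \<beta> \<gamma> d y"
    unfolding jump_conditions_def
  proof (intro exI conjI)
    have lim: "(l \<longlongrightarrow> l d) (at_left d)" "(l' \<longlongrightarrow> l' d) (at_left d)"
      using lc d by (auto simp: continuous_on_Icc_at_leftD)
    have rim: "(r \<longlongrightarrow> r d) (at_right d)" "(r' \<longlongrightarrow> r' d) (at_right d)"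
      using rc d by (auto simp: continuous_on_Icc_at_rightD)
    have evl: "eventually (\<lambda>x. 0 < x \<and> x < d) (at_left d)"
      using d eventually_at_left_field[of "\<lambda>x. 0 < x \<and> x < d" d] by auto
    have evr: "eventually (\<lambda>x. d < x \<and> x < pi) (at_right d)"
      using d eventually_at_right_field[of "\<lambda>x. d < x \<and> x < pi" d] by auto
    show "(y \<longlongrightarrow> l d) (at_left d)"
      by (rule Lim_transform_eventually[OF lim(1)]) (use evl in \<open>auto elim!: eventually_mono simp: y_def\<close>)
    show "(y \<longlongrightarrow> r d) (at_right d)"
      by (rule Lim_transform_eventually[OF rim(1)]) (use evr in \<open>auto elim!: eventually_mono simp: y_def\<close>)
    show "(D1 y \<longlongrightarrow> l' d) (at_left d)"
      by (rule Lim_transform_eventually[OF lim(2)])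
        (rule eventually_mono[OF evl], use D d in \<open>auto simp: y'_def\<close>)
    show "(D1 y \<longlongrightarrow> r' d) (at_right d)"
      by (rule Lim_transform_eventually[OF rim(2)])
        (rule eventually_mono[OF evr], use D d in \<open>auto simp: y'_def\<close>)
  qed (use R in auto)
  moreover have "y 0 = 1" "D1 y 0 = h" using D[of 0] d L by (auto simp: y_def y'_def)
  ultimately show ?thesis by blast
qed

text \<open>On the left, \<open>y\<close> agrees with \<open>A\<close> up to every
  \<open>c < d\<close>, so its limits at \<open>d\<close> are the values of \<open>A\<close>. On the
  right, the Wronskians of \<open>y\<close> with \<open>C\<close> and \<open>S\<close> transport the
  limits behind the jump to \<open>pi\<close>. Solving these two linear equations, whose determinant
  is the Wronskian 1 of \<open>C\<close> and \<open>S\<close>, gives the formulas.\<close>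

lemma boundary_values_at_pi:
  assumes q: "q absolutely_integrable_on {0..pi}" and d: "0 < d" "d < pi"
    and sol: "sl_solution q d lam y" and jump: "jump_conditions \<beta> \<gamma> d y" and ini: "y 0 = 1" "D1 y 0 = h"
    and A: "sl_system q lam 0 d A A'" "A 0 = 1" "A' 0 = h"
    and C: "sl_system q lam d pi C C'" "C d = 1" "C' d = 0"
    and S: "sl_system q lam d pi S S'" "S d = 0" "S' d = 1"
  shows "y pi = of_real \<beta> * A d * C pi + (inverse (of_real \<beta>) * A' d + \<gamma> * A d) * S pi"
    "D1 y pi = of_real \<beta> * A d * C' pi + (inverse (of_real \<beta>) * A' d + \<gamma> * A d) * S' pi"
proof -
  obtain yl yr yl' yr' where lims: "(y \<longlongrightarrow> yl) (at_left d)" "(y \<longlongrightarrow> yr) (at_right d)"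
        "(D1 y \<longlongrightarrow> yl') (at_left d)" "(D1 y \<longlongrightarrow> yr') (at_right d)"
        and j: "yr = of_real \<beta> * yl" "yr' = inverse (of_real \<beta>) * yl' + \<gamma> * yl"
    using jump unfolding jump_conditions_def by blast
  have evl: "eventually (\<lambda>x. 0 < x \<and> x < d) (at_left d)"
    using d eventually_at_left_field[of "\<lambda>x. 0 < x \<and> x < d" d] by auto
  have evr: "eventually (\<lambda>x. d < x \<and> x < pi) (at_right d)"
    using d eventually_at_right_field[of "\<lambda>x. d < x \<and> x < pi" d] by auto
  have left: "A c = y c" "A' c = D1 y c" if c: "0 < c" "c < d" for c
  proof -
    have qc: "q absolutely_integrable_on {0..c}"
      by (rule absolutely_integrable_on_subinterval[OF q]) (use c d in auto)
    have "sl_system q lam 0 c A A'" by (rule sl_system_subinterval[OF A(1)]) (use c in auto)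
    moreover have "sl_system q lam 0 c y (D1 y)" by (rule sl_solution_imp_system[OF q sol]) (use c d in auto)
    ultimately show "A c = y c" "A' c = D1 y c"
      using sl_system_unique[OF qc, of lam A A' y "D1 y" c] A ini c by auto
  qed
  have lim: "(A \<longlongrightarrow> A d) (at_left d)" "(A' \<longlongrightarrow> A' d) (at_left d)"
    using sl_systemD[OF A(1)] d by (auto simp: continuous_on_Icc_at_leftD)
  have "(y \<longlongrightarrow> A d) (at_left d)" "(D1 y \<longlongrightarrow> A' d) (at_left d)"
    by (rule Lim_transform_eventually[OF lim(1)], rule eventually_mono[OF evl], simp add: left)
       (rule Lim_transform_eventually[OF lim(2)], rule eventually_mono[OF evl], simp add: left)
  then have yl: "yl = A d" "yl' = A' d"
    using tendsto_unique[OF trivial_limit_at_left_real] lims by blast+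
  \<comment> \<open>The value of \<open>y\<close> at \<open>d\<close> is arbitrary, so
    \<open>y\<close> need not solve the system on the closed interval \<open>{d..pi}\<close>. The
    Wronskian is therefore taken on \<open>{c..pi}\<close>, with \<open>c\<close> tending to
    \<open>d\<close> from the right.\<close>
  have right: "yr * z' d - yr' * z d = y pi * z' pi - D1 y pi * z pi" if z: "sl_system q lam d pi z z'" for z z'
  proof -
    have "(z \<longlongrightarrow> z d) (at_right d)" "(z' \<longlongrightarrow> z' d) (at_right d)"
      using sl_systemD[OF z] d by (auto simp: continuous_on_Icc_at_rightD)
    then have 1: "((\<lambda>c. y c * z' c - D1 y c * z c) \<longlongrightarrow> yr * z' d - yr' * z d) (at_right d)"
      by (intro tendsto_intros lims)
    have "eventually (\<lambda>c. y c * z' c - D1 y c * z c = y pi * z' pi - D1 y pi * z pi) (at_right d)"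
    proof (rule eventually_mono[OF evr])
      fix c assume c: "d < c \<and> c < pi"
      have "sl_system q lam c pi y (D1 y)" by (rule sl_solution_imp_system[OF q sol]) (use c d in auto)
      moreover have "sl_system q lam c pi z z'" by (rule sl_system_subinterval[OF z]) (use c in auto)
      ultimately show "y c * z' c - D1 y c * z c = y pi * z' pi - D1 y pi * z pi"
        by (rule wronskian_const) (use c in auto)
    qed
    then have "((\<lambda>c. y pi * z' pi - D1 y pi * z pi) \<longlongrightarrow> yr * z' d - yr' * z d) (at_right d)"
      by (rule Lim_transform_eventually[OF 1])
    then show ?thesis
      using tendsto_unique[OF trivial_limit_at_right_real _ tendsto_const] by metis
  qed
  have W: "C pi * S' pi - C' pi * S pi = 1"
    using wronskian_const[OF C(1) S(1), of d pi] C S d by simp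
  have r1: "- yr' = y pi * C' pi - D1 y pi * C pi" using right[OF C(1)] C by simp
  have r2: "yr = y pi * S' pi - D1 y pi * S pi" using right[OF S(1)] S by simp
  have "y pi * (C pi * S' pi - C' pi * S pi) = yr * C pi + yr' * S pi"
    using r1 r2 by algebra
  then have 1: "y pi = yr * C pi + yr' * S pi" using W by simp
  have "D1 y pi * (C pi * S' pi - C' pi * S pi) = yr * C' pi + yr' * S' pi"
    using r1 r2 by algebra
  then have 2: "D1 y pi = yr * C' pi + yr' * S' pi" using W by simp
  show "y pi = of_real \<beta> * A d * C pi + (inverse (of_real \<beta>) * A' d + \<gamma> * A d) * S pi"
    "D1 y pi = of_real \<beta> * A d * C' pi + (inverse (of_real \<beta>) * A' d + \<gamma> * A d) * S' pi"
    using 1 2 unfolding j yl by auto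
qed

theorem phi_at_pi:
  assumes q: "q absolutely_integrable_on {0..pi}" and d: "0 < d" "d < pi"
    and A: "sl_system q lam 0 d A A'" "A 0 = 1" "A' 0 = h"
    and C: "sl_system q lam d pi C C'" "C d = 1" "C' d = 0"
    and S: "sl_system q lam d pi S S'" "S d = 0" "S' d = 1"
  shows "phi q h \<beta> \<gamma> d lam pi = of_real \<beta> * A d * C pi + (inverse (of_real \<beta>) * A' d + \<gamma> * A d) * S pi"
    "D1 (phi q h \<beta> \<gamma> d lam) pi = of_real \<beta> * A d * C' pi + (inverse (of_real \<beta>) * A' d + \<gamma> * A d) * S' pi"
proof -
  have "sl_solution q d lam (phi q h \<beta> \<gamma> d lam) \<and> jump_conditions \<beta> \<gamma> d (phi q h \<beta> \<gamma> d lam)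
     \<and> phi q h \<beta> \<gamma> d lam 0 = 1 \<and> D1 (phi q h \<beta> \<gamma> d lam) 0 = h"
    unfolding phi_def by (rule someI_ex[OF phi_exists[OF q d]])
  then show "phi q h \<beta> \<gamma> d lam pi = of_real \<beta> * A d * C pi + (inverse (of_real \<beta>) * A' d + \<gamma> * A d) * S pi"
    "D1 (phi q h \<beta> \<gamma> d lam) pi = of_real \<beta> * A d * C' pi + (inverse (of_real \<beta>) * A' d + \<gamma> * A d) * S' pi"
    using boundary_values_at_pi[OF q d _ _ _ _ A C S] by blast+
qed

section \<open>Asymptotics of solutions\<close>

lemma norm_cos_le_exp: "norm (cos w) \<le> exp \<bar>Im w\<bar>" for w :: complex
  using cmod_cos_le_exp[of 1 w] by simp

lemma norm_sin_le_exp: "norm (sin w) \<le> exp \<bar>Im w\<bar>" for w :: complex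
  using cmod_sin_le_exp[of 1 w] by simp

text \<open>Variation of constants. At \<open>t = x\<close> the first expression is
  \<open>y x\<close>; at \<open>t = z\<close> it is the free solution with the data of
  \<open>y\<close> at \<open>z\<close>; and its derivative contains only \<open>q * y\<close>, not
  \<open>\<rho>\<^sup>2\<close>. The second expression does the same for
  \<open>y' x\<close>.\<close>

lemma sl_system_variation:
  assumes S: "sl_system q (\<rho>\<^sup>2) a b y y'" and \<rho>: "\<rho> \<noteq> 0"
  shows "indef_integral a b (\<lambda>t. y' t * (sin (\<rho> * of_real (x - t)) / \<rho>) + y t * cos (\<rho> * of_real (x - t)))
           (\<lambda>t. q t * y t * (sin (\<rho> * of_real (x - t)) / \<rho>))" (is ?A)
    and "indef_integral a b (\<lambda>t. y' t * cos (\<rho> * of_real (x - t)) - y t * (\<rho> * sin (\<rho> * of_real (x - t))))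
           (\<lambda>t. q t * y t * cos (\<rho> * of_real (x - t)))" (is ?B)
proof -
  let ?w = "\<lambda>t::real. \<rho> * of_real (x - t)"
  have s: "indef_integral a b (\<lambda>t. sin (?w t)) (\<lambda>t. - \<rho> * cos (?w t))"
  proof (rule indef_integral_C1)
    show "((\<lambda>t. sin (?w t)) has_vector_derivative - \<rho> * cos (?w t)) (at t within {a..b})" for t
    proof -
      have "((\<lambda>w. sin (\<rho> * (of_real x - w))) has_field_derivative - \<rho> * cos (?w t)) (at (of_real t))"
        by (auto intro!: derivative_eq_intros)
      from has_vector_derivative_real_field[OF this] show ?thesis by simp
    qed
  qed (intro continuous_intros)
  have c: "indef_integral a b (\<lambda>t. cos (?w t)) (\<lambda>t. \<rho> * sin (?w t))"
  proof (rule indef_integral_C1)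
    show "((\<lambda>t. cos (?w t)) has_vector_derivative \<rho> * sin (?w t)) (at t within {a..b})" for t
    proof -
      have "((\<lambda>w. cos (\<rho> * (of_real x - w))) has_field_derivative \<rho> * sin (?w t)) (at (of_real t))"
        by (auto intro!: derivative_eq_intros)
      from has_vector_derivative_real_field[OF this] show ?thesis by simp
    qed
  qed (intro continuous_intros)
  have 1: "indef_integral a b y y'" and 2: "indef_integral a b y' (\<lambda>t. (q t - \<rho>\<^sup>2) * y t)"
    using sl_systemD[OF S] by auto
  have "indef_integral a b (\<lambda>t. (1/\<rho>) * (y' t * sin (?w t)) + y t * cos (?w t))
     (\<lambda>t. (1/\<rho>) * ((q t - \<rho>\<^sup>2) * y t * sin (?w t) + y' t * (- \<rho> * cos (?w t))) + (y' t * cos (?w t) + y t * (\<rho> * sin (?w t))))"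
    by (intro indef_integral_add indef_integral_cmult indef_integral_mult s c 1 2)
  also have "(\<lambda>t. (1/\<rho>) * ((q t - \<rho>\<^sup>2) * y t * sin (?w t) + y' t * (- \<rho> * cos (?w t))) + (y' t * cos (?w t) + y t * (\<rho> * sin (?w t))))
     = (\<lambda>t. q t * y t * (sin (?w t) / \<rho>))"
    using \<rho> by (simp add: field_simps power2_eq_square)
  finally show ?A by (simp add: field_simps)
  have "indef_integral a b (\<lambda>t. y' t * cos (?w t) - \<rho> * (y t * sin (?w t)))
     (\<lambda>t. ((q t - \<rho>\<^sup>2) * y t * cos (?w t) + y' t * (\<rho> * sin (?w t))) - \<rho> * (y' t * sin (?w t) + y t * (- \<rho> * cos (?w t))))"
    by (intro indef_integral_diff indef_integral_cmult indef_integral_mult s c 1 2)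
  also have "(\<lambda>t. ((q t - \<rho>\<^sup>2) * y t * cos (?w t) + y' t * (\<rho> * sin (?w t))) - \<rho> * (y' t * sin (?w t) + y t * (- \<rho> * cos (?w t))))
     = (\<lambda>t. q t * y t * cos (?w t))"
    by (simp add: algebra_simps power2_eq_square)
  finally show ?B by (simp add: algebra_simps)
qed

text \<open>The weight \<open>exp (\<bar>Im \<rho>\<bar> * \<bar>t - z\<bar>)\<close> is multiplicative along the path from \<open>z\<close> to \<open>x\<close>, so
  the integral term only contributes the factor \<open>\<integral>\<bar>q\<bar>\<close>; no Gronwall argument is needed.\<close>

lemma sl_variation_remainder:
  assumes q: "q absolutely_integrable_on {a..b}"
    and I: "indef_integral a b G (\<lambda>t. q t * y t * k t)"
    and z: "z \<in> {a..b}" and x: "x \<in> {a..b}"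
    and W: "\<And>t. t \<in> {a..b} \<Longrightarrow> norm (y t) \<le> W * exp (T * \<bar>t - z\<bar>)"
    and k: "\<And>t. norm (k t) \<le> \<kappa> * exp (T * \<bar>x - t\<bar>)" and nn: "0 \<le> W" "0 \<le> \<kappa>"
  shows "norm (G x - G z) \<le> \<kappa> * W * exp (T * \<bar>x - z\<bar>) * integral {a..b} (\<lambda>t. norm (q t))"
proof -
  define u where "u = min x z"
  define v where "v = max x z"
  have uv: "a \<le> u" "u \<le> v" "v \<le> b" using x z by (auto simp: u_def v_def)
  have nq: "(\<lambda>t. norm (q t)) integrable_on {a..b}" by (rule absolutely_integrable_norm'[OF q])
  have nqs: "(\<lambda>t. norm (q t)) integrable_on {u..v}"
    by (rule integrable_on_subinterval[OF nq]) (use uv in auto)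
  let ?C = "\<kappa> * W * exp (T * \<bar>x - z\<bar>)"
  have "norm (G x - G z) = norm (G v - G u)"
    by (auto simp: u_def v_def max_def min_def norm_minus_commute)
  also have "\<dots> \<le> integral {u..v} (\<lambda>t. norm (q t * y t * k t))" by (rule indef_integral_bound[OF I uv])
  also have "\<dots> \<le> integral {u..v} (\<lambda>t. ?C * norm (q t))"
  proof (rule integral_le)
    show "(\<lambda>t. norm (q t * y t * k t)) integrable_on {u..v}"
      by (rule integrable_on_subinterval[OF absolutely_integrable_norm'[OF indef_integral_abs_integrable[OF I]]])
        (use uv in auto)
    show "(\<lambda>t. ?C * norm (q t)) integrable_on {u..v}" by (rule integrable_on_mult_right[OF nqs])
    fix t assume t: "t \<in> {u..v}"
    have e: "exp (T * \<bar>t - z\<bar>) * exp (T * \<bar>x - t\<bar>) = exp (T * \<bar>x - z\<bar>)"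
    proof -
      have "\<bar>t - z\<bar> + \<bar>x - t\<bar> = \<bar>x - z\<bar>" using t by (auto simp: u_def v_def min_def max_def split: if_splits)
      then show ?thesis by (simp add: mult_exp_exp distrib_left[symmetric])
    qed
    have "norm (q t * y t * k t) \<le> norm (q t) * (W * exp (T * \<bar>t - z\<bar>)) * (\<kappa> * exp (T * \<bar>x - t\<bar>))"
      unfolding norm_mult using t uv nn by (intro mult_mono W k) auto
    also have "\<dots> = \<kappa> * W * (exp (T * \<bar>t - z\<bar>) * exp (T * \<bar>x - t\<bar>)) * norm (q t)" by simp
    finally show "norm (q t * y t * k t) \<le> ?C * norm (q t)" unfolding e .
  qed
  also have "\<dots> = ?C * integral {u..v} (\<lambda>t. norm (q t))" by simp
  also have "\<dots> \<le> ?C * integral {a..b} (\<lambda>t. norm (q t))"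
    using nn by (intro mult_left_mono integral_subset_le nqs nq) (use uv in auto)
  finally show ?thesis .
qed

text \<open>For \<open>norm \<rho> \<ge> 2 * Q\<close> the remainder of the variation formula is at
  most half the weighted maximum \<open>W\<close> of \<open>y\<close>, so
  \<open>W \<le> 2 * M\<close>; inserting this bound back into the remainders gives the other two
  estimates. The base point \<open>z\<close> may lie on either side of \<open>x\<close>, since
  solutions prescribed at the right end occur as well.\<close>

theorem sl_system_asymptotics:
  assumes q: "q absolutely_integrable_on {a..b}" and S: "sl_system q (\<rho>\<^sup>2) a b y y'"
    and \<rho>: "\<rho> \<noteq> 0" "2 * Q \<le> norm \<rho>" and Q: "Q = integral {a..b} (\<lambda>t. norm (q t))"
    and z: "z \<in> {a..b}" and x: "x \<in> {a..b}" and M: "M = norm (y z) + norm (y' z) / norm \<rho>"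
  shows "norm (y x) \<le> 2 * M * exp (\<bar>Im \<rho>\<bar> * \<bar>x - z\<bar>)"
    and "norm (y x - (y z * cos (\<rho> * of_real (x - z)) + y' z * (sin (\<rho> * of_real (x - z)) / \<rho>)))
      \<le> 2 * Q * M / norm \<rho> * exp (\<bar>Im \<rho>\<bar> * \<bar>x - z\<bar>)"
    and "norm (y' x - (y' z * cos (\<rho> * of_real (x - z)) - y z * (\<rho> * sin (\<rho> * of_real (x - z)))))
      \<le> 2 * Q * M * exp (\<bar>Im \<rho>\<bar> * \<bar>x - z\<bar>)"
proof -
  let ?T = "\<bar>Im \<rho>\<bar>"
  have Q0: "0 \<le> Q" unfolding Q by (rule integral_nonneg) (auto intro: absolutely_integrable_norm'[OF q])
  have M0: "0 \<le> M" by (simp add: M)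
  have nr: "norm \<rho> > 0" using \<rho> by simp
  have cb: "norm (cos (\<rho> * of_real (u - t))) \<le> 1 * exp (?T * \<bar>u - t\<bar>)" for u t
    using norm_cos_le_exp[of "\<rho> * of_real (u - t)"] by (simp add: abs_mult)
  have sb: "norm (sin (\<rho> * of_real (u - t)) / \<rho>) \<le> 1 / norm \<rho> * exp (?T * \<bar>u - t\<bar>)" for u t
    using norm_sin_le_exp[of "\<rho> * of_real (u - t)"] by (simp add: abs_mult norm_divide divide_right_mono)
  let ?w = "\<lambda>t. norm (y t) * exp (- (?T * \<bar>t - z\<bar>))"
  have "continuous_on {a..b} ?w" by (intro continuous_intros sl_systemD(3)[OF S])
  moreover have "{a..b} \<noteq> {}" using x by auto
  ultimately obtain s where s: "s \<in> {a..b}" "\<And>t. t \<in> {a..b} \<Longrightarrow> ?w t \<le> ?w s"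
    using continuous_attains_sup[of "{a..b}" ?w] by auto
  define W where "W = ?w s"
  have W0: "0 \<le> W" by (simp add: W_def)
  have W: "norm (y t) \<le> W * exp (?T * \<bar>t - z\<bar>)" if "t \<in> {a..b}" for t
  proof -
    have "?w t * exp (?T * \<bar>t - z\<bar>) \<le> W * exp (?T * \<bar>t - z\<bar>)"
      unfolding W_def by (intro mult_right_mono s(2)[OF that]) auto
    then show ?thesis by (simp add: mult.assoc mult_exp_exp)
  qed
  have r1: "norm (y u - (y z * cos (\<rho> * of_real (u - z)) + y' z * (sin (\<rho> * of_real (u - z)) / \<rho>)))
      \<le> 1 / norm \<rho> * W * exp (?T * \<bar>u - z\<bar>) * Q" if u: "u \<in> {a..b}" for u
    using sl_variation_remainder[OF q sl_system_variation(1)[OF S \<rho>(1), of u] z u W sb W0] nr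
    by (simp add: Q algebra_simps)
  have r2: "norm (y' x - (y' z * cos (\<rho> * of_real (x - z)) - y z * (\<rho> * sin (\<rho> * of_real (x - z)))))
      \<le> 1 * W * exp (?T * \<bar>x - z\<bar>) * Q"
    using sl_variation_remainder[OF q sl_system_variation(2)[OF S \<rho>(1), of x] z x W cb W0]
    by (simp add: Q algebra_simps)
  have "W * exp (?T * \<bar>s - z\<bar>) = norm (y s)" by (simp add: W_def mult.assoc mult_exp_exp)
  also have "\<dots> \<le> norm (y z * cos (\<rho> * of_real (s - z)) + y' z * (sin (\<rho> * of_real (s - z)) / \<rho>))
       + 1 / norm \<rho> * W * exp (?T * \<bar>s - z\<bar>) * Q"
    using r1[OF s(1)] norm_triangle_sub by (smt (verit, ccfv_SIG))
  also have "norm (y z * cos (\<rho> * of_real (s - z)) + y' z * (sin (\<rho> * of_real (s - z)) / \<rho>))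
      \<le> norm (y z) * (1 * exp (?T * \<bar>s - z\<bar>)) + norm (y' z) * (1 / norm \<rho> * exp (?T * \<bar>s - z\<bar>))"
    by (intro order_trans[OF norm_triangle_ineq] add_mono)
      (unfold norm_mult, (intro mult_left_mono cb sb; simp)+)
  also have "\<dots> = M * exp (?T * \<bar>s - z\<bar>)" by (simp add: M algebra_simps)
  finally have "exp (?T * \<bar>s - z\<bar>) * W \<le> exp (?T * \<bar>s - z\<bar>) * (M + W * (Q / norm \<rho>))"
    by (simp add: algebra_simps)
  then have "W \<le> M + W * (Q / norm \<rho>)" by simp
  also have "W * (Q / norm \<rho>) \<le> W * (1/2)"
    using \<rho> nr W0 by (intro mult_left_mono) (auto simp: field_simps)
  finally have WM: "W \<le> 2 * M" by simp
  show "norm (y x) \<le> 2 * M * exp (?T * \<bar>x - z\<bar>)"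
    by (rule order_trans[OF W[OF x]]) (intro mult_right_mono WM, simp)
  have "1 / norm \<rho> * W * exp (?T * \<bar>x - z\<bar>) * Q \<le> 1 / norm \<rho> * (2 * M) * exp (?T * \<bar>x - z\<bar>) * Q"
    using Q0 by (intro mult_right_mono mult_left_mono WM) auto
  with r1[OF x] show "norm (y x - (y z * cos (\<rho> * of_real (x - z)) + y' z * (sin (\<rho> * of_real (x - z)) / \<rho>)))
      \<le> 2 * Q * M / norm \<rho> * exp (?T * \<bar>x - z\<bar>)" by (simp add: mult_ac)
  have "1 * W * exp (?T * \<bar>x - z\<bar>) * Q \<le> 1 * (2 * M) * exp (?T * \<bar>x - z\<bar>) * Q"
    using Q0 by (intro mult_right_mono mult_left_mono WM) auto
  with r2 show "norm (y' x - (y' z * cos (\<rho> * of_real (x - z)) - y z * (\<rho> * sin (\<rho> * of_real (x - z)))))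
      \<le> 2 * Q * M * exp (?T * \<bar>x - z\<bar>)" by (simp add: mult_ac)
qed

section \<open>Division of entire functions\<close>

text \<open>Local divisibility by \<open>(w - z) ^ j\<close>: a lower bound on the multiplicity that
  also makes sense for the zero function, which is what \<open>F\<close> turns out to be.\<close>

definition pow_dvd :: "complex \<Rightarrow> nat \<Rightarrow> (complex \<Rightarrow> complex) \<Rightarrow> bool" where
  "pow_dvd z j f \<longleftrightarrow>
     (\<exists>r>0. \<exists>k. k holomorphic_on ball z r \<and> (\<forall>w\<in>ball z r. f w = (w - z) ^ j * k w))"

lemma pow_dvd_mult:
  assumes "pow_dvd z i f" "pow_dvd z j g" shows "pow_dvd z (i + j) (\<lambda>w. f w * g w)"
proof -
  obtain r k where 1: "r > 0" "k holomorphic_on ball z r" "\<And>w. w \<in> ball z r \<Longrightarrow> f w = (w - z) ^ i * k w"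
    using assms(1) unfolding pow_dvd_def by blast
  obtain s m where 2: "s > 0" "m holomorphic_on ball z s" "\<And>w. w \<in> ball z s \<Longrightarrow> g w = (w - z) ^ j * m w"
    using assms(2) unfolding pow_dvd_def by blast
  show ?thesis unfolding pow_dvd_def
  proof (intro exI[of _ "min r s"] conjI exI[of _ "\<lambda>w. k w * m w"] ballI)
    show "(\<lambda>w. k w * m w) holomorphic_on ball z (min r s)"
      by (intro holomorphic_on_mult holomorphic_on_subset[OF 1(2)] holomorphic_on_subset[OF 2(2)]) auto
  qed (use 1 2 in \<open>auto simp: power_add\<close>)
qed

lemma pow_dvd_0: "f holomorphic_on UNIV \<Longrightarrow> pow_dvd z 0 f"
  unfolding pow_dvd_def by (intro exI[of _ 1] conjI exI[of _ f]) (auto intro: holomorphic_on_subset)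

lemma pow_dvd_mono:
  assumes "pow_dvd z j f" "i \<le> j" shows "pow_dvd z i f"
proof -
  obtain r k where 1: "r > 0" "k holomorphic_on ball z r" "\<And>w. w \<in> ball z r \<Longrightarrow> f w = (w - z) ^ j * k w"
    using assms(1) unfolding pow_dvd_def by blast
  show ?thesis unfolding pow_dvd_def
  proof (intro exI[of _ r] conjI exI[of _ "\<lambda>w. (w - z) ^ (j - i) * k w"] ballI)
    show "(\<lambda>w. (w - z) ^ (j - i) * k w) holomorphic_on ball z r" by (intro holomorphic_intros 1)
    show "f w = (w - z) ^ i * ((w - z) ^ (j - i) * k w)" if "w \<in> ball z r" for w
      using 1(3)[OF that] assms(2) by (simp add: mult.assoc[symmetric] power_add[symmetric])
  qed (use 1 in auto)
qed

lemma pow_dvd_diff: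
  assumes "pow_dvd z j f" "pow_dvd z j g" shows "pow_dvd z j (\<lambda>w. f w - g w)"
proof -
  obtain r k where 1: "r > 0" "k holomorphic_on ball z r" "\<And>w. w \<in> ball z r \<Longrightarrow> f w = (w - z) ^ j * k w"
    using assms(1) unfolding pow_dvd_def by blast
  obtain s m where 2: "s > 0" "m holomorphic_on ball z s" "\<And>w. w \<in> ball z s \<Longrightarrow> g w = (w - z) ^ j * m w"
    using assms(2) unfolding pow_dvd_def by blast
  show ?thesis unfolding pow_dvd_def
  proof (intro exI[of _ "min r s"] conjI exI[of _ "\<lambda>w. k w - m w"] ballI)
    show "(\<lambda>w. k w - m w) holomorphic_on ball z (min r s)"
      by (intro holomorphic_on_diff holomorphic_on_subset[OF 1(2)] holomorphic_on_subset[OF 2(2)]) auto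
  qed (use 1 2 in \<open>auto simp: algebra_simps\<close>)
qed

lemma pow_dvd_cancel:
  assumes "pow_dvd z j (\<lambda>w. u w * f w)" "u holomorphic_on UNIV" "u z \<noteq> 0"
  shows "pow_dvd z j f"
proof -
  obtain r k where 1: "r > 0" "k holomorphic_on ball z r" "\<And>w. w \<in> ball z r \<Longrightarrow> u w * f w = (w - z) ^ j * k w"
    using assms(1) unfolding pow_dvd_def by blast
  have "continuous (at z) u" using assms(2)
    by (meson UNIV_I continuous_on_eq_continuous_at holomorphic_on_imp_continuous_on open_UNIV)
  then obtain s where s: "s > 0" "\<And>w. dist z w < s \<Longrightarrow> u w \<noteq> 0"
    using continuous_at_avoid[of z u 0] assms(3) by blast
  show ?thesis unfolding pow_dvd_def
  proof (intro exI[of _ "min r s"] conjI exI[of _ "\<lambda>w. k w / u w"] ballI)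
    show "(\<lambda>w. k w / u w) holomorphic_on ball z (min r s)"
      by (intro holomorphic_on_divide holomorphic_on_subset[OF 1(2)] holomorphic_on_subset[OF assms(2)])
        (use s in auto)
    fix w assume w: "w \<in> ball z (min r s)"
    then have "u w \<noteq> 0" "u w * f w = (w - z) ^ j * k w" using s 1 by auto
    then show "f w = (w - z) ^ j * (k w / u w)" by (simp add: field_simps)
  qed (use 1 s in auto)
qed

lemma zorder_local_factor:
  assumes f: "f holomorphic_on UNIV" and "f z0 \<noteq> 0"
  obtains r g where "r > 0" "g holomorphic_on ball z r" "zorder f z \<ge> 0" "f z = 0 \<longleftrightarrow> zorder f z > 0"
    "\<And>w. w \<in> ball z r \<Longrightarrow> g w \<noteq> 0" "\<And>w. w \<in> ball z r \<Longrightarrow> f w = (w - z) ^ nat (zorder f z) * g w"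
proof -
  have "(if f z = 0 then zorder f z > 0 else zorder f z = 0) \<and> (\<exists>r. r>0 \<and> cball z r \<subseteq> UNIV \<and> zor_poly f z holomorphic_on cball z r
    \<and> (\<forall>w\<in>cball z r. f w  = zor_poly f z w * (w-z) ^ nat (zorder f z) \<and> zor_poly f z w \<noteq>0))"
    by (rule zorder_exist_zero[OF f]) (use assms in auto)
  then obtain r where r: "if f z = 0 then zorder f z > 0 else zorder f z = 0" "r > 0" "zor_poly f z holomorphic_on cball z r"
    "\<And>w. w\<in>cball z r \<Longrightarrow> f w  = zor_poly f z w * (w-z) ^ nat (zorder f z) \<and> zor_poly f z w \<noteq>0" by blast
  show ?thesis
  proof (rule that[of r "zor_poly f z"])
    show "zor_poly f z holomorphic_on ball z r" by (rule holomorphic_on_subset[OF r(3)]) auto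
    show "f w = (w - z) ^ nat (zorder f z) * zor_poly f z w" "zor_poly f z w \<noteq> 0" if "w \<in> ball z r" for w
      using r(4)[of w] that by auto
  qed (use r in \<open>auto split: if_splits\<close>)
qed

lemma pow_dvd_zorder:
  assumes f: "f holomorphic_on UNIV" "f z0 \<noteq> 0" shows "pow_dvd z (nat (zorder f z)) f"
  using zorder_local_factor[OF assms, of z] unfolding pow_dvd_def by metis

text \<open>Near a zero of \<open>D\<close> the power of \<open>w - z\<close> in \<open>N\<close>
  cancels the one in \<open>D\<close>, so the quotient has a removable singularity. \<open>G\<close>
  takes its value there from the limit.\<close>

lemma entire_division:
  assumes D: "D holomorphic_on UNIV" "D z0 \<noteq> 0" and N: "N holomorphic_on UNIV"
    and dv: "\<And>z. D z = 0 \<Longrightarrow> pow_dvd z (nat (zorder D z)) N"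
  obtains G where "G holomorphic_on UNIV" "\<And>w. N w = D w * G w"
proof -
  define G where "G w = (if D w \<noteq> 0 then N w / D w else Lim (at w) (\<lambda>v. N v / D v))" for w
  have loc: "\<exists>e>0. G holomorphic_on ball z e" for z
  proof (cases "D z = 0")
    case False
    have "continuous (at z) D" using D(1)
      by (meson UNIV_I continuous_on_eq_continuous_at holomorphic_on_imp_continuous_on open_UNIV)
    then obtain s where s: "s > 0" "\<And>w. dist z w < s \<Longrightarrow> D w \<noteq> 0"
      using continuous_at_avoid[of z D 0] False by blast
    have "(\<lambda>w. N w / D w) holomorphic_on ball z s"
      by (intro holomorphic_on_divide holomorphic_on_subset[OF N] holomorphic_on_subset[OF D(1)]) (use s in auto)
    then have "G holomorphic_on ball z s"
      by (rule holomorphic_transform) (use s in \<open>auto simp: G_def\<close>)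
    with s show ?thesis by blast
  next
    case True
    obtain r g where g: "r > 0" "g holomorphic_on ball z r" "zorder D z > 0" "\<And>w. w \<in> ball z r \<Longrightarrow> g w \<noteq> 0"
      "\<And>w. w \<in> ball z r \<Longrightarrow> D w = (w - z) ^ nat (zorder D z) * g w"
      by (rule zorder_local_factor[OF D, of z]) (use True in blast)
    obtain s k where k: "s > 0" "k holomorphic_on ball z s" "\<And>w. w \<in> ball z s \<Longrightarrow> N w = (w - z) ^ nat (zorder D z) * k w"
      using dv[OF True] unfolding pow_dvd_def by blast
    define t where "t = min r s"
    have t: "t > 0" using g k by (simp add: t_def)
    have hol: "(\<lambda>w. k w / g w) holomorphic_on ball z t"
      by (intro holomorphic_on_divide holomorphic_on_subset[OF k(2)] holomorphic_on_subset[OF g(2)])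
        (use g(4) in \<open>auto simp: t_def\<close>)
    have eq: "N w / D w = k w / g w" "D w \<noteq> 0" if "w \<in> ball z t" "w \<noteq> z" for w
      using g(4,5)[of w] k(3)[of w] that by (auto simp: t_def)
    have "isCont (\<lambda>w. k w / g w) z"
      using holomorphic_on_imp_continuous_on[OF hol] t by (simp add: continuous_on_eq_continuous_at)
    then have "((\<lambda>w. k w / g w) \<longlongrightarrow> k z / g z) (at z)" by (simp add: isCont_def)
    then have "((\<lambda>w. N w / D w) \<longlongrightarrow> k z / g z) (at z)"
    proof (rule Lim_transform_eventually)
      show "\<forall>\<^sub>F w in at z. k w / g w = N w / D w"
        unfolding eventually_at by (intro exI[of _ t]) (use t eq in \<open>auto simp: dist_commute\<close>)
    qed
    then have "Lim (at z) (\<lambda>w. N w / D w) = k z / g z" by (intro tendsto_Lim) auto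
    then have "G z = k z / g z" using True by (simp add: G_def)
    then have "k w / g w = G w" if "w \<in> ball z t" for w
      using eq[OF that] by (cases "w = z") (auto simp: G_def)
    then have "G holomorphic_on ball z t" by (intro holomorphic_transform[OF hol]) auto
    with t show ?thesis by blast
  qed
  show ?thesis
  proof (rule that[of G])
    have "G analytic_on UNIV" unfolding analytic_on_def using loc by blast
    then show "G holomorphic_on UNIV" by (rule analytic_imp_holomorphic)
    fix w show "N w = D w * G w"
    proof (cases "D w = 0")
      case True
      obtain r g where "zorder D w > 0" by (rule zorder_local_factor[OF D, of w]) (use True in blast)
      moreover obtain s k where "s > 0" "\<And>v. v \<in> ball w s \<Longrightarrow> N v = (v - w) ^ nat (zorder D w) * k v"
        using dv[OF True] unfolding pow_dvd_def by blast
      then have "N w = (w - w) ^ nat (zorder D w) * k w" by simp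
      ultimately show ?thesis using True by simp
    qed (simp add: G_def)
  qed
qed

section \<open>Counting common zeros with multiplicity\<close>

lemma pow_dvd_linear_prod:
  assumes "finite L"
  shows "pow_dvd z (card {n \<in> L. l n = z}) (\<lambda>w. \<Prod>n\<in>L. w - l n)"
  using assms
proof induction
  case empty
  have "pow_dvd z 0 (\<lambda>w. 1)" by (rule pow_dvd_0) simp
  then show ?case by simp
next
  case (insert m L)
  have *: "pow_dvd z (if l m = z then 1 else 0) (\<lambda>w. w - l m)"
  proof (cases "l m = z")
    case True
    then show ?thesis unfolding pow_dvd_def
      by (intro exI[of _ 1] conjI exI[of _ "\<lambda>w. 1"]) auto
  next
    case False
    then show ?thesis by (auto intro!: pow_dvd_0 holomorphic_intros)
  qed
  have "{n \<in> insert m L. l n = z} = (if l m = z then insert m {n \<in> L. l n = z} else {n \<in> L. l n = z})" by auto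
  then have "card {n \<in> insert m L. l n = z} = (if l m = z then 1 else 0) + card {n \<in> L. l n = z}"
    using insert by auto
  with pow_dvd_mult[OF * insert.IH] insert show ?case by simp
qed

text \<open>Split the indices \<open>n\<close> with \<open>l n = z\<close>. Those in
  \<open>L\<close> are paid for by the linear factors. The others, \<open>?C\<close>, are sent
  injectively by \<open>p\<close> to indices of \<open>lt\<close> with the same value, so both
  \<open>D\<close> and \<open>Dt\<close> vanish at \<open>z\<close> to order at least
  \<open>card ?C\<close>, and so does \<open>F\<close> by \<open>common\<close>. The two counts add
  up to the order of \<open>D\<close> at \<open>z\<close>.\<close>

lemma common_zeros_division:
  assumes D: "D holomorphic_on UNIV" "D z0 \<noteq> 0" and Dt: "Dt holomorphic_on UNIV" "Dt z1 \<noteq> 0"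
    and l: "eigenvalue_seq D l" and lt: "eigenvalue_seq Dt lt" and co: "coincide_except k l lt"
    and F: "F holomorphic_on UNIV"
    and common: "\<And>z j. pow_dvd z j D \<Longrightarrow> pow_dvd z j Dt \<Longrightarrow> pow_dvd z j F"
  obtains L G where "finite L" "card L = k" "G holomorphic_on UNIV" "\<And>w. (\<Prod>n\<in>L. w - l n) * F w = D w * G w"
proof -
  obtain L Lt p where L: "finite L" "card L = k" and Lt: "finite Lt" "card Lt = k"
    and p: "bij_betw p (UNIV - L) (UNIV - Lt)" "\<And>n. n \<in> UNIV - L \<Longrightarrow> l n = lt (p n)"
    using co unfolding coincide_except_def by blast
  have ord: "finite {n. l n = z}" "int (card {n. l n = z}) = zorder D z" if "D z = 0" for z
    using l that unfolding eigenvalue_seq_def by blast+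
  have ordt: "finite {n. lt n = z}" "int (card {n. lt n = z}) = zorder Dt z" if "Dt z = 0" for z
    using lt that unfolding eigenvalue_seq_def by blast+
  have "pow_dvd z (nat (zorder D z)) (\<lambda>w. (\<Prod>n\<in>L. w - l n) * F w)" if z: "D z = 0" for z
  proof -
    let ?A = "{n \<in> L. l n = z}" and ?C = "{n. n \<notin> L \<and> l n = z}"
    have fin: "finite ?A" "finite ?C" "?A \<inter> ?C = {}" "{n. l n = z} = ?A \<union> ?C"
      using ord(1)[OF z] by (auto elim: rev_finite_subset)
    have card: "nat (zorder D z) = card ?A + card ?C"
    proof -
      have "card {n. l n = z} = card ?A + card ?C"
        by (subst fin(4)) (rule card_Un_disjoint[OF fin(1-3)])
      then show ?thesis using ord(2)[OF z] by linarith
    qed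
    have "pow_dvd z (card ?C) F"
    proof (cases "?C = {}")
      case True show ?thesis unfolding True using pow_dvd_0[OF F] by simp
    next
      case False
      then obtain n where n: "n \<notin> L" "l n = z" by blast
      have "Dt (lt (p n)) = 0" using lt unfolding eigenvalue_seq_def by blast
      then have zt: "Dt z = 0" using p(2)[of n] n by simp
      have "p ` ?C \<subseteq> {n. lt n = z}" using p(2) by auto
      moreover have "inj_on p ?C" using p(1) by (auto simp: bij_betw_def intro: inj_on_subset)
      ultimately have "card ?C \<le> card {n. lt n = z}" using ordt(1)[OF zt] by (metis card_inj_on_le)
      then have "card ?C \<le> nat (zorder Dt z)" using ordt(2)[OF zt] by simp
      then have "pow_dvd z (card ?C) Dt" by (rule pow_dvd_mono[OF pow_dvd_zorder[OF Dt]])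
      moreover have "pow_dvd z (card ?C) D" by (rule pow_dvd_mono[OF pow_dvd_zorder[OF D]]) (simp add: card)
      ultimately show ?thesis by (intro common)
    qed
    from pow_dvd_mult[OF pow_dvd_linear_prod[OF L(1), of z l] this] show ?thesis by (simp add: card)
  qed
  then obtain G where "G holomorphic_on UNIV" "\<And>w. (\<Prod>n\<in>L. w - l n) * F w = D w * G w"
    by (rule entire_division[OF D, rotated]) (auto intro!: holomorphic_intros F)
  with L show ?thesis by (intro that) auto
qed

text \<open>The maximum principle carries the bound from the squares to all points, so
  \<open>G\<close> is a polynomial by Liouville. A nonconstant polynomial is unbounded along the
  imaginary axis, and a constant with limit 0 is 0. The offset \<open>\<theta>\<close> lets each
  boundary value problem choose where its squares cross the real axis.\<close>

lemma entire_zero_of_square_bounds: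
  fixes \<theta> C :: real
  assumes G: "G holomorphic_on UNIV" and \<theta>: "0 \<le> \<theta>" "\<theta> < 2"
    and bound: "\<And>N z. N \<ge> N0 \<Longrightarrow> max \<bar>Re z\<bar> \<bar>Im z\<bar> = 2 * real N + \<theta> \<Longrightarrow> norm (G z) \<le> C * norm z ^ p"
    and lim: "(\<lambda>n. G (\<i> * of_nat n)) \<longlonglongrightarrow> 0"
  shows "G z = 0"
proof -
  define C' where "C' = max C 0"
  have C': "0 \<le> C'" "C \<le> C'" by (auto simp: C'_def)
  define B where "B = C' * (2 * (2 * real N0 + 8)) ^ p"
  have est: "norm (G z) \<le> B * norm z ^ p" if z: "1 \<le> norm z" for z
  proof -
    define m where "m = max \<bar>Re z\<bar> \<bar>Im z\<bar>"
    \<comment> \<open>The summand \<open>N0\<close> puts the square into the range of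
      \<open>bound\<close>, and \<open>+ 1\<close> makes it contain \<open>z\<close> strictly. The
      half-width \<open>R\<close> is then at most \<open>(2 * N0 + 8) * norm z\<close>, and points
      of the square have modulus at most \<open>2 * R\<close>; this is the origin of
      \<open>B\<close>.\<close>
    define N where "N = nat \<lceil>m\<rceil> + N0 + 1"
    define R where "R = 2 * real N + \<theta>"
    have m0: "0 \<le> m" and mz: "m \<le> norm z" using abs_Re_le_cmod abs_Im_le_cmod by (auto simp: m_def)
    have Nm: "m < real N" "real N \<le> m + 2 + real N0" using m0 unfolding N_def by linarith+
    have Rm: "m < R" using Nm \<theta> by (simp add: R_def)
    have R0: "0 < R" using Rm m0 by simp
    have "real N0 * 1 \<le> real N0 * norm z" using z by (intro mult_left_mono) auto
    then have RK: "R \<le> (2 * real N0 + 8) * norm z"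
      using Nm \<theta> mz z unfolding R_def by (simp add: algebra_simps)
    let ?S = "box (Complex (-R) (-R)) (Complex R R)"
    have "norm (G z) \<le> C' * (2 * R) ^ p"
    proof (rule maximum_modulus_frontier[of G ?S])
      show "G holomorphic_on interior ?S" "continuous_on (closure ?S) G"
        by (rule holomorphic_on_subset[OF G] continuous_on_subset[OF holomorphic_on_imp_continuous_on[OF G]]; simp)+
      show "bounded ?S" by (rule bounded_box)
      show "z \<in> ?S" using Rm by (auto simp: in_box_complex_iff m_def)
      fix w assume "w \<in> frontier ?S"
      then have w: "w \<in> cbox (Complex (-R) (-R)) (Complex R R)" "w \<notin> ?S"
        by (auto simp: frontier_box split: if_splits)
      then have wR: "max \<bar>Re w\<bar> \<bar>Im w\<bar> = R"
        by (auto simp: in_box_complex_iff in_cbox_complex_iff max_def)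
      have "norm w \<le> \<bar>Re w\<bar> + \<bar>Im w\<bar>" by (rule cmod_le)
      then have nw: "norm w \<le> 2 * R" using wR by linarith
      have "norm (G w) \<le> C * norm w ^ p"
        by (rule bound[of N]) (use wR in \<open>auto simp: N_def R_def\<close>)
      also have "\<dots> \<le> C' * (2 * R) ^ p"
        using C' nw by (intro mult_mono power_mono) auto
      finally show "norm (G w) \<le> C' * (2 * R) ^ p" .
    qed
    also have "\<dots> \<le> C' * (2 * ((2 * real N0 + 8) * norm z)) ^ p"
      using C' RK R0 by (intro mult_left_mono power_mono) auto
    also have "\<dots> = B * norm z ^ p"
      unfolding B_def mult.assoc power_mult_distrib[symmetric] by (simp only: mult.assoc)
    finally show ?thesis .
  qed
  define c where "c k = (deriv ^^ k) G 0 / fact k" for k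
  have poly: "G z = (\<Sum>k\<le>p. c k * z ^ k)" for z
    unfolding c_def by (rule Liouville_polynomial[OF G est])
  have c0: "c k = 0" if k: "1 \<le> k" "k \<le> p" for k
  proof (rule ccontr)
    assume "c k \<noteq> 0"
    then have "eventually (\<lambda>z. 1 \<le> norm (G z)) at_infinity"
      unfolding poly using k by (intro polyfun_extremal exI[of _ k]) auto
    then obtain b where b: "\<And>z. b \<le> norm z \<Longrightarrow> 1 \<le> norm (G z)" unfolding eventually_at_infinity by blast
    have "eventually (\<lambda>n. norm (G (\<i> * of_nat n)) < 1) sequentially"
      using tendsto_norm[OF lim] order_tendstoD(2) by fastforce
    moreover have "eventually (\<lambda>n. b \<le> real n) sequentially"
      by (meson eventually_sequentiallyI le_trans of_nat_le_iff order_trans real_arch_simple)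
    ultimately have "eventually (\<lambda>n. False) sequentially"
    proof eventually_elim
      case (elim n)
      then show ?case using b[of "\<i> * of_nat n"] by (simp add: norm_mult)
    qed
    then show False by simp
  qed
  have const: "G z = c 0" for z
  proof -
    have "(\<Sum>k\<le>p. c k * z ^ k) = (\<Sum>k\<le>p. if k = 0 then c 0 else 0)"
      by (rule sum.cong) (use c0 in auto)
    then show ?thesis unfolding poly by simp
  qed
  have "c 0 = 0" using lim unfolding const by (simp add: LIMSEQ_const_iff)
  then show ?thesis using const by simp
qed

section \<open>Growth and lower bounds of the characteristic functions\<close>

text \<open>The bound \<open>O(\<bar>\<rho>\<bar> powi k * exp (\<sigma> * \<bar>Im
  \<rho>\<bar>))\<close> at infinity. Both indices add under products, so error terms can be tracked
  by arithmetic; the power is an integer because errors have index -1 or -2.\<close>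

definition growth :: "real \<Rightarrow> int \<Rightarrow> (complex \<Rightarrow> complex) \<Rightarrow> bool" where
  "growth \<sigma> k f \<longleftrightarrow> (\<exists>C R. 0 \<le> C \<and> 1 \<le> R \<and>
     (\<forall>\<rho>. R \<le> norm \<rho> \<longrightarrow> norm (f \<rho>) \<le> C * (norm \<rho> powi k * exp (\<sigma> * \<bar>Im \<rho>\<bar>))))"

section \<open>Calculus of growth bounds\<close>

lemma growthI:
  assumes "\<And>\<rho>. R \<le> norm \<rho> \<Longrightarrow> 1 \<le> norm \<rho> \<Longrightarrow> norm (f \<rho>) \<le> C * (norm \<rho> powi k * exp (\<sigma> * \<bar>Im \<rho>\<bar>))"
  shows "growth \<sigma> k f"
  unfolding growth_def
proof (rule exI[of _ "max C 0"], rule exI[of _ "max R 1"], intro conjI allI impI)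
  fix \<rho> :: complex assume "max R 1 \<le> norm \<rho>"
  then have "norm (f \<rho>) \<le> C * (norm \<rho> powi k * exp (\<sigma> * \<bar>Im \<rho>\<bar>))" by (intro assms) auto
  also have "\<dots> \<le> max C 0 * (norm \<rho> powi k * exp (\<sigma> * \<bar>Im \<rho>\<bar>))" by (intro mult_right_mono) auto
  finally show "norm (f \<rho>) \<le> \<dots>" .
qed auto

lemma growthE:
  assumes "growth \<sigma> k f"
  obtains C R where "0 \<le> C" "1 \<le> R"
    "\<And>\<rho>. R \<le> norm \<rho> \<Longrightarrow> norm (f \<rho>) \<le> C * (norm \<rho> powi k * exp (\<sigma> * \<bar>Im \<rho>\<bar>))"
  using assms unfolding growth_def by blast

lemma growth_add:
  assumes "growth \<sigma> k f" "growth \<sigma> k g" shows "growth \<sigma> k (\<lambda>\<rho>. f \<rho> + g \<rho>)"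
proof -
  obtain C R where f: "\<And>\<rho>. R \<le> norm \<rho> \<Longrightarrow> norm (f \<rho>) \<le> C * (norm \<rho> powi k * exp (\<sigma> * \<bar>Im \<rho>\<bar>))"
    by (rule growthE[OF assms(1)]) blast
  obtain D S where g: "\<And>\<rho>. S \<le> norm \<rho> \<Longrightarrow> norm (g \<rho>) \<le> D * (norm \<rho> powi k * exp (\<sigma> * \<bar>Im \<rho>\<bar>))"
    by (rule growthE[OF assms(2)]) blast
  show ?thesis
  proof (rule growthI[of "max R S" _ "C + D"])
    fix \<rho> :: complex assume "max R S \<le> norm \<rho>"
    then show "norm (f \<rho> + g \<rho>) \<le> (C + D) * (norm \<rho> powi k * exp (\<sigma> * \<bar>Im \<rho>\<bar>))"
      unfolding distrib_right by (intro order_trans[OF norm_triangle_ineq] add_mono f g) auto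
  qed
qed

lemma growth_mult:
  assumes "growth \<sigma> k f" "growth \<tau> l g" shows "growth (\<sigma> + \<tau>) (k + l) (\<lambda>\<rho>. f \<rho> * g \<rho>)"
proof -
  obtain C R where f: "0 \<le> C" "\<And>\<rho>. R \<le> norm \<rho> \<Longrightarrow> norm (f \<rho>) \<le> C * (norm \<rho> powi k * exp (\<sigma> * \<bar>Im \<rho>\<bar>))"
    by (rule growthE[OF assms(1)]) blast
  obtain D S where g: "0 \<le> D" "\<And>\<rho>. S \<le> norm \<rho> \<Longrightarrow> norm (g \<rho>) \<le> D * (norm \<rho> powi l * exp (\<tau> * \<bar>Im \<rho>\<bar>))"
    by (rule growthE[OF assms(2)]) blast
  show ?thesis
  proof (rule growthI[of "max R S" _ "C * D"])
    fix \<rho> :: complex assume \<rho>: "max R S \<le> norm \<rho>" "1 \<le> norm \<rho>"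
    have "norm (f \<rho> * g \<rho>) \<le> (C * (norm \<rho> powi k * exp (\<sigma> * \<bar>Im \<rho>\<bar>))) * (D * (norm \<rho> powi l * exp (\<tau> * \<bar>Im \<rho>\<bar>)))"
      unfolding norm_mult using \<rho> f(1) by (intro mult_mono f g) auto
    also have "\<dots> = C * D * (norm \<rho> powi (k + l) * exp ((\<sigma> + \<tau>) * \<bar>Im \<rho>\<bar>))"
      using \<rho> by (subst power_int_add) (auto simp: distrib_right exp_add)
    finally show "norm (f \<rho> * g \<rho>) \<le> \<dots>" .
  qed
qed

lemma growth_cmult: "growth \<sigma> k f \<Longrightarrow> growth \<sigma> k (\<lambda>\<rho>. c * f \<rho>)"
proof -
  assume "growth \<sigma> k f"
  moreover have "growth 0 0 (\<lambda>\<rho>. c)" by (rule growthI[of 0 _ "norm c"]) simp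
  ultimately show ?thesis using growth_mult[of 0 0 "\<lambda>\<rho>. c" \<sigma> k f] by simp
qed

lemma growth_diff:
  "growth \<sigma> k f \<Longrightarrow> growth \<sigma> k g \<Longrightarrow> growth \<sigma> k (\<lambda>\<rho>. f \<rho> - g \<rho>)"
  using growth_add[of \<sigma> k f "\<lambda>\<rho>. - 1 * g \<rho>"] growth_cmult[of \<sigma> k g "-1"] by simp

lemma growth_mono:
  assumes "growth \<sigma> k f" "k \<le> l" shows "growth \<sigma> l f"
proof -
  obtain C R where f: "0 \<le> C" "\<And>\<rho>. R \<le> norm \<rho> \<Longrightarrow> norm (f \<rho>) \<le> C * (norm \<rho> powi k * exp (\<sigma> * \<bar>Im \<rho>\<bar>))"
    by (rule growthE[OF assms(1)]) blast
  show ?thesis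
  proof (rule growthI[of R _ C])
    fix \<rho> :: complex assume \<rho>: "R \<le> norm \<rho>" "1 \<le> norm \<rho>"
    note f(2)[OF \<rho>(1)]
    also have "C * (norm \<rho> powi k * exp (\<sigma> * \<bar>Im \<rho>\<bar>)) \<le> C * (norm \<rho> powi l * exp (\<sigma> * \<bar>Im \<rho>\<bar>))"
      using f(1) \<rho>(2) assms(2) by (intro mult_left_mono mult_right_mono power_int_increasing) auto
    finally show "norm (f \<rho>) \<le> \<dots>" .
  qed
qed

lemma growth_of_add_diff: "growth \<sigma> k (\<lambda>\<rho>. f \<rho> - g \<rho>) \<Longrightarrow> growth \<sigma> k g \<Longrightarrow> growth \<sigma> k f"
  using growth_add[of \<sigma> k "\<lambda>\<rho>. f \<rho> - g \<rho>" g] by simp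

lemma growth_cos: "0 \<le> d \<Longrightarrow> growth d 0 (\<lambda>\<rho>. cos (\<rho> * of_real d))"
  by (rule growthI[of 0 _ 1]) (use norm_cos_le_exp in \<open>fastforce simp: abs_mult mult.commute intro: order_trans\<close>)

lemma growth_sin: "0 \<le> d \<Longrightarrow> growth d 0 (\<lambda>\<rho>. sin (\<rho> * of_real d))"
  by (rule growthI[of 0 _ 1]) (use norm_sin_le_exp in \<open>fastforce simp: abs_mult mult.commute intro: order_trans\<close>)

lemma growth_id: "growth 0 1 (\<lambda>\<rho>. \<rho>)"
  by (rule growthI[of 0 _ 1]) simp

lemma growth_inverse: "growth 0 (-1) (\<lambda>\<rho>. 1 / \<rho>)"
  by (rule growthI[of 0 _ 1]) (simp add: norm_divide power_int_minus field_simps)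

text \<open>The initial slope enters through
  \<open>\<eta> * sin (\<rho> * (x - a)) / \<rho>\<close>, which has the order of the error, so the
  leading terms are the same for every \<open>\<eta>\<close> and every \<open>q\<close>.\<close>

lemma growth_sl_sol_cos:
  assumes q: "q absolutely_integrable_on {a..b}" and x: "x \<in> {a..b}"
  shows "growth (x - a) (-1) (\<lambda>\<rho>. fst (sl_sol q a b 1 \<eta> (\<rho>\<^sup>2)) x - cos (\<rho> * of_real (x - a)))" (is ?A)
    and "growth (x - a) 0 (\<lambda>\<rho>. snd (sl_sol q a b 1 \<eta> (\<rho>\<^sup>2)) x - (- \<rho> * sin (\<rho> * of_real (x - a))))" (is ?B)
proof -
  define Q where "Q = integral {a..b} (\<lambda>t. norm (q t))"
  have Q0: "0 \<le> Q" unfolding Q_def by (rule integral_nonneg) (auto intro: absolutely_integrable_norm'[OF q])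
  have ab: "a \<le> b" "a \<in> {a..b}" "0 \<le> x - a" using x by auto
  have "growth (x - a) (-1) (\<lambda>\<rho>. fst (sl_sol q a b 1 \<eta> (\<rho>\<^sup>2)) x - (1 * cos (\<rho> * of_real (x - a)) + \<eta> * (sin (\<rho> * of_real (x - a)) / \<rho>)))
     \<and> growth (x - a) 0 (\<lambda>\<rho>. snd (sl_sol q a b 1 \<eta> (\<rho>\<^sup>2)) x - (\<eta> * cos (\<rho> * of_real (x - a)) - 1 * (\<rho> * sin (\<rho> * of_real (x - a)))))"
  proof (intro conjI growthI[of "2 * Q" _ "2 * Q * (1 + norm \<eta>)"])
    fix \<rho> :: complex assume \<rho>: "2 * Q \<le> norm \<rho>" "1 \<le> norm \<rho>"
    have r0: "\<rho> \<noteq> 0" using \<rho> by auto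
    have M: "1 + norm \<eta> / norm \<rho> \<le> 1 + norm \<eta>" using \<rho> by (simp add: divide_le_eq mult_le_cancel_left1)
    note S = sl_sol[OF q ab(1), where lam="\<rho>\<^sup>2" and \<alpha>=1 and \<eta>=\<eta>]
    note asy = sl_system_asymptotics[OF q S(1) r0 \<rho>(1) Q_def ab(2) x refl, unfolded S(2,3) norm_one]
    have e: "exp (\<bar>Im \<rho>\<bar> * \<bar>x - a\<bar>) = exp ((x - a) * \<bar>Im \<rho>\<bar>)" using ab by (simp add: mult.commute)
    note asy(2)
    also have "2 * Q * (1 + norm \<eta> / norm \<rho>) / norm \<rho> * exp (\<bar>Im \<rho>\<bar> * \<bar>x - a\<bar>)
        \<le> 2 * Q * (1 + norm \<eta>) / norm \<rho> * exp (\<bar>Im \<rho>\<bar> * \<bar>x - a\<bar>)"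
      using Q0 by (intro mult_right_mono divide_right_mono mult_left_mono M) auto
    finally show "norm (fst (sl_sol q a b 1 \<eta> (\<rho>\<^sup>2)) x - (1 * cos (\<rho> * of_real (x - a)) + \<eta> * (sin (\<rho> * of_real (x - a)) / \<rho>)))
      \<le> 2 * Q * (1 + norm \<eta>) * (norm \<rho> powi -1 * exp ((x - a) * \<bar>Im \<rho>\<bar>))"
      unfolding e by (simp add: power_int_minus field_simps)
    note asy(3)
    also have "2 * Q * (1 + norm \<eta> / norm \<rho>) * exp (\<bar>Im \<rho>\<bar> * \<bar>x - a\<bar>)
        \<le> 2 * Q * (1 + norm \<eta>) * exp (\<bar>Im \<rho>\<bar> * \<bar>x - a\<bar>)"
      using Q0 by (intro mult_right_mono mult_left_mono M) auto
    finally show "norm (snd (sl_sol q a b 1 \<eta> (\<rho>\<^sup>2)) x - (\<eta> * cos (\<rho> * of_real (x - a)) - 1 * (\<rho> * sin (\<rho> * of_real (x - a)))))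
      \<le> 2 * Q * (1 + norm \<eta>) * (norm \<rho> powi 0 * exp ((x - a) * \<bar>Im \<rho>\<bar>))"
      unfolding e by simp
  qed
  then have 1: "growth (x - a) (-1) (\<lambda>\<rho>. fst (sl_sol q a b 1 \<eta> (\<rho>\<^sup>2)) x - (1 * cos (\<rho> * of_real (x - a)) + \<eta> * (sin (\<rho> * of_real (x - a)) / \<rho>)))"
    and 2: "growth (x - a) 0 (\<lambda>\<rho>. snd (sl_sol q a b 1 \<eta> (\<rho>\<^sup>2)) x - (\<eta> * cos (\<rho> * of_real (x - a)) - 1 * (\<rho> * sin (\<rho> * of_real (x - a)))))"
    by auto
  have "growth (x - a) (-1) (\<lambda>\<rho>. \<eta> * ((1 / \<rho>) * sin (\<rho> * of_real (x - a))))"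
    using growth_cmult[OF growth_mult[OF growth_inverse growth_sin[OF ab(3)]], of \<eta>] by simp
  from growth_add[OF 1 this] show ?A by (simp add: field_simps)
  from growth_add[OF 2 growth_cmult[OF growth_cos[OF ab(3)], of \<eta>]] show ?B by (simp add: algebra_simps)
qed

lemma growth_sl_sol_sin:
  assumes q: "q absolutely_integrable_on {a..b}" and x: "x \<in> {a..b}"
  shows "growth (x - a) (-2) (\<lambda>\<rho>. fst (sl_sol q a b 0 1 (\<rho>\<^sup>2)) x - sin (\<rho> * of_real (x - a)) / \<rho>)" (is ?A)
    and "growth (x - a) (-1) (\<lambda>\<rho>. snd (sl_sol q a b 0 1 (\<rho>\<^sup>2)) x - cos (\<rho> * of_real (x - a)))" (is ?B)
proof -
  define Q where "Q = integral {a..b} (\<lambda>t. norm (q t))"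
  have ab: "a \<le> b" "a \<in> {a..b}" "0 \<le> x - a" using x by auto
  have "?A \<and> ?B"
  proof (intro conjI growthI[of "2 * Q" _ "2 * Q"])
    fix \<rho> :: complex assume \<rho>: "2 * Q \<le> norm \<rho>" "1 \<le> norm \<rho>"
    have r0: "\<rho> \<noteq> 0" using \<rho> by auto
    note S = sl_sol[OF q ab(1), where lam="\<rho>\<^sup>2" and \<alpha>=0 and \<eta>=1]
    note asy = sl_system_asymptotics[OF q S(1) r0 \<rho>(1) Q_def ab(2) x refl, unfolded S(2,3)]
    have e: "exp (\<bar>Im \<rho>\<bar> * \<bar>x - a\<bar>) = exp ((x - a) * \<bar>Im \<rho>\<bar>)" using ab by (simp add: mult.commute)
    show "norm (fst (sl_sol q a b 0 1 (\<rho>\<^sup>2)) x - sin (\<rho> * of_real (x - a)) / \<rho>)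
      \<le> 2 * Q * (norm \<rho> powi -2 * exp ((x - a) * \<bar>Im \<rho>\<bar>))"
      using asy(2) unfolding e by (simp add: power_int_minus field_simps power2_eq_square)
    show "norm (snd (sl_sol q a b 0 1 (\<rho>\<^sup>2)) x - cos (\<rho> * of_real (x - a)))
      \<le> 2 * Q * (norm \<rho> powi -1 * exp ((x - a) * \<bar>Im \<rho>\<bar>))"
      using asy(3) unfolding e by (simp add: power_int_minus field_simps)
  qed
  then show ?A ?B by auto
qed

section \<open>Lower bounds for sine and cosine on the contours\<close>

lemma norm_cos_squared': "(norm (cos z))\<^sup>2 = (exp (2 * Im z) + exp (- (2 * Im z)) + 2 * cos (2 * Re z)) / 4" for z :: complex
  unfolding norm_cos_squared cos_double_cos
  by (simp add: power2_eq_square algebra_simps exp_minus[symmetric] mult_exp_exp add_divide_distrib diff_divide_distrib)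

lemma norm_sin_squared': "(norm (sin z))\<^sup>2 = (exp (2 * Im z) + exp (- (2 * Im z)) - 2 * cos (2 * Re z)) / 4" for z :: complex
  unfolding norm_sin_squared by (simp add: exp_minus)

lemma exp_abs_sum_bounds:
  "exp (2 * \<bar>v\<bar>) \<le> exp (2 * v) + exp (- (2 * v))" "2 \<le> exp (2 * v) + exp (- (2 * v))" for v :: real
proof -
  show "exp (2 * \<bar>v\<bar>) \<le> exp (2 * v) + exp (- (2 * v))" by (cases "0 \<le> v") auto
  have "0 \<le> (exp v - exp (- v))\<^sup>2" by simp
  also have "\<dots> = exp (2 * v) + exp (- (2 * v)) - 2"
    by (simp add: power2_eq_square algebra_simps mult_exp_exp)
  finally show "2 \<le> exp (2 * v) + exp (- (2 * v))" by simp
qed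

lemma exp_4_ge: "13 \<le> exp (2 * \<bar>v\<bar>)" if "2 \<le> \<bar>v\<bar>" for v :: real
proof -
  have "1 + 4 + 4\<^sup>2 / 2 \<le> exp (4::real)" by (rule exp_lower_Taylor_quadratic) simp
  also have "\<dots> \<le> exp (2 * \<bar>v\<bar>)" using that by simp
  finally show ?thesis by simp
qed

text \<open>The two alternatives are the vertical and the horizontal sides of a square. On the
  vertical ones the oscillating term in \<open>norm_cos_squared'\<close> adds to the exponentials;
  on the horizontal ones the exponentials are at least 13 and outweigh it.\<close>

lemma norm_cos_lower:
  fixes z :: complex
  assumes "cos (2 * Re z) = 1 \<or> 2 \<le> \<bar>Im z\<bar>"
  shows "1 \<le> norm (cos z)" "exp \<bar>Im z\<bar> / 4 \<le> norm (cos z)"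
proof -
  let ?X = "exp (2 * Im z) + exp (- (2 * Im z))"
  define c where "c = cos (2 * Re z)"
  have c: "- 1 \<le> c" by (simp add: c_def)
  have e: "exp (2 * \<bar>Im z\<bar>) = (exp \<bar>Im z\<bar>)\<^sup>2" by (simp add: exp_double)
  have "1\<^sup>2 \<le> (norm (cos z))\<^sup>2 \<and> (exp \<bar>Im z\<bar> / 4)\<^sup>2 \<le> (norm (cos z))\<^sup>2"
    using assms
  proof
    assume "cos (2 * Re z) = 1"
    then show ?thesis using exp_abs_sum_bounds[of "Im z"]
      unfolding norm_cos_squared' power_divide e[symmetric] c_def[symmetric] by simp
  next
    assume "2 \<le> \<bar>Im z\<bar>"
    then show ?thesis using exp_abs_sum_bounds[of "Im z"] exp_4_ge[of "Im z"] c
      unfolding norm_cos_squared' power_divide e[symmetric] c_def[symmetric] by simp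
  qed
  then show "1 \<le> norm (cos z)" "exp \<bar>Im z\<bar> / 4 \<le> norm (cos z)"
    using power2_le_imp_le[of 1 "norm (cos z)"] power2_le_imp_le[of "exp \<bar>Im z\<bar> / 4" "norm (cos z)"] by auto
qed

text \<open>The counterpart for a product \<open>sin * cos\<close>:
  \<open>cos (2 * Re z) = 0\<close> describes the vertical lines midway between the zeros of sine
  and cosine, where both factors are large.\<close>

lemma norm_sin_cos_lower:
  fixes z :: complex
  assumes "cos (2 * Re z) = 0 \<or> 2 \<le> \<bar>Im z\<bar>"
  shows "exp \<bar>Im z\<bar> / 4 \<le> norm (sin z)" "exp \<bar>Im z\<bar> / 4 \<le> norm (cos z)"
proof -
  let ?X = "exp (2 * Im z) + exp (- (2 * Im z))"
  define c where "c = cos (2 * Re z)"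
  have c: "- 1 \<le> c" "c \<le> 1" by (simp_all add: c_def)
  have e: "exp (2 * \<bar>Im z\<bar>) = (exp \<bar>Im z\<bar>)\<^sup>2" by (simp add: exp_double)
  have "(exp \<bar>Im z\<bar> / 4)\<^sup>2 \<le> (norm (sin z))\<^sup>2 \<and> (exp \<bar>Im z\<bar> / 4)\<^sup>2 \<le> (norm (cos z))\<^sup>2"
    using assms
  proof
    assume "cos (2 * Re z) = 0"
    then show ?thesis using exp_abs_sum_bounds[of "Im z"]
      unfolding norm_cos_squared' norm_sin_squared' power_divide e[symmetric] c_def[symmetric] by simp
  next
    assume "2 \<le> \<bar>Im z\<bar>"
    then show ?thesis using exp_abs_sum_bounds[of "Im z"] exp_4_ge[of "Im z"] c
      unfolding norm_cos_squared' norm_sin_squared' power_divide e[symmetric] c_def[symmetric] by simp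
  qed
  then show "exp \<bar>Im z\<bar> / 4 \<le> norm (sin z)" "exp \<bar>Im z\<bar> / 4 \<le> norm (cos z)"
    using power2_le_imp_le[of "exp \<bar>Im z\<bar> / 4" "norm (sin z)"] power2_le_imp_le[of "exp \<bar>Im z\<bar> / 4" "norm (cos z)"] by auto
qed

lemma growth_subst:
  assumes f: "growth \<sigma> k f" and eq: "\<And>\<rho>. \<rho> \<noteq> 0 \<Longrightarrow> f \<rho> = g \<rho>"
  shows "growth \<sigma> k g"
proof -
  obtain C R where C: "\<And>\<rho>. R \<le> norm \<rho> \<Longrightarrow> norm (f \<rho>) \<le> C * (norm \<rho> powi k * exp (\<sigma> * \<bar>Im \<rho>\<bar>))"
    by (rule growthE[OF f]) blast
  show ?thesis
  proof (rule growthI[of R _ C])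
    fix \<rho> :: complex assume \<rho>: "R \<le> norm \<rho>" "1 \<le> norm \<rho>"
    then have "\<rho> \<noteq> 0" by auto
    with C[OF \<rho>(1)] show "norm (g \<rho>) \<le> C * (norm \<rho> powi k * exp (\<sigma> * \<bar>Im \<rho>\<bar>))" by (simp add: eq)
  qed
qed

text \<open>The leading term is \<open>- (\<beta> + 1 / \<beta>) * \<rho> * sin (\<rho> * d) * cos
  (\<rho> * d)\<close>. Its coefficient is positive up to sign because \<open>\<beta> > 0\<close>,
  so the two products cannot cancel. All other terms, including the one with
  \<open>\<gamma>\<close>, are smaller by a factor \<open>\<rho>\<close>.\<close>

lemma char_robin_lower:
  fixes \<beta> d :: real and \<gamma> :: complex
  assumes d: "0 \<le> d" and \<beta>: "\<beta> > 0"
    and a: "growth d (-1) (\<lambda>\<rho>. a \<rho> - cos (\<rho> * of_real d))"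
    and a': "growth d 0 (\<lambda>\<rho>. a' \<rho> - (- \<rho> * sin (\<rho> * of_real d)))"
    and c: "growth d 0 (\<lambda>\<rho>. c \<rho> - (- \<rho> * sin (\<rho> * of_real d)))"
    and s: "growth d (-1) (\<lambda>\<rho>. s \<rho> - cos (\<rho> * of_real d))"
  obtains \<kappa> R where "\<kappa> > 0"
    "\<And>\<rho>. R \<le> norm \<rho> \<Longrightarrow> exp \<bar>Im (\<rho> * of_real d)\<bar> / 4 \<le> norm (sin (\<rho> * of_real d)) \<Longrightarrow>
      exp \<bar>Im (\<rho> * of_real d)\<bar> / 4 \<le> norm (cos (\<rho> * of_real d)) \<Longrightarrow>
      \<kappa> * norm \<rho> * exp (2 * d * \<bar>Im \<rho>\<bar>)
        \<le> norm (of_real \<beta> * a \<rho> * c \<rho> + (inverse (of_real \<beta>) * a' \<rho> + \<gamma> * a \<rho>) * s \<rho>)"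
proof -
  let ?c = "\<lambda>\<rho>. cos (\<rho> * of_real d)" and ?s = "\<lambda>\<rho>. sin (\<rho> * of_real d)"
  let ?D = "\<lambda>\<rho>. of_real \<beta> * a \<rho> * c \<rho> + (inverse (of_real \<beta>) * a' \<rho> + \<gamma> * a \<rho>) * s \<rho>"
  define b where "b = \<beta> + inverse \<beta>"
  have rs: "growth d 1 (\<lambda>\<rho>. - \<rho> * ?s \<rho>)"
    using growth_cmult[OF growth_mult[OF growth_id growth_sin[OF d]], of "-1"] by simp
  have ag: "growth d 0 a" by (rule growth_of_add_diff[OF growth_mono[OF a] growth_cos[OF d]]) simp
  have sg: "growth d 0 s" by (rule growth_of_add_diff[OF growth_mono[OF s] growth_cos[OF d]]) simp
  have a'g: "growth d 1 a'" by (rule growth_of_add_diff[OF growth_mono[OF a'] rs]) simp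
  have t1: "growth (d + d) 0 (\<lambda>\<rho>. a \<rho> * (c \<rho> - (- \<rho> * ?s \<rho>)))" using growth_mult[OF ag c] by simp
  have t2: "growth (d + d) 0 (\<lambda>\<rho>. (- \<rho> * ?s \<rho>) * (a \<rho> - ?c \<rho>))" using growth_mult[OF rs a] by simp
  have t3: "growth (d + d) 0 (\<lambda>\<rho>. a' \<rho> * (s \<rho> - ?c \<rho>))" using growth_mult[OF a'g s] by simp
  have t4: "growth (d + d) 0 (\<lambda>\<rho>. ?c \<rho> * (a' \<rho> - (- \<rho> * ?s \<rho>)))" using growth_mult[OF growth_cos[OF d] a'] by simp
  have t5: "growth (d + d) 0 (\<lambda>\<rho>. a \<rho> * s \<rho>)" using growth_mult[OF ag sg] by simp
  have main: "growth (d + d) 0 (\<lambda>\<rho>. of_real \<beta> * (a \<rho> * (c \<rho> - (- \<rho> * ?s \<rho>)) + (- \<rho> * ?s \<rho>) * (a \<rho> - ?c \<rho>))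
      + inverse (of_real \<beta>) * (a' \<rho> * (s \<rho> - ?c \<rho>) + ?c \<rho> * (a' \<rho> - (- \<rho> * ?s \<rho>))) + \<gamma> * (a \<rho> * s \<rho>))"
    by (intro growth_add growth_cmult t1 t2 t3 t4 t5)
  define err where "err \<rho> = ?D \<rho> - of_real b * (- \<rho> * ?s \<rho> * ?c \<rho>)" for \<rho>
  have "growth (d + d) 0 err"
    by (rule growth_subst[OF main]) (simp add: err_def b_def algebra_simps)
  then obtain C R where C: "0 \<le> C" and R: "1 \<le> R" and E: "\<And>\<rho>. R \<le> norm \<rho> \<Longrightarrow>
      norm (err \<rho>) \<le> C * (norm \<rho> powi 0 * exp ((d + d) * \<bar>Im \<rho>\<bar>))"
    by (rule growthE) blast
  have b0: "b > 0" using \<beta> by (simp add: b_def add_pos_pos)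
  \<comment> \<open>The two factors \<open>1/4\<close> bound the leading term below by
    \<open>b / 16\<close>; beyond \<open>32 * C / b\<close> the error takes at most half of
    that.\<close>
  show ?thesis
  proof (rule that[of "b / 32" "max R (32 * C / b)"])
    show "b / 32 > 0" using b0 by simp
    fix \<rho> :: complex assume \<rho>: "max R (32 * C / b) \<le> norm \<rho>"
      and l: "exp \<bar>Im (\<rho> * of_real d)\<bar> / 4 \<le> norm (?s \<rho>)" "exp \<bar>Im (\<rho> * of_real d)\<bar> / 4 \<le> norm (?c \<rho>)"
    then have \<rho>1: "R \<le> norm \<rho>" and \<rho>2: "C \<le> b / 32 * norm \<rho>" using b0 by (simp_all add: field_simps)
    let ?e = "exp (2 * d * \<bar>Im \<rho>\<bar>)"
    have e: "exp \<bar>Im (\<rho> * of_real d)\<bar> * exp \<bar>Im (\<rho> * of_real d)\<bar> = ?e"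
      using d by (simp add: mult_exp_exp abs_mult mult_ac)
    have 1: "b * norm \<rho> * (?e / 16) \<le> norm (of_real b * (- \<rho> * ?s \<rho> * ?c \<rho>))"
    proof -
      have "?e / 16 = exp \<bar>Im (\<rho> * of_real d)\<bar> / 4 * (exp \<bar>Im (\<rho> * of_real d)\<bar> / 4)"
        unfolding e[symmetric] by simp
      also have "\<dots> \<le> norm (?s \<rho>) * norm (?c \<rho>)" using l by (intro mult_mono) auto
      finally have "b * norm \<rho> * (?e / 16) \<le> b * norm \<rho> * (norm (?s \<rho>) * norm (?c \<rho>))"
        using b0 by (intro mult_left_mono) auto
      then show ?thesis using b0 by (simp add: norm_mult mult.assoc)
    qed
    have 2: "norm (of_real b * (- \<rho> * ?s \<rho> * ?c \<rho>)) \<le> norm (?D \<rho>) + norm (err \<rho>)"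
    proof -
      have "of_real b * (- \<rho> * ?s \<rho> * ?c \<rho>) = ?D \<rho> - err \<rho>" by (simp add: err_def)
      then show ?thesis using norm_triangle_ineq4[of "?D \<rho>" "err \<rho>"] by (simp only:)
    qed
    have 3: "norm (err \<rho>) \<le> C * ?e" using E[OF \<rho>1] by simp
    have 4: "C * ?e \<le> b / 32 * norm \<rho> * ?e" by (intro mult_right_mono \<rho>2) simp
    have 5: "b * norm \<rho> * (?e / 16) = 2 * (b / 32 * norm \<rho> * ?e)" by simp
    show "b / 32 * norm \<rho> * ?e \<le> norm (?D \<rho>)" using 1 2 3 4 unfolding 5 by linarith
  qed
qed

text \<open>The leading term \<open>\<beta> * cos\<^sup>2 - sin\<^sup>2 / \<beta>\<close> is not a
  multiple of a product of sine and cosine. Rewritten as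
  \<open>(\<beta> + 1 / \<beta>) * cos\<^sup>2 - 1 / \<beta>\<close>, it is at least
  \<open>\<beta> * \<bar>cos\<bar>\<^sup>2\<close> in modulus wherever
  \<open>\<bar>cos\<bar> \<ge> 1\<close>, which dictates contours through points with
  \<open>cos (2 * Re z) = 1\<close>.\<close>

lemma char_dirichlet_lower:
  fixes \<beta> d :: real and \<gamma> :: complex
  assumes d: "0 \<le> d" and \<beta>: "\<beta> > 0"
    and a: "growth d (-1) (\<lambda>\<rho>. a \<rho> - cos (\<rho> * of_real d))"
    and a': "growth d 0 (\<lambda>\<rho>. a' \<rho> - (- \<rho> * sin (\<rho> * of_real d)))"
    and c: "growth d (-1) (\<lambda>\<rho>. c \<rho> - cos (\<rho> * of_real d))"
    and s: "growth d (-2) (\<lambda>\<rho>. s \<rho> - sin (\<rho> * of_real d) / \<rho>)"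
  obtains \<kappa> R where "\<kappa> > 0"
    "\<And>\<rho>. R \<le> norm \<rho> \<Longrightarrow> 1 \<le> norm (cos (\<rho> * of_real d)) \<Longrightarrow>
      exp \<bar>Im (\<rho> * of_real d)\<bar> / 4 \<le> norm (cos (\<rho> * of_real d)) \<Longrightarrow>
      \<kappa> * exp (2 * d * \<bar>Im \<rho>\<bar>)
        \<le> norm (of_real \<beta> * a \<rho> * c \<rho> + (inverse (of_real \<beta>) * a' \<rho> + \<gamma> * a \<rho>) * s \<rho>)"
proof -
  let ?c = "\<lambda>\<rho>. cos (\<rho> * of_real d)" and ?s = "\<lambda>\<rho>. sin (\<rho> * of_real d)"
  let ?D = "\<lambda>\<rho>. of_real \<beta> * a \<rho> * c \<rho> + (inverse (of_real \<beta>) * a' \<rho> + \<gamma> * a \<rho>) * s \<rho>"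
  let ?M = "\<lambda>\<rho>. of_real (\<beta> + inverse \<beta>) * (?c \<rho>)\<^sup>2 - of_real (inverse \<beta>)"
  have rs: "growth d 1 (\<lambda>\<rho>. - \<rho> * ?s \<rho>)"
    using growth_cmult[OF growth_mult[OF growth_id growth_sin[OF d]], of "-1"] by simp
  have sr: "growth d (-1) (\<lambda>\<rho>. ?s \<rho> / \<rho>)"
    using growth_mult[OF growth_inverse growth_sin[OF d]] by simp
  have ag: "growth d 0 a" by (rule growth_of_add_diff[OF growth_mono[OF a] growth_cos[OF d]]) simp
  have sg: "growth d (-1) s" by (rule growth_of_add_diff[OF growth_mono[OF s] sr]) simp
  have a'g: "growth d 1 a'" by (rule growth_of_add_diff[OF growth_mono[OF a'] rs]) simp
  have t1: "growth (d + d) (-1) (\<lambda>\<rho>. a \<rho> * (c \<rho> - ?c \<rho>))" using growth_mult[OF ag c] by simp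
  have t2: "growth (d + d) (-1) (\<lambda>\<rho>. ?c \<rho> * (a \<rho> - ?c \<rho>))" using growth_mult[OF growth_cos[OF d] a] by simp
  have t3: "growth (d + d) (-1) (\<lambda>\<rho>. a' \<rho> * (s \<rho> - ?s \<rho> / \<rho>))" using growth_mult[OF a'g s] by simp
  have t4: "growth (d + d) (-1) (\<lambda>\<rho>. (?s \<rho> / \<rho>) * (a' \<rho> - (- \<rho> * ?s \<rho>)))" using growth_mult[OF sr a'] by simp
  have t5: "growth (d + d) (-1) (\<lambda>\<rho>. a \<rho> * s \<rho>)" using growth_mult[OF ag sg] by simp
  have main: "growth (d + d) (-1) (\<lambda>\<rho>. of_real \<beta> * (a \<rho> * (c \<rho> - ?c \<rho>) + ?c \<rho> * (a \<rho> - ?c \<rho>))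
      + inverse (of_real \<beta>) * (a' \<rho> * (s \<rho> - ?s \<rho> / \<rho>) + (?s \<rho> / \<rho>) * (a' \<rho> - (- \<rho> * ?s \<rho>))) + \<gamma> * (a \<rho> * s \<rho>))"
    by (intro growth_add growth_cmult t1 t2 t3 t4 t5)
  define err where "err \<rho> = ?D \<rho> - ?M \<rho>" for \<rho>
  have "growth (d + d) (-1) err"
  proof (rule growth_subst[OF main])
    fix \<rho> :: complex assume r: "\<rho> \<noteq> 0"
    have p: "(?s \<rho>)\<^sup>2 = 1 - (?c \<rho>)\<^sup>2" by (rule sin_squared_eq)
    have "of_real \<beta> * (a \<rho> * (c \<rho> - ?c \<rho>) + ?c \<rho> * (a \<rho> - ?c \<rho>))
      + inverse (of_real \<beta>) * (a' \<rho> * (s \<rho> - ?s \<rho> / \<rho>) + (?s \<rho> / \<rho>) * (a' \<rho> - (- \<rho> * ?s \<rho>))) + \<gamma> * (a \<rho> * s \<rho>)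
      = ?D \<rho> - (of_real \<beta> * (?c \<rho>)\<^sup>2 - inverse (of_real \<beta>) * (?s \<rho>)\<^sup>2)"
      using r by (simp add: power2_eq_square algebra_simps)
    also have "of_real \<beta> * (?c \<rho>)\<^sup>2 - inverse (of_real \<beta>) * (?s \<rho>)\<^sup>2 = ?M \<rho>"
      unfolding p by (simp add: algebra_simps)
    finally show "of_real \<beta> * (a \<rho> * (c \<rho> - ?c \<rho>) + ?c \<rho> * (a \<rho> - ?c \<rho>))
      + inverse (of_real \<beta>) * (a' \<rho> * (s \<rho> - ?s \<rho> / \<rho>) + (?s \<rho> / \<rho>) * (a' \<rho> - (- \<rho> * ?s \<rho>))) + \<gamma> * (a \<rho> * s \<rho>)
      = err \<rho>" unfolding err_def .
  qed
  then obtain C R where C: "0 \<le> C" and R: "1 \<le> R" and E: "\<And>\<rho>. R \<le> norm \<rho> \<Longrightarrow>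
      norm (err \<rho>) \<le> C * (norm \<rho> powi -1 * exp ((d + d) * \<bar>Im \<rho>\<bar>))"
    by (rule growthE) blast
  show ?thesis
  proof (rule that[of "\<beta> / 32" "max R (32 * C / \<beta>)"])
    show "\<beta> / 32 > 0" using \<beta> by simp
    fix \<rho> :: complex assume \<rho>: "max R (32 * C / \<beta>) \<le> norm \<rho>"
      and l: "1 \<le> norm (?c \<rho>)" "exp \<bar>Im (\<rho> * of_real d)\<bar> / 4 \<le> norm (?c \<rho>)"
    then have \<rho>1: "R \<le> norm \<rho>" and \<rho>2: "32 * C / \<beta> \<le> norm \<rho>" by simp_all
    have r0: "norm \<rho> > 0" using \<rho>1 R by auto
    have \<rho>3: "C / norm \<rho> \<le> \<beta> / 32" using \<rho>2 \<beta> r0 by (simp add: field_simps)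
    let ?e = "exp (2 * d * \<bar>Im \<rho>\<bar>)"
    have e: "exp \<bar>Im (\<rho> * of_real d)\<bar> * exp \<bar>Im (\<rho> * of_real d)\<bar> = ?e"
      using d by (simp add: mult_exp_exp abs_mult mult_ac)
    have 1: "\<beta> * (?e / 16) \<le> norm (?M \<rho>)"
    proof -
      have "?e / 16 = exp \<bar>Im (\<rho> * of_real d)\<bar> / 4 * (exp \<bar>Im (\<rho> * of_real d)\<bar> / 4)"
        unfolding e[symmetric] by simp
      also have "\<dots> \<le> norm (?c \<rho>) * norm (?c \<rho>)" using l by (intro mult_mono) auto
      finally have "\<beta> * (?e / 16) \<le> \<beta> * (norm (?c \<rho>))\<^sup>2"
        using \<beta> by (simp add: power2_eq_square)
      also have "1\<^sup>2 \<le> (norm (?c \<rho>))\<^sup>2" by (intro power_mono l(1)) simp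
      then have "inverse \<beta> * 1 \<le> inverse \<beta> * (norm (?c \<rho>))\<^sup>2" using \<beta> by (intro mult_left_mono) auto
      then have "\<beta> * (norm (?c \<rho>))\<^sup>2 \<le> (\<beta> + inverse \<beta>) * (norm (?c \<rho>))\<^sup>2 - inverse \<beta>"
        by (simp add: distrib_right)
      also have "\<dots> = norm (of_real (\<beta> + inverse \<beta>) * (?c \<rho>)\<^sup>2) - norm (of_real (inverse \<beta>) :: complex)"
        unfolding norm_mult norm_power norm_of_real using \<beta> by (simp add: add_pos_pos)
      also have "\<dots> \<le> norm (?M \<rho>)" by (rule norm_triangle_ineq2)
      finally show ?thesis .
    qed
    have 2: "norm (?M \<rho>) \<le> norm (?D \<rho>) + norm (err \<rho>)"
    proof -
      have "?M \<rho> = ?D \<rho> - err \<rho>" by (simp add: err_def)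
      then show ?thesis using norm_triangle_ineq4[of "?D \<rho>" "err \<rho>"] by (simp only:)
    qed
    have 3: "norm (err \<rho>) \<le> C / norm \<rho> * ?e"
      using E[OF \<rho>1] by (simp add: power_int_minus divide_inverse mult.assoc)
    have 4: "C / norm \<rho> * ?e \<le> \<beta> / 32 * ?e" by (intro mult_right_mono \<rho>3) simp
    have 5: "\<beta> * (?e / 16) = 2 * (\<beta> / 32 * ?e)" by simp
    show "\<beta> / 32 * ?e \<le> norm (?D \<rho>)" using 1 2 3 4 unfolding 5 by linarith
  qed
qed

section \<open>Laplace integrals of flat functions\<close>

lemma continuous_ae_zero_imp_zero:
  fixes w :: "real \<Rightarrow> complex"
  assumes w: "continuous_on S w" "open S" and N: "negligible N" "\<And>x. x \<in> S - N \<Longrightarrow> w x = 0" and x: "x \<in> S"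
  shows "w x = 0"
proof (rule ccontr)
  assume nz: "w x \<noteq> 0"
  have "open (w -` (- {0}) \<inter> S)"
    using w by (simp add: continuous_on_open_vimage open_Compl)
  moreover have "x \<in> w -` (- {0}) \<inter> S" using nz x by simp
  ultimately have "\<not> negligible (w -` (- {0}) \<inter> S)" by (intro open_not_negligible) auto
  moreover have "w -` (- {0}) \<inter> S \<subseteq> N" using N(2) by auto
  ultimately show False using N(1) negligible_subset by blast
qed

text \<open>All derivatives vanish to the right of \<open>c\<close>, hence at \<open>c\<close> by
  continuity. To the left, the top derivative is at most \<open>\<eta>\<close> near
  \<open>c\<close>, and each of \<open>m\<close> integrations towards \<open>c\<close> gains a
  factor \<open>c - x\<close>.\<close>

lemma Cm_on_vanishing_right:
  fixes D :: "nat \<Rightarrow> real \<Rightarrow> complex"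
  assumes e: "e > 0"
    and der: "\<And>j x. j < m \<Longrightarrow> x \<in> ball c e \<Longrightarrow> (D j has_vector_derivative D (Suc j) x) (at x)"
    and cont: "continuous_on (ball c e) (D m)"
    and N: "negligible N" "\<And>x. x \<in> {c<..<c+e} - N \<Longrightarrow> D 0 x = 0" and \<eta>: "\<eta> > 0"
  obtains \<delta> where "0 < \<delta>" "\<delta> < e" "\<And>x. c - \<delta> < x \<Longrightarrow> x \<le> c \<Longrightarrow> norm (D 0 x) \<le> \<eta> * (c - x) ^ m"
proof -
  have ball: "ball c e = {c-e<..<c+e}" by (rule ball_eq_greaterThanLessThan)
  have cj: "continuous_on (ball c e) (D j)" if "j \<le> m" for j
  proof (cases "j = m")
    case True then show ?thesis using cont by simp
  next
    case False
    then have "j < m" using that by simp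
    then have "isCont (D j) x" if "x \<in> ball c e" for x
      using der[OF _ that] has_vector_derivative_continuous by blast
    then show ?thesis by (simp add: continuous_at_imp_continuous_on)
  qed
  have sub: "{c<..<c+e} \<subseteq> ball c e" unfolding ball using e by auto
  have zero: "D j x = 0" if "j \<le> m" "x \<in> {c<..<c+e}" for j x
    using that
  proof (induction j arbitrary: x)
    case 0
    show ?case
      by (rule continuous_ae_zero_imp_zero[OF continuous_on_subset[OF cj sub] _ N]) (use 0 in auto)
  next
    case (Suc j)
    have "(D j has_vector_derivative D (Suc j) x) (at x)" using der[of j x] Suc.prems sub by auto
    moreover have "(D j has_vector_derivative 0) (at x)"
      by (rule has_vector_derivative_transform_within_open[OF has_vector_derivative_const[of 0], where S="{c<..<c+e}"])
        (use Suc in auto)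
    ultimately show ?case by (rule vector_derivative_unique_at)
  qed
  have cc: "D j c = 0" if "j \<le> m" for j
  proof -
    have "isCont (D j) c" using cj[OF that] e by (simp add: continuous_on_eq_continuous_at)
    then have "(D j \<longlongrightarrow> D j c) (at_right c)" by (simp add: isCont_def filterlim_at_split)
    moreover have "(D j \<longlongrightarrow> 0) (at_right c)"
    proof (rule tendsto_eventually)
      show "\<forall>\<^sub>F x in at_right c. D j x = 0"
        using zero[OF that] e eventually_at_right_field[of "\<lambda>x. D j x = 0" c] by (auto intro!: exI[of _ "c + e"])
    qed
    ultimately show ?thesis using tendsto_unique[OF trivial_limit_at_right_real] by blast
  qed
  have "isCont (D m) c" using cj[of m] e by (simp add: continuous_on_eq_continuous_at)
  then obtain \<delta>0 where d0: "\<delta>0 > 0" "\<And>x. dist x c < \<delta>0 \<Longrightarrow> dist (D m x) (D m c) < \<eta>"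
    unfolding continuous_at_eps_delta using \<eta> by blast
  define \<delta> where "\<delta> = min \<delta>0 (e / 2)"
  have d: "0 < \<delta>" "\<delta> < e" using d0 e by (auto simp: \<delta>_def)
  \<comment> \<open>\<open>i\<close> counts the integrations carried out so far, descending from
    \<open>D m\<close> to \<open>D 0\<close>.\<close>
  have bound: "norm (D (m - i) x) \<le> \<eta> * (c - x) ^ i" if "i \<le> m" "c - \<delta> < x" "x \<le> c" for i x
    using that
  proof (induction i arbitrary: x)
    case 0
    then show ?case using d0(2)[of x] cc[of m] by (simp add: \<delta>_def dist_real_def dist_norm less_imp_le)
  next
    case (Suc i)
    let ?j = "m - Suc i"
    have j: "?j < m" "Suc ?j = m - i" using Suc.prems by auto
    have hi: "(D (m - i) has_integral (D ?j c - D ?j x)) {x..c}"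
    proof (rule fundamental_theorem_of_calculus)
      show "(D ?j has_vector_derivative D (m - i) t) (at t within {x..c})" if "t \<in> {x..c}" for t
        using der[of ?j t] j that Suc.prems d unfolding ball by (auto intro: has_vector_derivative_at_within)
    qed (use Suc.prems in auto)
    have "norm (D ?j c - D ?j x) \<le> (\<eta> * (c - x) ^ i) * measure lborel {x..c}"
    proof (rule has_integral_bound_real[OF _ finite.emptyI hi])
      show "0 \<le> \<eta> * (c - x) ^ i" using \<eta> Suc.prems by simp
      fix t assume t: "t \<in> {x..c} - {}"
      have "norm (D (m - i) t) \<le> \<eta> * (c - t) ^ i" by (rule Suc.IH) (use t Suc.prems in auto)
      also have "\<dots> \<le> \<eta> * (c - x) ^ i" using t \<eta> by (intro mult_left_mono power_mono) auto
      finally show "norm (D (m - i) t) \<le> \<eta> * (c - x) ^ i" .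
    qed
    then show ?case using cc[of ?j] Suc.prems by (simp add: mult_ac)
  qed
  show ?thesis by (rule that[OF d]) (use bound[of m] in simp)
qed

text \<open>Flatness is stated with an arbitrary \<open>\<eta>\<close>, as little-o: when the number
  of missing eigenvalues is the largest one allowed, all powers of \<open>\<rho>\<close> may be used
  up, and the limit 0 must come from this \<open>\<eta>\<close>.\<close>

lemma Cm_near_flat:
  assumes m: "0 \<le> m" and q: "Cm_near m c q" and qt: "Cm_near m c qt"
    and right: "AE x in lebesgue. x \<in> {c..e} \<longrightarrow> q x = qt x" and ce: "c < e" and \<eta>: "\<eta> > 0"
  obtains \<delta> N where "0 < \<delta>" "negligible N"
    "\<And>x. c - \<delta> < x \<Longrightarrow> x \<le> c \<Longrightarrow> x \<notin> N \<Longrightarrow> norm (q x - qt x) \<le> \<eta> * (c - x) ^ nat m"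
proof -
  obtain e1 g where e1: "e1 > 0" and g: "Cm_on (nat m) (ball c e1) g" "AE x in lebesgue. x \<in> ball c e1 \<longrightarrow> q x = g x"
    using q m unfolding Cm_near_def by auto
  obtain e2 gt where e2: "e2 > 0" and gt: "Cm_on (nat m) (ball c e2) gt" "AE x in lebesgue. x \<in> ball c e2 \<longrightarrow> qt x = gt x"
    using qt m unfolding Cm_near_def by auto
  obtain D where D: "D 0 = g" "\<And>j x. j < nat m \<Longrightarrow> x \<in> ball c e1 \<Longrightarrow> (D j has_vector_derivative D (Suc j) x) (at x)"
      "continuous_on (ball c e1) (D (nat m))" using g(1) unfolding Cm_on_def by blast
  obtain Dt where Dt: "Dt 0 = gt" "\<And>j x. j < nat m \<Longrightarrow> x \<in> ball c e2 \<Longrightarrow> (Dt j has_vector_derivative Dt (Suc j) x) (at x)"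
      "continuous_on (ball c e2) (Dt (nat m))" using gt(1) unfolding Cm_on_def by blast
  define s where "s = min (min e1 e2) (e - c)"
  have s: "s > 0" "ball c s \<subseteq> ball c e1" "ball c s \<subseteq> ball c e2" using e1 e2 ce by (auto simp: s_def)
  have "AE x in lebesgue. (x \<in> ball c e1 \<longrightarrow> q x = g x) \<and> (x \<in> ball c e2 \<longrightarrow> qt x = gt x) \<and> (x \<in> {c..e} \<longrightarrow> q x = qt x)"
    using g(2) gt(2) right by eventually_elim auto
  then obtain N where N: "negligible N" "{x. \<not> ((x \<in> ball c e1 \<longrightarrow> q x = g x) \<and> (x \<in> ball c e2 \<longrightarrow> qt x = gt x) \<and> (x \<in> {c..e} \<longrightarrow> q x = qt x))} \<subseteq> N"
    unfolding eventually_ae_filter_negligible by blast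
  have N': "x \<in> ball c e1 \<Longrightarrow> q x = g x" "x \<in> ball c e2 \<Longrightarrow> qt x = gt x" "x \<in> {c..e} \<Longrightarrow> q x = qt x" if "x \<notin> N" for x
    using N(2) that by blast+
  let ?W = "\<lambda>j x. D j x - Dt j x"
  obtain \<delta> where d: "0 < \<delta>" "\<delta> < s" "\<And>x. c - \<delta> < x \<Longrightarrow> x \<le> c \<Longrightarrow> norm (?W 0 x) \<le> \<eta> * (c - x) ^ nat m"
  proof (rule Cm_on_vanishing_right[OF s(1), of "nat m" c ?W N \<eta>])
    show "(?W j has_vector_derivative ?W (Suc j) x) (at x)" if "j < nat m" "x \<in> ball c s" for j x
      using that s by (intro has_vector_derivative_diff D(2) Dt(2)) auto
    show "continuous_on (ball c s) (?W (nat m))"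
      by (intro continuous_on_diff continuous_on_subset[OF D(3)] continuous_on_subset[OF Dt(3)] s)
    show "?W 0 x = 0" if x: "x \<in> {c<..<c + s} - N" for x
    proof -
      have "x \<in> ball c s" using x by (auto simp: dist_real_def)
      then have "q x = g x" "qt x = gt x" using N' x s by blast+
      moreover have "q x = qt x" using N'(3)[of x] x by (auto simp: s_def)
      ultimately show ?thesis by (simp add: D(1) Dt(1))
    qed
  qed (use N \<eta> in auto)
  show ?thesis
  proof (rule that[OF d(1) N(1)])
    fix x assume x: "c - \<delta> < x" "x \<le> c" "x \<notin> N"
    have "x \<in> ball c s" using x d by (auto simp: dist_real_def)
    then have "q x = g x" "qt x = gt x" using N' x s by blast+
    then show "norm (q x - qt x) \<le> \<eta> * (c - x) ^ nat m" using d(3)[OF x(1,2)] by (simp add: D(1) Dt(1))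
  qed
qed

section \<open>Laplace integrals with weight concentrated at the right endpoint\<close>

lemma integral_le_off_negligible:
  fixes f g :: "real \<Rightarrow> real"
  assumes f: "f integrable_on S" and g: "g integrable_on S"
    and le: "\<And>x. x \<in> S - N \<Longrightarrow> f x \<le> g x" and N: "negligible N"
  shows "integral S f \<le> integral S g"
proof -
  let ?f = "\<lambda>x. if x \<in> N then g x else f x"
  have "integral S f = integral S ?f" by (rule integral_spike[OF N]) auto
  also have "\<dots> \<le> integral S g"
    by (rule integral_le[OF integrable_spike[OF f N] g]) (use le in auto)
  finally show ?thesis .
qed

lemma integral_exp_decay_le:
  fixes c u d :: real
  assumes ud: "u \<le> d"
  shows "integral {u..d} (\<lambda>x. c * exp (c * (x - d))) \<le> 1"
proof -
  have "((\<lambda>x. c * exp (c * (x - d))) has_integral (exp (c * (d - d)) - exp (c * (u - d)))) {u..d}"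
  proof (rule fundamental_theorem_of_calculus[OF ud])
    show "((\<lambda>x. exp (c * (x - d))) has_vector_derivative c * exp (c * (x - d))) (at x within {u..d})" for x
      unfolding has_real_derivative_iff_has_vector_derivative[symmetric]
      by (auto intro!: derivative_eq_intros)
  qed
  from integral_unique[OF this] show ?thesis by (simp del: integral_mult_right)
qed

text \<open>\<open>(n * s) ^ m / fact m\<close> is a single term of the series of
  \<open>exp (n * s)\<close>.\<close>

lemma power_mult_exp_le:
  fixes s n :: real assumes "0 \<le> s" "0 \<le> n"
  shows "n ^ m * s ^ m * exp (- (n * s)) \<le> fact m"
proof -
  have "(n * s) ^ m / fact m \<le> exp (n * s)"
  proof -
    have "(\<Sum>k\<in>{m}. (n * s) ^ k /\<^sub>R fact k) \<le> (\<Sum>k. (n * s) ^ k /\<^sub>R fact k)"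
      using assms by (intro sum_le_suminf summable_exp_generic) auto
    then show ?thesis by (simp add: exp_def divide_inverse mult.commute)
  qed
  then have "(n * s) ^ m \<le> fact m * exp (n * s)" by (simp add: field_simps)
  then have "(n * s) ^ m * exp (- (n * s)) \<le> fact m * exp (n * s) * exp (- (n * s))" by (intro mult_right_mono) auto
  then show ?thesis by (simp add: power_mult_distrib mult.assoc mult_exp_exp)
qed

text \<open>The weight \<open>exp (2 n (x - d))\<close> concentrates at \<open>d\<close> on the scale \<open>1/n\<close>, so vanishing of
  order \<open>m\<close> at \<open>d\<close> gains \<open>n\<^sup>-\<^sup>m\<^sup>-\<^sup>1\<close>.\<close>

lemma flat_laplace_limit:
  fixes r :: "real \<Rightarrow> real" and m :: nat
  assumes d: "0 < d" and r: "r integrable_on {0..d}" and pos: "\<And>x. x \<in> {0..d} \<Longrightarrow> 0 \<le> r x"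
    and flat: "\<And>\<eta>. \<eta> > 0 \<Longrightarrow> \<exists>\<delta>>0. \<exists>N. negligible N \<and> (\<forall>x. d - \<delta> < x \<longrightarrow> x \<le> d \<longrightarrow> x \<notin> N \<longrightarrow> r x \<le> \<eta> * (d - x) ^ m)"
  shows "(\<lambda>n. real n ^ Suc m * integral {0..d} (\<lambda>x. r x * exp (2 * real n * (x - d)))) \<longlonglongrightarrow> 0"
proof (rule LIMSEQ_I)
  fix e :: real assume e: "e > 0"
  \<comment> \<open>\<open>fact m\<close> is the loss in \<open>power_mult_exp_le\<close>; with this
    \<open>\<eta>\<close> the part near \<open>d\<close> contributes at most \<open>e / 4\<close>,
    and the part away from \<open>d\<close> is exponentially small.\<close>
  define \<eta> where "\<eta> = e / (4 * fact m)"
  have \<eta>: "\<eta> > 0" using e by (simp add: \<eta>_def)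
  obtain \<delta>0 N where d0: "\<delta>0 > 0" "negligible N" "\<And>x. d - \<delta>0 < x \<Longrightarrow> x \<le> d \<Longrightarrow> x \<notin> N \<Longrightarrow> r x \<le> \<eta> * (d - x) ^ m"
    using flat[OF \<eta>] by blast
  define \<delta> where "\<delta> = min (\<delta>0 / 2) (d / 2)"
  have dl: "0 < \<delta>" "\<delta> < \<delta>0" "\<delta> < d" using d0 d by (auto simp: \<delta>_def)
  define c where "c = d - \<delta>"
  have c: "0 < c" "c < d" using dl by (auto simp: c_def)
  have int: "(\<lambda>x. r x * exp (2 * real n * (x - d))) integrable_on {0..d}" for n
  proof -
    have "(\<lambda>x. exp (2 * real n * (x - d)) * r x) absolutely_integrable_on {0..d}"
    proof (rule absolutely_integrable_bounded_measurable_product_real)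
      have ec: "continuous_on {0..d} (\<lambda>x. exp (2 * real n * (x - d)))" by (intro continuous_intros)
      then show "(\<lambda>x. exp (2 * real n * (x - d))) \<in> borel_measurable (lebesgue_on {0..d})"
        by (intro continuous_imp_measurable_on_sets_lebesgue) auto
      show "bounded ((\<lambda>x. exp (2 * real n * (x - d))) ` {0..d})"
        using ec by (intro compact_imp_bounded compact_continuous_image) auto
      show "r absolutely_integrable_on {0..d}" by (rule nonnegative_absolutely_integrable_1[OF r pos])
    qed auto
    then show ?thesis using absolutely_integrable_on_def by (auto simp: mult.commute)
  qed
  define I where "I = integral {0..d} r"
  have I0: "0 \<le> I" unfolding I_def by (rule integral_nonneg[OF r pos])
  have split: "integral {0..d} (\<lambda>x. r x * exp (2 * real n * (x - d)))
     = integral {0..c} (\<lambda>x. r x * exp (2 * real n * (x - d))) + integral {c..d} (\<lambda>x. r x * exp (2 * real n * (x - d)))" for n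
    by (rule Henstock_Kurzweil_Integration.integral_combine[symmetric, OF _ _ int]) (use c in auto)
  have left: "integral {0..c} (\<lambda>x. r x * exp (2 * real n * (x - d))) \<le> exp (- (2 * real n * \<delta>)) * I" for n
  proof -
    have rc: "r integrable_on {0..c}" by (rule integrable_on_subinterval[OF r]) (use c in auto)
    have "integral {0..c} (\<lambda>x. r x * exp (2 * real n * (x - d))) \<le> integral {0..c} (\<lambda>x. r x * exp (- (2 * real n * \<delta>)))"
    proof (rule integral_le)
      show "(\<lambda>x. r x * exp (2 * real n * (x - d))) integrable_on {0..c}"
        by (rule integrable_on_subinterval[OF int]) (use c in auto)
      show "(\<lambda>x. r x * exp (- (2 * real n * \<delta>))) integrable_on {0..c}" by (rule integrable_on_mult_left[OF rc])
      fix x assume x: "x \<in> {0..c}"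
      have "real n * (x - d) \<le> real n * (- \<delta>)" using x by (intro mult_left_mono) (auto simp: c_def)
      then have "exp (2 * real n * (x - d)) \<le> exp (- (2 * real n * \<delta>))" by (simp add: mult.commute)
      then show "r x * exp (2 * real n * (x - d)) \<le> r x * exp (- (2 * real n * \<delta>))"
        using x c by (intro mult_left_mono pos) auto
    qed
    also have "\<dots> = exp (- (2 * real n * \<delta>)) * integral {0..c} r" by simp
    also have "\<dots> \<le> exp (- (2 * real n * \<delta>)) * I"
      unfolding I_def using c pos by (intro mult_left_mono integral_subset_le rc r) auto
    finally show ?thesis .
  qed
  have right: "real n ^ Suc m * integral {c..d} (\<lambda>x. r x * exp (2 * real n * (x - d))) \<le> e / 4" for n
  proof -
    have ri: "(\<lambda>x. r x * exp (2 * real n * (x - d))) integrable_on {c..d}"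
      by (rule integrable_on_subinterval[OF int]) (use c in auto)
    have ei: "(\<lambda>x. real n * exp (real n * (x - d))) integrable_on {c..d}"
      by (intro integrable_continuous_real continuous_intros)
    have "real n ^ Suc m * integral {c..d} (\<lambda>x. r x * exp (2 * real n * (x - d)))
       = integral {c..d} (\<lambda>x. real n ^ Suc m * (r x * exp (2 * real n * (x - d))))" by simp
    also have "\<dots> \<le> integral {c..d} (\<lambda>x. (\<eta> * fact m) * (real n * exp (real n * (x - d))))"
    proof (rule integral_le_off_negligible)
      show "(\<lambda>x. real n ^ Suc m * (r x * exp (2 * real n * (x - d)))) integrable_on {c..d}"
        by (rule integrable_on_mult_right[OF ri])
      show "(\<lambda>x. (\<eta> * fact m) * (real n * exp (real n * (x - d)))) integrable_on {c..d}"
        by (rule integrable_on_mult_right[OF ei])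
      fix x assume x: "x \<in> {c..d} - N"
      \<comment> \<open>One half of the exponent absorbs \<open>real n ^ m * (d - x) ^ m\<close>;
        the other half, together with the remaining factor \<open>real n\<close>, has integral at
        most 1.\<close>
      have ee: "exp (2 * real n * (x - d)) = exp (- (real n * (d - x))) * exp (real n * (x - d))"
        by (simp add: mult_exp_exp algebra_simps)
      have "r x \<le> \<eta> * (d - x) ^ m" by (rule d0(3)) (use x dl in \<open>auto simp: c_def\<close>)
      then have "real n ^ Suc m * (r x * exp (2 * real n * (x - d)))
          \<le> real n ^ Suc m * (\<eta> * (d - x) ^ m * exp (2 * real n * (x - d)))"
        by (intro mult_left_mono mult_right_mono) auto
      also have "\<dots> = \<eta> * (real n ^ m * (d - x) ^ m * exp (- (real n * (d - x)))) * (real n * exp (real n * (x - d)))"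
        unfolding ee by simp
      also have "\<dots> \<le> \<eta> * fact m * (real n * exp (real n * (x - d)))"
        using \<eta> x by (intro mult_right_mono mult_left_mono power_mult_exp_le) auto
      finally show "real n ^ Suc m * (r x * exp (2 * real n * (x - d))) \<le> (\<eta> * fact m) * (real n * exp (real n * (x - d)))" .
    qed (rule d0(2))
    also have "\<dots> = (\<eta> * fact m) * integral {c..d} (\<lambda>x. real n * exp (real n * (x - d)))" by (rule integral_mult_right)
    also have "\<dots> \<le> (\<eta> * fact m) * 1"
      using \<eta> c by (intro mult_left_mono integral_exp_decay_le) auto
    also have "\<dots> = e / 4" by (simp add: \<eta>_def)
    finally show ?thesis .
  qed
  have "(\<lambda>n. real n ^ Suc m * (exp (- (2 * real n * \<delta>)) * I)) \<longlonglongrightarrow> 0"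
    using dl by real_asymp
  from LIMSEQ_D[OF this, of "e/2"] e obtain n0 where n0: "\<And>n. n \<ge> n0 \<Longrightarrow> norm (real n ^ Suc m * (exp (- (2 * real n * \<delta>)) * I)) < e / 2"
    by auto
  show "\<exists>no. \<forall>n\<ge>no. norm (real n ^ Suc m * integral {0..d} (\<lambda>x. r x * exp (2 * real n * (x - d))) - 0) < e"
  proof (intro exI[of _ n0] allI impI)
    fix n assume n: "n \<ge> n0"
    let ?J = "integral {0..d} (\<lambda>x. r x * exp (2 * real n * (x - d)))"
    have J0: "0 \<le> ?J" by (rule integral_nonneg[OF int]) (use pos in auto)
    have "real n ^ Suc m * ?J \<le> real n ^ Suc m * (exp (- (2 * real n * \<delta>)) * I) + e / 4"
      unfolding split distrib_left by (intro add_mono right mult_left_mono left) auto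
    also have "\<dots> < e" using n0[OF n] e by (simp add: abs_if split: if_splits)
    finally show "norm (real n ^ Suc m * ?J - 0) < e" using J0 by (simp add: abs_mult)
  qed
qed

text \<open>The case \<open>m = - 1\<close>, with integrability as the only information: the
  integrand is dominated by \<open>r\<close> and tends to 0 except at \<open>x = d\<close>.\<close>

lemma laplace_limit:
  fixes r :: "real \<Rightarrow> real"
  assumes d: "0 < d" and r: "r integrable_on {0..d}" and pos: "\<And>x. x \<in> {0..d} \<Longrightarrow> 0 \<le> r x"
  shows "(\<lambda>n. integral {0..d} (\<lambda>x. r x * exp (2 * real n * (x - d)))) \<longlonglongrightarrow> 0"
proof -
  have ra: "r absolutely_integrable_on {0..d}" by (rule nonnegative_absolutely_integrable_1[OF r pos])
  have int: "(\<lambda>x. r x * exp (2 * real n * (x - d))) integrable_on {0..d}" for n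
  proof -
    have "(\<lambda>x. exp (2 * real n * (x - d)) * r x) absolutely_integrable_on {0..d}"
    proof (rule absolutely_integrable_bounded_measurable_product_real[OF _ _ _ ra])
      have ec: "continuous_on {0..d} (\<lambda>x. exp (2 * real n * (x - d)))" by (intro continuous_intros)
      then show "(\<lambda>x. exp (2 * real n * (x - d))) \<in> borel_measurable (lebesgue_on {0..d})"
        by (intro continuous_imp_measurable_on_sets_lebesgue) auto
      show "bounded ((\<lambda>x. exp (2 * real n * (x - d))) ` {0..d})"
        using ec by (intro compact_imp_bounded compact_continuous_image) auto
    qed auto
    then show ?thesis using absolutely_integrable_on_def by (auto simp: mult.commute)
  qed
  have "(\<lambda>n. integral {0..d} (\<lambda>x. r x * exp (2 * real n * (x - d)))) \<longlonglongrightarrow> integral {0..d} (\<lambda>x. if x = d then r d else 0)"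
  proof (rule dominated_convergence(2)[OF int r])
    fix n x assume x: "x \<in> {0..d}"
    have "real n * (x - d) \<le> 0" using x by (simp add: mult_nonneg_nonpos)
    then have "r x * exp (2 * real n * (x - d)) \<le> r x * 1" using pos[OF x] by (intro mult_left_mono) auto
    then show "norm (r x * exp (2 * real n * (x - d))) \<le> r x" using pos[OF x] by simp
  next
    fix x assume x: "x \<in> {0..d}"
    show "(\<lambda>n. r x * exp (2 * real n * (x - d))) \<longlonglongrightarrow> (if x = d then r d else 0)"
    proof (cases "x = d")
      case False
      then have "x - d < 0" using x by simp
      then have "(\<lambda>n. r x * exp (2 * real n * (x - d))) \<longlonglongrightarrow> 0" by real_asymp
      then show ?thesis using False by simp
    qed simp
  qed
  also have "integral {0..d} (\<lambda>x. if x = d then r d else 0) = integral {0..d} (\<lambda>x. 0)"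
    by (rule integral_spike[of "{d}"]) auto
  finally show ?thesis by simp
qed

section \<open>Vanishing of the Wronskian\<close>

text \<open>Twice the real part of \<open>\<rho> * pi / 2\<close> is \<open>pi * Re \<rho>\<close>,
  so even half-widths put the vertical sides where the cosine is 1. On the horizontal sides
  \<open>Im \<rho>\<close> is large.\<close>

lemma square_contour_cos:
  assumes "N \<ge> 1" "max \<bar>Re \<rho>\<bar> \<bar>Im \<rho>\<bar> = 2 * real N + 0"
  shows "cos (2 * Re (\<rho> * of_real (pi/2))) = 1 \<or> 2 \<le> \<bar>Im (\<rho> * of_real (pi/2))\<bar>"
proof (cases "\<bar>Re \<rho>\<bar> = 2 * real N")
  case True
  have "cos (2 * Re (\<rho> * of_real (pi/2))) = cos (\<bar>Re \<rho>\<bar> * pi)"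
    by (cases "0 \<le> Re \<rho>") (simp_all add: abs_if)
  also have "\<dots> = 1" unfolding True using cos_int_2pin[of "int N"] by (simp add: mult_ac)
  finally show ?thesis ..
next
  case False
  then have "\<bar>Im \<rho>\<bar> = 2 * real N" using assms(2) by (auto simp: max_def split: if_splits)
  moreover have "2 * 1 \<le> 2 * real N" using assms(1) by (intro mult_left_mono) auto
  ultimately have "2 \<le> \<bar>Im \<rho>\<bar>" by simp
  then have "2 * 1 \<le> \<bar>Im \<rho>\<bar> * (pi/2)" using pi_ge_two by (intro mult_mono) auto
  then show ?thesis by (simp add: abs_mult)
qed

text \<open>The offset \<open>1/2\<close> moves \<open>pi * Re \<rho>\<close> on the vertical sides
  a quarter period further, to a zero of the cosine.\<close>

lemma square_contour_sin_cos:
  assumes "N \<ge> 1" "max \<bar>Re \<rho>\<bar> \<bar>Im \<rho>\<bar> = 2 * real N + 1/2"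
  shows "cos (2 * Re (\<rho> * of_real (pi/2))) = 0 \<or> 2 \<le> \<bar>Im (\<rho> * of_real (pi/2))\<bar>"
proof (cases "\<bar>Re \<rho>\<bar> = 2 * real N + 1/2")
  case True
  have "cos (2 * Re (\<rho> * of_real (pi/2))) = cos (\<bar>Re \<rho>\<bar> * pi)"
    by (cases "0 \<le> Re \<rho>") (simp_all add: abs_if)
  also have "\<bar>Re \<rho>\<bar> * pi = 2 * real N * pi + pi / 2" unfolding True by (simp add: algebra_simps)
  also have "cos (2 * real N * pi + pi / 2) = 0"
    using sin_int_2pin[of "int N"] by (simp add: cos_add mult_ac)
  finally show ?thesis ..
next
  case False
  then have "\<bar>Im \<rho>\<bar> = 2 * real N + 1/2" using assms(2) by (auto simp: max_def split: if_splits)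
  moreover have "2 * 1 \<le> 2 * real N" using assms(1) by (intro mult_left_mono) auto
  ultimately have "2 \<le> \<bar>Im \<rho>\<bar>" by simp
  then have "2 * 1 \<le> \<bar>Im \<rho>\<bar> * (pi/2)" using pi_ge_two by (intro mult_mono) auto
  then show ?thesis by (simp add: abs_mult)
qed

lemma entire_zero_off_finite:
  assumes F: "F holomorphic_on UNIV" and L: "finite L" and z: "\<And>w. w \<notin> L \<Longrightarrow> F w = (0::complex)"
  shows "F z = 0"
proof -
  have "isCont F z" using holomorphic_on_imp_continuous_on[OF F] by (simp add: continuous_on_eq_continuous_at)
  then have "(F \<longlongrightarrow> F z) (at z)" by (simp add: isCont_def)
  moreover have "(F \<longlongrightarrow> 0) (at z)"
  proof (rule tendsto_eventually)
    have "open (- (L - {z}))" using L by (intro open_Compl finite_imp_closed) auto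
    then have "\<forall>\<^sub>F w in at z. w \<in> - (L - {z})" by (rule eventually_at_in_open') auto
    moreover have "\<forall>\<^sub>F w in at z. w \<noteq> z" by (simp add: eventually_at_filter)
    ultimately show "\<forall>\<^sub>F w in at z. F w = 0" by eventually_elim (auto intro: z)
  qed
  ultimately show ?thesis using tendsto_unique[OF trivial_limit_at] by blast
qed

lemma linear_prod_growth:
  fixes w :: complex
  assumes "finite L" "1 \<le> norm w"
  shows "norm (\<Prod>n\<in>L. w - l n) \<le> (\<Prod>n\<in>L. 1 + norm (l n)) * norm w ^ card L"
proof -
  have "norm (\<Prod>n\<in>L. w - l n) \<le> (\<Prod>n\<in>L. (1 + norm (l n)) * norm w)"
    unfolding prod_norm[symmetric]
  proof (intro prod_mono conjI)
    fix n assume "n \<in> L"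
    have "norm (w - l n) \<le> norm w + norm (l n)" by (rule norm_triangle_ineq4)
    also have "norm (l n) \<le> norm (l n) * norm w" using assms(2) by (simp add: mult_le_cancel_left1)
    finally show "norm (w - l n) \<le> (1 + norm (l n)) * norm w" by (simp add: distrib_right)
  qed simp
  also have "\<dots> = (\<Prod>n\<in>L. 1 + norm (l n)) * norm w ^ card L" by (simp add: prod.distrib)
  finally show ?thesis .
qed

text \<open>With \<open>u = inverse \<beta> * s\<close> and \<open>v = \<beta> * c + \<gamma> * s\<close> the characteristic functions are
  \<open>u * a' + v * a\<close> and \<open>u * b' + v * b\<close>; eliminating \<open>v\<close> and \<open>u\<close> expresses \<open>u * F\<close> and
  \<open>v * F\<close> through them, and \<open>u\<close>, \<open>v\<close> have no common zero.\<close>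

lemma common_order_divides_wronskian:
  fixes \<beta> :: real and \<gamma> :: complex
  assumes hol: "a holomorphic_on UNIV" "a' holomorphic_on UNIV" "b holomorphic_on UNIV" "b' holomorphic_on UNIV"
     "c holomorphic_on UNIV" "s holomorphic_on UNIV"
    and nz: "c z \<noteq> 0 \<or> s z \<noteq> 0" and \<beta>: "\<beta> > 0"
    and X: "pow_dvd z j (\<lambda>w. of_real \<beta> * a w * c w + (inverse (of_real \<beta>) * a' w + \<gamma> * a w) * s w)"
    and Xt: "pow_dvd z j (\<lambda>w. of_real \<beta> * b w * c w + (inverse (of_real \<beta>) * b' w + \<gamma> * b w) * s w)"
  shows "pow_dvd z j (\<lambda>w. a w * b' w - a' w * b w)"
proof -
  let ?X = "\<lambda>w. of_real \<beta> * a w * c w + (inverse (of_real \<beta>) * a' w + \<gamma> * a w) * s w"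
  let ?Xt = "\<lambda>w. of_real \<beta> * b w * c w + (inverse (of_real \<beta>) * b' w + \<gamma> * b w) * s w"
  have m: "pow_dvd z j (\<lambda>w. f w * g w)" if "f holomorphic_on UNIV" "pow_dvd z j g" for f g
    using pow_dvd_mult[OF pow_dvd_0[OF that(1)] that(2)] by simp
  show ?thesis
  proof (cases "s z = 0")
    case False
    have "pow_dvd z j (\<lambda>w. a w * ?Xt w - b w * ?X w)" by (intro pow_dvd_diff m hol X Xt)
    also have "(\<lambda>w. a w * ?Xt w - b w * ?X w) = (\<lambda>w. (inverse (of_real \<beta>) * s w) * (a w * b' w - a' w * b w))"
      by (simp add: algebra_simps)
    finally show ?thesis
      by (rule pow_dvd_cancel) (use False \<beta> in \<open>auto intro!: holomorphic_intros hol\<close>)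
  next
    case True
    have "pow_dvd z j (\<lambda>w. b' w * ?X w - a' w * ?Xt w)" by (intro pow_dvd_diff m hol X Xt)
    also have "(\<lambda>w. b' w * ?X w - a' w * ?Xt w) = (\<lambda>w. (of_real \<beta> * c w + \<gamma> * s w) * (a w * b' w - a' w * b w))"
      by (simp add: algebra_simps)
    finally show ?thesis
      by (rule pow_dvd_cancel) (use True nz \<beta> in \<open>auto intro!: holomorphic_intros hol\<close>)
  qed
qed

text \<open>The argument common to both problems: \<open>e\<close> is the power of
  \<open>\<rho>\<close> in the lower bound for the characteristic function, \<open>j\<close> the
  power of decay of \<open>F\<close> on the imaginary axis, and \<open>k\<close> the number of
  missing eigenvalues. \<open>kj\<close> says that the \<open>2 * k\<close> powers from the linear
  factors are paid for by these two. The predicate \<open>good\<close> marks the points where the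
  lower bound is available.\<close>

lemma wronskian_vanishes:
  fixes \<beta> d \<kappa> R \<theta> :: real and \<gamma> :: complex and e k j :: nat
  assumes hol: "a holomorphic_on UNIV" "a' holomorphic_on UNIV" "b holomorphic_on UNIV" "b' holomorphic_on UNIV"
     "c holomorphic_on UNIV" "s holomorphic_on UNIV"
    and nz: "\<And>z. c z \<noteq> 0 \<or> s z \<noteq> 0" and \<beta>: "\<beta> > 0"
    and X: "X = (\<lambda>w. of_real \<beta> * a w * c w + (inverse (of_real \<beta>) * a' w + \<gamma> * a w) * s w)"
    and Xt: "Xt = (\<lambda>w. of_real \<beta> * b w * c w + (inverse (of_real \<beta>) * b' w + \<gamma> * b w) * s w)"
    and F: "F = (\<lambda>w. a w * b' w - a' w * b w)"
    and l: "eigenvalue_seq X l" and lt: "eigenvalue_seq Xt lt" and co: "coincide_except k l lt"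
    and Xtnz: "Xt z1 \<noteq> 0"
    and \<kappa>: "\<kappa> > 0" and low: "\<And>\<rho>. R \<le> norm \<rho> \<Longrightarrow> good \<rho> \<Longrightarrow> \<kappa> * norm \<rho> ^ e * exp (2 * d * \<bar>Im \<rho>\<bar>) \<le> norm (X (\<rho>\<^sup>2))"
    and Fg: "growth (2 * d) 1 (\<lambda>\<rho>. F (\<rho>\<^sup>2))"
    and \<theta>: "0 \<le> \<theta>" "\<theta> < 2" and sq: "\<And>N \<rho>. N \<ge> 1 \<Longrightarrow> max \<bar>Re \<rho>\<bar> \<bar>Im \<rho>\<bar> = 2 * real N + \<theta> \<Longrightarrow> good \<rho>"
    and im: "\<And>n. n \<ge> n0 \<Longrightarrow> good (\<i> * of_nat n)"
    and lim: "(\<lambda>n. real n ^ j * exp (- (2 * d * real n)) * norm (F (- (of_nat n)\<^sup>2))) \<longlonglongrightarrow> 0"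
    and kj: "2 * k \<le> j + e"
  shows "F z = 0"
proof -
  have XH: "X holomorphic_on UNIV" "Xt holomorphic_on UNIV" "F holomorphic_on UNIV"
    unfolding X Xt F by (intro holomorphic_intros hol)+
  obtain C0 R0 where C0: "0 \<le> C0" "1 \<le> R0" "\<And>\<rho>. R0 \<le> norm \<rho> \<Longrightarrow> norm (F (\<rho>\<^sup>2)) \<le> C0 * (norm \<rho> powi 1 * exp (2 * d * \<bar>Im \<rho>\<bar>))"
    by (rule growthE[OF Fg]) blast
  define R1 where "R1 = max R R0"
  define n1 where "n1 = max n0 (nat \<lceil>R1\<rceil> + 1)"
  have n1: "n \<ge> n1 \<Longrightarrow> R1 \<le> real n \<and> good (\<i> * of_nat n)" for n
    using im[of n] unfolding n1_def by (intro conjI; linarith)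
  have R1: "1 \<le> R1" "R \<le> R1" "R0 \<le> R1" using C0 by (auto simp: R1_def)
  have Xnz: "X ((\<i> * of_nat n1)\<^sup>2) \<noteq> 0"
  proof -
    have "0 < \<kappa> * norm (\<i> * of_nat n1) ^ e * exp (2 * d * \<bar>Im (\<i> * of_nat n1)\<bar>)"
      using \<kappa> n1[of n1] R1 by (intro mult_pos_pos) (auto simp: norm_mult)
    also have "\<dots> \<le> norm (X ((\<i> * of_nat n1)\<^sup>2))"
      by (rule low) (use n1[of n1] R1 in \<open>auto simp: norm_mult\<close>)
    finally show ?thesis by auto
  qed
  obtain L G where L: "finite L" "card L = k" and G: "G holomorphic_on UNIV" "\<And>w. (\<Prod>n\<in>L. w - l n) * F w = X w * G w"
  proof (rule common_zeros_division[OF XH(1) Xnz XH(2) Xtnz l lt co XH(3)])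
    show "pow_dvd z j F" if "pow_dvd z j X" "pow_dvd z j Xt" for z j
      unfolding F by (rule common_order_divides_wronskian[OF hol nz \<beta>]) (use that in \<open>auto simp: X Xt\<close>)
  qed blast
  define CP where "CP = (\<Prod>n\<in>L. 1 + norm (l n))"
  have CP0: "0 \<le> CP" unfolding CP_def by (intro prod_nonneg) auto
  have key: "norm (G (\<rho>\<^sup>2)) \<le> CP / \<kappa> * (norm \<rho> ^ (2 * k) / norm \<rho> ^ e * exp (- (2 * d * \<bar>Im \<rho>\<bar>)) * norm (F (\<rho>\<^sup>2)))"
    if \<rho>: "R1 \<le> norm \<rho>" "good \<rho>" for \<rho>
  proof -
    have r1: "1 \<le> norm \<rho>" using \<rho> R1 by simp
    have p: "norm (\<Prod>n\<in>L. \<rho>\<^sup>2 - l n) \<le> CP * norm \<rho> ^ (2 * k)"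
      using linear_prod_growth[OF L(1), of "\<rho>\<^sup>2" l] r1 by (simp add: CP_def norm_power L(2) power_mult[symmetric] one_le_power)
    let ?b = "\<kappa> * norm \<rho> ^ e * exp (2 * d * \<bar>Im \<rho>\<bar>)"
    have "0 < norm \<rho>" using r1 by linarith
    then have b0: "0 < ?b" using \<kappa> by (intro mult_pos_pos zero_less_power) auto
    have "?b * norm (G (\<rho>\<^sup>2)) \<le> norm (X (\<rho>\<^sup>2)) * norm (G (\<rho>\<^sup>2))"
      using low[of \<rho>] \<rho> R1 by (intro mult_right_mono) auto
    also have "\<dots> = norm (\<Prod>n\<in>L. \<rho>\<^sup>2 - l n) * norm (F (\<rho>\<^sup>2))"
      using arg_cong[OF G(2)[of "\<rho>\<^sup>2"], of norm] by (simp add: norm_mult)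
    also have "\<dots> \<le> CP * norm \<rho> ^ (2 * k) * norm (F (\<rho>\<^sup>2))" by (intro mult_right_mono p) simp
    finally have "norm (G (\<rho>\<^sup>2)) \<le> CP * norm \<rho> ^ (2 * k) * norm (F (\<rho>\<^sup>2)) / ?b"
      using b0 by (simp add: pos_le_divide_eq mult.commute)
    then show ?thesis by (simp add: exp_minus field_simps)
  qed
  \<comment> \<open>On the squares a crude power suffices: \<open>2 * k\<close> from the linear
    factors and 1 from the growth of \<open>F\<close>. The precise balance matters only on the
    imaginary axis.\<close>
  have "G (z\<^sup>2) = 0" for z
  proof (rule entire_zero_of_square_bounds[where G="\<lambda>\<rho>. G (\<rho>\<^sup>2)" and \<theta>=\<theta> and ?N0.0="nat \<lceil>R1\<rceil> + 1" and p="2 * k + 1" and C="CP / \<kappa> * C0"])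
    show "(\<lambda>\<rho>. G (\<rho>\<^sup>2)) holomorphic_on UNIV"
    proof -
      have "(\<lambda>\<rho>::complex. \<rho>\<^sup>2) holomorphic_on UNIV" by (intro holomorphic_intros)
      from holomorphic_on_compose[OF this holomorphic_on_subset[OF G(1) subset_UNIV]] show ?thesis
        by (simp add: o_def)
    qed
    fix N \<rho> assume N: "nat \<lceil>R1\<rceil> + 1 \<le> N" "max \<bar>Re \<rho>\<bar> \<bar>Im \<rho>\<bar> = 2 * real N + \<theta>"
    have g: "good \<rho>" by (rule sq[OF _ N(2)]) (use N in simp)
    have "R1 \<le> real N" using N(1) by linarith
    also have "\<dots> \<le> max \<bar>Re \<rho>\<bar> \<bar>Im \<rho>\<bar>" unfolding N(2) using \<theta> by simp
    also have "\<dots> \<le> norm \<rho>" using abs_Re_le_cmod abs_Im_le_cmod by simp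
    finally have rn: "R1 \<le> norm \<rho>" .
    then have r1: "1 \<le> norm \<rho>" using R1 by simp
    have F1: "exp (- (2 * d * \<bar>Im \<rho>\<bar>)) * norm (F (\<rho>\<^sup>2)) \<le> C0 * norm \<rho>"
    proof -
      have "exp (- (2 * d * \<bar>Im \<rho>\<bar>)) * norm (F (\<rho>\<^sup>2)) \<le> exp (- (2 * d * \<bar>Im \<rho>\<bar>)) * (C0 * (norm \<rho> powi 1 * exp (2 * d * \<bar>Im \<rho>\<bar>)))"
        by (intro mult_left_mono C0) (use rn R1 in auto)
      also have "\<dots> = C0 * norm \<rho>" by (simp add: exp_minus)
      finally show ?thesis .
    qed
    have pe: "norm \<rho> ^ (2 * k) / norm \<rho> ^ e \<le> norm \<rho> ^ (2 * k)"
      using r1 by (simp add: divide_le_eq mult_le_cancel_left1)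
    have "norm (G (\<rho>\<^sup>2)) \<le> CP / \<kappa> * (norm \<rho> ^ (2 * k) / norm \<rho> ^ e * exp (- (2 * d * \<bar>Im \<rho>\<bar>)) * norm (F (\<rho>\<^sup>2)))"
      by (rule key[OF rn g])
    also have "\<dots> \<le> CP / \<kappa> * (norm \<rho> ^ (2 * k) * (C0 * norm \<rho>))"
      unfolding mult.assoc[of "norm \<rho> ^ (2 * k) / norm \<rho> ^ e"]
      using CP0 \<kappa> C0 by (intro mult_left_mono mult_mono F1 pe) auto
    also have "\<dots> = CP / \<kappa> * C0 * norm \<rho> ^ (2 * k + 1)" by simp
    finally show "norm (G (\<rho>\<^sup>2)) \<le> CP / \<kappa> * C0 * norm \<rho> ^ (2 * k + 1)" .
  next
    have "(\<lambda>n. CP / \<kappa> * (real n ^ j * exp (- (2 * d * real n)) * norm (F (- (of_nat n)\<^sup>2)))) \<longlonglongrightarrow> CP / \<kappa> * 0"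
      by (intro tendsto_mult tendsto_const lim)
    then have lim': "(\<lambda>n. CP / \<kappa> * (real n ^ j * exp (- (2 * d * real n)) * norm (F (- (of_nat n)\<^sup>2)))) \<longlonglongrightarrow> 0" by simp
    show "(\<lambda>n. G ((\<i> * of_nat n)\<^sup>2)) \<longlonglongrightarrow> 0"
    proof (rule Lim_null_comparison[OF _ lim'])
      show "\<forall>\<^sub>F n in sequentially. norm (G ((\<i> * of_nat n)\<^sup>2)) \<le> CP / \<kappa> * (real n ^ j * exp (- (2 * d * real n)) * norm (F (- (of_nat n)\<^sup>2)))"
      proof (rule eventually_sequentiallyI[of n1])
        fix n assume n: "n1 \<le> n"
        have rn: "R1 \<le> real n" "good (\<i> * of_nat n)" using n1[OF n] by auto
        have r1: "1 \<le> real n" using rn R1 by simp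
        have "real n ^ (2 * k) \<le> real n ^ (j + e)" by (rule power_increasing[OF kj r1])
        then have pe: "real n ^ (2 * k) / real n ^ e \<le> real n ^ j"
          using r1 by (simp add: divide_le_eq power_add)
        have "norm (G ((\<i> * of_nat n)\<^sup>2)) \<le> CP / \<kappa> * (real n ^ (2 * k) / real n ^ e * exp (- (2 * d * real n)) * norm (F (- (of_nat n)\<^sup>2)))"
          using key[of "\<i> * of_nat n"] rn by (simp add: norm_mult power_mult_distrib)
        also have "\<dots> \<le> CP / \<kappa> * (real n ^ j * exp (- (2 * d * real n)) * norm (F (- (of_nat n)\<^sup>2)))"
          using CP0 \<kappa> by (intro mult_left_mono mult_right_mono pe) auto
        finally show "norm (G ((\<i> * of_nat n)\<^sup>2)) \<le> \<dots>" .
      qed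
    qed
  qed (use \<theta> in auto)
  \<comment> \<open>Every complex number is a square.\<close>
  then have "G w = 0" for w by (metis power2_csqrt)
  then have PF: "(\<Prod>n\<in>L. w - l n) * F w = 0" for w using G(2) by simp
  show ?thesis
  proof (rule entire_zero_off_finite[OF XH(3), of "l ` L"])
    show "finite (l ` L)" using L by simp
    fix w assume "w \<notin> l ` L"
    then have "(\<Prod>n\<in>L. w - l n) \<noteq> 0" using L(1) by (auto simp: prod_zero_iff)
    then show "F w = 0" using PF[of w] by simp
  qed
qed

section \<open>Uniqueness on the half interval\<close>

text \<open>The combination vanishes at \<open>d\<close>, and its slope there is the Wronskian of
  \<open>y\<close> and \<open>t\<close>, which is 1 already at 0. It is thus the solution prescribed
  at the right end, expressed by entire functions of \<open>lam\<close>.\<close>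

lemma sl_sol_backward:
  assumes q: "q absolutely_integrable_on {0..d}" and d: "0 \<le> d"
    and y: "y = fst (sl_sol q 0 d 1 h lam)" "y' = snd (sl_sol q 0 d 1 h lam)"
    and t: "t = fst (sl_sol q 0 d 0 1 lam)" "t' = snd (sl_sol q 0 d 0 1 lam)"
  shows "sl_system q lam 0 d (\<lambda>x. y d * t x + (- t d) * y x) (\<lambda>x. y d * t' x + (- t d) * y' x)"
    and "y d * t' d - y' d * t d = 1"
proof -
  note Y = sl_sol[OF q d, where lam=lam and \<alpha>=1 and \<eta>=h, folded y]
  note T = sl_sol[OF q d, where lam=lam and \<alpha>=0 and \<eta>=1, folded t]
  show "sl_system q lam 0 d (\<lambda>x. y d * t x + (- t d) * y x) (\<lambda>x. y d * t' x + (- t d) * y' x)"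
    by (rule sl_system_lincomb[OF T(1) Y(1)])
  show "y d * t' d - y' d * t d = 1"
    using wronskian_const[OF Y(1) T(1), of d 0] d Y T by simp
qed

text \<open>Estimated separately, the two products only give the exponent \<open>d + x\<close>.
  Their difference solves the equation with data at \<open>d\<close>, so the asymptotics based at
  \<open>d\<close> give \<open>d - x\<close>.\<close>

lemma growth_backward:
  assumes q: "q absolutely_integrable_on {0..d}" and x: "x \<in> {0..d}"
  shows "growth (d - x) (-1) (\<lambda>\<rho>. fst (sl_sol q 0 d 1 h (\<rho>\<^sup>2)) d * fst (sl_sol q 0 d 0 1 (\<rho>\<^sup>2)) x
      - fst (sl_sol q 0 d 0 1 (\<rho>\<^sup>2)) d * fst (sl_sol q 0 d 1 h (\<rho>\<^sup>2)) x)"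
proof -
  define Q where "Q = integral {0..d} (\<lambda>t. norm (q t))"
  have d: "0 \<le> d" "d \<in> {0..d}" using x by auto
  show ?thesis
  proof (rule growthI[of "2 * Q" _ 2])
    fix \<rho> :: complex assume \<rho>: "2 * Q \<le> norm \<rho>" "1 \<le> norm \<rho>"
    have r0: "\<rho> \<noteq> 0" using \<rho> by auto
    define y where "y = fst (sl_sol q 0 d 1 h (\<rho>\<^sup>2))"
    define y' where "y' = snd (sl_sol q 0 d 1 h (\<rho>\<^sup>2))"
    define t where "t = fst (sl_sol q 0 d 0 1 (\<rho>\<^sup>2))"
    define t' where "t' = snd (sl_sol q 0 d 0 1 (\<rho>\<^sup>2))"
    note B = sl_sol_backward[OF q d(1) y_def y'_def t_def t'_def]
    have "norm (y d * t x + (- t d) * y x) \<le> 2 * (1 / norm \<rho>) * exp (\<bar>Im \<rho>\<bar> * \<bar>x - d\<bar>)"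
      by (rule sl_system_asymptotics(1)[OF q B(1) r0 \<rho>(1) Q_def d(2) x]) (use B(2) in \<open>simp add: mult.commute\<close>)
    also have "\<bar>x - d\<bar> = d - x" using x by auto
    finally show "norm (y d * t x - t d * y x) \<le> 2 * (norm \<rho> powi -1 * exp ((d - x) * \<bar>Im \<rho>\<bar>))"
      by (simp add: power_int_minus divide_inverse mult.commute[of "\<bar>Im \<rho>\<bar>"])
  qed
qed

lemma growth_forward:
  assumes q: "q absolutely_integrable_on {0..d}" and x: "x \<in> {0..d}"
  shows "growth x 0 (\<lambda>\<rho>. fst (sl_sol q 0 d 1 h (\<rho>\<^sup>2)) x)"
    and "growth x 1 (\<lambda>\<rho>. snd (sl_sol q 0 d 1 h (\<rho>\<^sup>2)) x)"
proof -
  have x0: "0 \<le> x" using x by simp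
  show "growth x 0 (\<lambda>\<rho>. fst (sl_sol q 0 d 1 h (\<rho>\<^sup>2)) x)"
    by (rule growth_of_add_diff[OF growth_mono[OF growth_sl_sol_cos(1)[OF q x, simplified]] growth_cos[OF x0]]) simp
  have rs: "growth x 1 (\<lambda>\<rho>. - \<rho> * sin (\<rho> * of_real x))"
    using growth_cmult[OF growth_mult[OF growth_id growth_sin[OF x0]], of "-1"] by simp
  have "growth x 0 (\<lambda>\<rho>. snd (sl_sol q 0 d 1 h (\<rho>\<^sup>2)) x - (- \<rho> * sin (\<rho> * of_real x)))"
    using growth_sl_sol_cos(2)[OF q x, of h] by simp
  then show "growth x 1 (\<lambda>\<rho>. snd (sl_sol q 0 d 1 h (\<rho>\<^sup>2)) x)"
    by (rule growth_of_add_diff[OF growth_mono rs]) simp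
qed

text \<open>The relative error of the leading cosine is of order \<open>1 / \<rho>\<close>, so for
  large \<open>\<rho>\<close> half of the bound \<open>1/4\<close> survives.\<close>

lemma sl_sol_lower:
  assumes q: "q absolutely_integrable_on {0..d}" and d: "0 \<le> d"
  obtains R where "1 \<le> R" "\<And>\<rho>. R \<le> norm \<rho> \<Longrightarrow> exp \<bar>Im (\<rho> * of_real d)\<bar> / 4 \<le> norm (cos (\<rho> * of_real d)) \<Longrightarrow>
    exp (d * \<bar>Im \<rho>\<bar>) / 8 \<le> norm (fst (sl_sol q 0 d 1 h (\<rho>\<^sup>2)) d)"
proof -
  have "growth d (-1) (\<lambda>\<rho>. fst (sl_sol q 0 d 1 h (\<rho>\<^sup>2)) d - cos (\<rho> * of_real d))"
    using growth_sl_sol_cos(1)[OF q, of d h] d by simp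
  then obtain C R where C: "0 \<le> C" "1 \<le> R" "\<And>\<rho>. R \<le> norm \<rho> \<Longrightarrow>
      norm (fst (sl_sol q 0 d 1 h (\<rho>\<^sup>2)) d - cos (\<rho> * of_real d)) \<le> C * (norm \<rho> powi -1 * exp (d * \<bar>Im \<rho>\<bar>))"
    by (rule growthE) blast
  show ?thesis
  proof (rule that[of "max R (8 * C)"])
    show "1 \<le> max R (8 * C)" using C by simp
    fix \<rho> :: complex assume \<rho>: "max R (8 * C) \<le> norm \<rho>"
      and l: "exp \<bar>Im (\<rho> * of_real d)\<bar> / 4 \<le> norm (cos (\<rho> * of_real d))"
    let ?e = "exp (d * \<bar>Im \<rho>\<bar>)"
    have r0: "0 < norm \<rho>" using \<rho> C by linarith
    have "exp \<bar>Im (\<rho> * of_real d)\<bar> = ?e" using d by (simp add: abs_mult mult.commute)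
    then have 1: "?e / 4 \<le> norm (cos (\<rho> * of_real d))" using l by simp
    have "norm (fst (sl_sol q 0 d 1 h (\<rho>\<^sup>2)) d - cos (\<rho> * of_real d)) \<le> C * (norm \<rho> powi -1 * ?e)"
      by (rule C(3)) (use \<rho> in simp)
    also have "\<dots> = C / norm \<rho> * ?e" by (simp add: power_int_minus divide_inverse)
    also have "\<dots> \<le> 1/8 * ?e" using \<rho> r0 by (intro mult_right_mono) (auto simp: field_simps)
    finally have 2: "norm (fst (sl_sol q 0 d 1 h (\<rho>\<^sup>2)) d - cos (\<rho> * of_real d)) \<le> ?e / 8" by simp
    have "norm (cos (\<rho> * of_real d)) \<le> norm (fst (sl_sol q 0 d 1 h (\<rho>\<^sup>2)) d) + norm (fst (sl_sol q 0 d 1 h (\<rho>\<^sup>2)) d - cos (\<rho> * of_real d))"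
      using norm_triangle_ineq4[of "fst (sl_sol q 0 d 1 h (\<rho>\<^sup>2)) d" "fst (sl_sol q 0 d 1 h (\<rho>\<^sup>2)) d - cos (\<rho> * of_real d)"] by simp
    with 1 2 show "?e / 8 \<le> norm (fst (sl_sol q 0 d 1 h (\<rho>\<^sup>2)) d)" by linarith
  qed
qed

text \<open>On the contours \<open>S\<close> is \<open>O(exp (\<bar>Im \<rho>\<bar> * (d - x)) / \<rho>)\<close> while \<open>y x / y d\<close> is
  \<open>O(exp (- \<bar>Im \<rho>\<bar> * (d - x)))\<close>, so the entire function
  \<open>S * Ct - St * C = S * yt x / yt d - St * y x / y d\<close> decays and vanishes.\<close>

lemma backward_products_eq:
  fixes q qt :: "real \<Rightarrow> complex" and lam :: complex
  defines "d \<equiv> pi / 2"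
  assumes q: "q absolutely_integrable_on {0..d}" and qt: "qt absolutely_integrable_on {0..d}"
    and F0: "\<And>lam. fst (sl_sol q 0 d 1 h lam) d * snd (sl_sol qt 0 d 1 ht lam) d
               = snd (sl_sol q 0 d 1 h lam) d * fst (sl_sol qt 0 d 1 ht lam) d"
    and x: "x \<in> {0..d}"
  defines "y \<equiv> \<lambda>lam. fst (sl_sol q 0 d 1 h lam)" and "yt \<equiv> \<lambda>lam. fst (sl_sol qt 0 d 1 ht lam)"
    and "t \<equiv> \<lambda>lam. fst (sl_sol q 0 d 0 1 lam)" and "tt \<equiv> \<lambda>lam. fst (sl_sol qt 0 d 0 1 lam)"
  shows "y lam d * ((y lam d * t lam x - t lam d * y lam x) * yt lam x)
       = yt lam d * ((yt lam d * tt lam x - tt lam d * yt lam x) * y lam x)"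
proof -
  define y' yt' t' tt' where y': "y' = (\<lambda>lam. snd (sl_sol q 0 d 1 h lam))" and yt': "yt' = (\<lambda>lam. snd (sl_sol qt 0 d 1 ht lam))"
    and t': "t' = (\<lambda>lam. snd (sl_sol q 0 d 0 1 lam))" and tt': "tt' = (\<lambda>lam. snd (sl_sol qt 0 d 0 1 lam))"
  have d0: "0 \<le> d" "d \<in> {0..d}" by (auto simp: d_def)
  define S where "S lam = y lam d * t lam x - t lam d * y lam x" for lam
  define St where "St lam = yt lam d * tt lam x - tt lam d * yt lam x" for lam
  \<comment> \<open>The brackets are the solutions with value 1 and slope 0 at \<open>d\<close>;
    they are entire in \<open>lam\<close>, hence so is \<open>A\<close>. This form of
    \<open>A\<close> avoids the poles of the quotients by \<open>y d\<close> and
    \<open>yt d\<close>.\<close>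
  define A where "A lam = S lam * (tt' lam d * yt lam x - yt' lam d * tt lam x)
        - St lam * (t' lam d * y lam x - y' lam d * t lam x)" for lam
  have W: "y lam d * t' lam d - y' lam d * t lam d = 1" for lam
    unfolding y_def y' t_def t' by (rule sl_sol_backward(2)[OF q d0(1) refl refl refl refl])
  have Wt: "yt lam d * tt' lam d - yt' lam d * tt lam d = 1" for lam
    unfolding yt_def yt' tt_def tt' by (rule sl_sol_backward(2)[OF qt d0(1) refl refl refl refl])
  have id: "y lam d * yt lam d * A lam = y lam d * (S lam * yt lam x) - yt lam d * (St lam * y lam x)" for lam
  proof -
    have F: "y lam d * yt' lam d = y' lam d * yt lam d" using F0[of lam] by (simp add: y_def yt_def y' yt')
    have c: "y lam d * (t' lam d * y lam x - y' lam d * t lam x) = y lam x - y' lam d * S lam"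
      using W[of lam] unfolding S_def by algebra
    have ct: "yt lam d * (tt' lam d * yt lam x - yt' lam d * tt lam x) = yt lam x - yt' lam d * St lam"
      using Wt[of lam] unfolding St_def by algebra
    have "y lam d * yt lam d * A lam = y lam d * S lam * (yt lam d * (tt' lam d * yt lam x - yt' lam d * tt lam x))
        - yt lam d * St lam * (y lam d * (t' lam d * y lam x - y' lam d * t lam x))"
      unfolding A_def by (simp add: algebra_simps)
    also have "\<dots> = y lam d * S lam * (yt lam x - yt' lam d * St lam) - yt lam d * St lam * (y lam x - y' lam d * S lam)"
      unfolding c ct ..
    \<comment> \<open>The terms with \<open>S * St\<close> have coefficient
      \<open>y' d * yt d - y d * yt' d\<close>, which is zero: this is where the agreement of the
      m-functions is used.\<close>
    also have "\<dots> = y lam d * (S lam * yt lam x) - yt lam d * (St lam * y lam x)" using F by algebra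
    finally show ?thesis .
  qed
  have hol: "(\<lambda>lam. y lam u) holomorphic_on UNIV" "(\<lambda>lam. y' lam u) holomorphic_on UNIV"
    "(\<lambda>lam. t lam u) holomorphic_on UNIV" "(\<lambda>lam. t' lam u) holomorphic_on UNIV"
    "(\<lambda>lam. yt lam u) holomorphic_on UNIV" "(\<lambda>lam. yt' lam u) holomorphic_on UNIV"
    "(\<lambda>lam. tt lam u) holomorphic_on UNIV" "(\<lambda>lam. tt' lam u) holomorphic_on UNIV" if "u \<in> {0..d}" for u
    unfolding y_def y' t_def t' yt_def yt' tt_def tt' by (rule sl_sol_holomorphic[OF q d0(1) that] sl_sol_holomorphic[OF qt d0(1) that])+
  have Ahol: "(\<lambda>\<rho>. A (\<rho>\<^sup>2)) holomorphic_on UNIV"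
  proof -
    have "A holomorphic_on UNIV" unfolding A_def[abs_def] S_def[abs_def] St_def[abs_def]
      by (intro holomorphic_intros hol x d0(2))
    moreover have "(\<lambda>\<rho>::complex. \<rho>\<^sup>2) holomorphic_on UNIV" by (intro holomorphic_intros)
    ultimately show ?thesis using holomorphic_on_compose[of "\<lambda>\<rho>. \<rho>\<^sup>2" UNIV A]
      by (auto simp: o_def intro: holomorphic_on_subset)
  qed
  have "growth (d + ((d - x) + x)) (0 + (-1 + 0)) (\<lambda>\<rho>. y (\<rho>\<^sup>2) d * (S (\<rho>\<^sup>2) * yt (\<rho>\<^sup>2) x))"
    unfolding y_def yt_def S_def t_def
    by (intro growth_mult growth_forward(1) growth_backward q qt x d0(2))
  moreover have "growth (d + ((d - x) + x)) (0 + (-1 + 0)) (\<lambda>\<rho>. yt (\<rho>\<^sup>2) d * (St (\<rho>\<^sup>2) * y (\<rho>\<^sup>2) x))"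
    unfolding y_def yt_def St_def tt_def
    by (intro growth_mult growth_forward(1) growth_backward q qt x d0(2))
  ultimately have "growth (d + ((d - x) + x)) (0 + (-1 + 0)) (\<lambda>\<rho>. y (\<rho>\<^sup>2) d * yt (\<rho>\<^sup>2) d * A (\<rho>\<^sup>2))"
    unfolding id by (rule growth_diff)
  then have "growth (2 * d) (-1) (\<lambda>\<rho>. y (\<rho>\<^sup>2) d * yt (\<rho>\<^sup>2) d * A (\<rho>\<^sup>2))" by simp
  then obtain C R where C: "0 \<le> C" "1 \<le> R" "\<And>\<rho>. R \<le> norm \<rho> \<Longrightarrow>
      norm (y (\<rho>\<^sup>2) d * yt (\<rho>\<^sup>2) d * A (\<rho>\<^sup>2)) \<le> C * (norm \<rho> powi -1 * exp (2 * d * \<bar>Im \<rho>\<bar>))"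
    by (rule growthE) blast
  obtain R1 where R1: "1 \<le> R1" "\<And>\<rho>. R1 \<le> norm \<rho> \<Longrightarrow> exp \<bar>Im (\<rho> * of_real d)\<bar> / 4 \<le> norm (cos (\<rho> * of_real d)) \<Longrightarrow>
    exp (d * \<bar>Im \<rho>\<bar>) / 8 \<le> norm (y (\<rho>\<^sup>2) d)"
    unfolding y_def by (rule sl_sol_lower[OF q d0(1)]) blast
  obtain R2 where R2: "1 \<le> R2" "\<And>\<rho>. R2 \<le> norm \<rho> \<Longrightarrow> exp \<bar>Im (\<rho> * of_real d)\<bar> / 4 \<le> norm (cos (\<rho> * of_real d)) \<Longrightarrow>
    exp (d * \<bar>Im \<rho>\<bar>) / 8 \<le> norm (yt (\<rho>\<^sup>2) d)"
    unfolding yt_def by (rule sl_sol_lower[OF qt d0(1)]) blast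
  define R0 where "R0 = max R (max R1 R2)"
  have key: "norm (A (\<rho>\<^sup>2)) \<le> 64 * C / norm \<rho>"
    if \<rho>: "R0 \<le> norm \<rho>" and g: "cos (2 * Re (\<rho> * of_real d)) = 1 \<or> 2 \<le> \<bar>Im (\<rho> * of_real d)\<bar>" for \<rho>
  proof -
    let ?e = "exp (d * \<bar>Im \<rho>\<bar>)"
    have ee: "exp (2 * d * \<bar>Im \<rho>\<bar>) = ?e * ?e" by (simp only: exp_add[symmetric]) (simp add: algebra_simps)
    have Rs: "R \<le> norm \<rho>" "R1 \<le> norm \<rho>" "R2 \<le> norm \<rho>" using \<rho> by (auto simp: R0_def)
    have "0 < norm \<rho>" using Rs C by linarith
    have l: "?e / 8 \<le> norm (y (\<rho>\<^sup>2) d)" "?e / 8 \<le> norm (yt (\<rho>\<^sup>2) d)"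
      using R1(2)[OF Rs(2)] R2(2)[OF Rs(3)] norm_cos_lower(2)[OF g] by auto
    have "?e / 8 * (?e / 8) * norm (A (\<rho>\<^sup>2)) \<le> norm (y (\<rho>\<^sup>2) d) * norm (yt (\<rho>\<^sup>2) d) * norm (A (\<rho>\<^sup>2))"
      using l by (intro mult_right_mono mult_mono) auto
    also have "\<dots> \<le> C * (norm \<rho> powi -1 * exp (2 * d * \<bar>Im \<rho>\<bar>))"
      using C(3)[OF Rs(1)] by (simp add: norm_mult)
    also have "C * (norm \<rho> powi -1 * exp (2 * d * \<bar>Im \<rho>\<bar>)) = ?e / 8 * (?e / 8) * (64 * C / norm \<rho>)"
    proof -
      have "norm \<rho> powi -1 = 1 / norm \<rho>" by (simp add: power_int_minus inverse_eq_divide)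
      then show ?thesis unfolding ee by simp
    qed
    finally have le: "?e / 8 * (?e / 8) * norm (A (\<rho>\<^sup>2)) \<le> ?e / 8 * (?e / 8) * (64 * C / norm \<rho>)" .
    show ?thesis by (rule mult_left_le_imp_le[OF le]) simp
  qed
  have "A (z\<^sup>2) = 0" for z
  proof (rule entire_zero_of_square_bounds[OF Ahol, of 0 "nat \<lceil>R0\<rceil> + 1" "64 * C" 0])
    fix N \<rho> assume N: "nat \<lceil>R0\<rceil> + 1 \<le> N" "max \<bar>Re \<rho>\<bar> \<bar>Im \<rho>\<bar> = 2 * real N + 0"
    have "R0 \<le> real N" using N(1) by linarith
    also have "\<dots> \<le> max \<bar>Re \<rho>\<bar> \<bar>Im \<rho>\<bar>" unfolding N(2) by simp
    also have "\<dots> \<le> norm \<rho>" using abs_Re_le_cmod abs_Im_le_cmod by simp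
    finally have rn: "R0 \<le> norm \<rho>" .
    have "norm (A (\<rho>\<^sup>2)) \<le> 64 * C / norm \<rho>"
      by (rule key[OF rn]) (unfold d_def, rule square_contour_cos[OF _ N(2)], use N in simp)
    also have "\<dots> \<le> 64 * C"
    proof -
      have "1 \<le> norm \<rho>" using rn C(2) by (auto simp: R0_def)
      then show ?thesis using C(1) by (simp add: divide_le_eq mult_le_cancel_left1)
    qed
    finally show "norm (A (\<rho>\<^sup>2)) \<le> 64 * C * norm \<rho> ^ 0" by simp
  next
    have lim: "(\<lambda>n. 64 * C / real n) \<longlonglongrightarrow> 0" by (rule lim_const_over_n)
    show "(\<lambda>n. A ((\<i> * of_nat n)\<^sup>2)) \<longlonglongrightarrow> 0"
    proof (rule Lim_null_comparison[OF _ lim])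
      show "\<forall>\<^sub>F n in sequentially. norm (A ((\<i> * of_nat n)\<^sup>2)) \<le> 64 * C / real n"
      proof (rule eventually_sequentiallyI[of "nat \<lceil>R0\<rceil>"])
        fix n assume "nat \<lceil>R0\<rceil> \<le> n"
        then have "R0 \<le> norm (\<i> * of_nat n)" by (simp add: norm_mult)
        from key[OF this] show "norm (A ((\<i> * of_nat n)\<^sup>2)) \<le> 64 * C / real n" by (simp add: norm_mult)
      qed
    qed
  qed simp_all
  then have "A lam = 0" by (metis power2_csqrt)
  with id[of lam] show ?thesis by (simp add: S_def St_def)
qed

lemma vector_derivative_unique_within_interval:
  fixes f :: "real \<Rightarrow> complex"
  assumes "a < b" "x \<in> {a..b}" "(f has_vector_derivative f') (at x within {a..b})"
    "(g has_vector_derivative g') (at x within {a..b})" "\<And>t. t \<in> {a..b} \<Longrightarrow> f t = g t"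
  shows "f' = g'"
proof -
  have "(f has_vector_derivative g') (at x within {a..b})"
    using assms by (intro has_vector_derivative_transform[OF _ _ assms(4)]) auto
  then show ?thesis
    using vector_derivative_within_cbox[of a b x f f'] vector_derivative_within_cbox[of a b x f g'] assms(1-3)
    by (simp add: box_real)
qed

text \<open>\<open>backward_products_eq\<close> says that \<open>S * yt / yt d\<close> and
  \<open>St * y / y d\<close> agree, that is, the diagonal Green functions coincide. Differentiating
  in \<open>x\<close> and eliminating \<open>S'\<close> and \<open>St'\<close> by the Wronskian
  relations leaves an identity between the squares of \<open>y\<close> and \<open>yt\<close>. One
  \<open>lam\<close> at which \<open>y\<close> has no zero then suffices, and subtracting the two
  equations gives \<open>(q - qt) * y = 0\<close>.\<close>

theorem half_interval_uniqueness:
  fixes q qt :: "real \<Rightarrow> complex"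
  defines "d \<equiv> pi / 2"
  assumes q: "q absolutely_integrable_on {0..d}" and qt: "qt absolutely_integrable_on {0..d}"
    and F0: "\<And>lam. fst (sl_sol q 0 d 1 h lam) d * snd (sl_sol qt 0 d 1 ht lam) d
               = snd (sl_sol q 0 d 1 h lam) d * fst (sl_sol qt 0 d 1 ht lam) d"
  obtains N where "h = ht" "negligible N" "\<And>x. x \<in> {0<..<d} - N \<Longrightarrow> q x = qt x"
proof -
  have d0: "0 < d" "0 \<le> d" "d \<in> {0..d}" "0 \<in> {0..d}" by (auto simp: d_def)
  define Q where "Q = integral {0..d} (\<lambda>t. norm (q t))"
  have Q0: "0 \<le> Q" unfolding Q_def by (rule integral_nonneg) (auto intro: absolutely_integrable_norm'[OF q])
  define K where "K = 2 * Q * (1 + norm h) + norm h"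
  \<comment> \<open>\<open>lam\<close> will be \<open>- n\<^sup>2\<close>. The bound
    \<open>2 * Q < n\<close> admits the asymptotics, and \<open>2 * K < n\<close> keeps
    \<open>y\<close> away from 0.\<close>
  obtain n :: nat where n: "2 * Q + 2 * K + 1 < real n" using reals_Archimedean2 by blast
  have K0: "0 \<le> K" using Q0 by (simp add: K_def)
  define \<rho> where "\<rho> = \<i> * of_nat n"
  define lam where "lam = \<rho>\<^sup>2"
  have \<rho>: "norm \<rho> = real n" "Im \<rho> = real n" "\<rho> \<noteq> 0" "2 * Q \<le> norm \<rho>" "1 \<le> real n"
    using n Q0 K0 by (auto simp: \<rho>_def norm_mult)
  define y where "y = fst (sl_sol q 0 d 1 h lam)"
  define y' where "y' = snd (sl_sol q 0 d 1 h lam)"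
  define yt where "yt = fst (sl_sol qt 0 d 1 ht lam)"
  define yt' where "yt' = snd (sl_sol qt 0 d 1 ht lam)"
  define t where "t = fst (sl_sol q 0 d 0 1 lam)"
  define t' where "t' = snd (sl_sol q 0 d 0 1 lam)"
  define tt where "tt = fst (sl_sol qt 0 d 0 1 lam)"
  define tt' where "tt' = snd (sl_sol qt 0 d 0 1 lam)"
  note Y = sl_sol[OF q d0(2), where lam=lam and \<alpha>=1 and \<eta>=h, folded y_def y'_def]
  note Yt = sl_sol[OF qt d0(2), where lam=lam and \<alpha>=1 and \<eta>=ht, folded yt_def yt'_def]
  define S where "S x = y d * t x + (- t d) * y x" for x
  define S' where "S' x = y d * t' x + (- t d) * y' x" for x
  define St where "St x = yt d * tt x + (- tt d) * yt x" for x
  define St' where "St' x = yt d * tt' x + (- tt d) * yt' x" for x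
  have SS: "sl_system q lam 0 d S S'" and W: "y d * t' d - y' d * t d = 1"
    using sl_sol_backward[OF q d0(2) y_def y'_def t_def t'_def] by (simp_all add: S_def[abs_def] S'_def[abs_def])
  have SSt: "sl_system qt lam 0 d St St'" and Wt: "yt d * tt' d - yt' d * tt d = 1"
    using sl_sol_backward[OF qt d0(2) yt_def yt'_def tt_def tt'_def] by (simp_all add: St_def[abs_def] St'_def[abs_def])
  have I: "y d * (S x * yt x) = yt d * (St x * y x)" if "x \<in> {0..d}" for x
    using backward_products_eq[of q qt h ht x lam, folded d_def, OF q qt F0 that]
    by (simp add: S_def St_def y_def yt_def t_def tt_def)
  note der = sl_system_has_derivative
  have I': "y d * (S' x * yt x + S x * yt' x) = yt d * (St' x * y x + St x * y' x)" if x: "x \<in> {0..d}" for x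
  proof (rule vector_derivative_unique_within_interval[OF d0(1) x _ _ I])
    show "((\<lambda>x. y d * (S x * yt x)) has_vector_derivative y d * (S' x * yt x + S x * yt' x)) (at x within {0..d})"
      using has_vector_derivative_mult_right[OF has_vector_derivative_mult[OF der[OF SS x] der[OF Yt(1) x]], of "y d"]
      by (simp add: add.commute)
    show "((\<lambda>x. yt d * (St x * y x)) has_vector_derivative yt d * (St' x * y x + St x * y' x)) (at x within {0..d})"
      using has_vector_derivative_mult_right[OF has_vector_derivative_mult[OF der[OF SSt x] der[OF Y(1) x]], of "yt d"]
      by (simp add: add.commute)
  qed
  have WS: "S' x * y x - S x * y' x = y d" if x: "x \<in> {0..d}" for x
  proof -
    have "S d = 0" "S' d = 1" using W by (simp_all add: S_def S'_def mult.commute)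
    then show ?thesis using wronskian_const[OF SS Y(1) x d0(3)] by (simp add: algebra_simps)
  qed
  have WSt: "St' x * yt x - St x * yt' x = yt d" if x: "x \<in> {0..d}" for x
  proof -
    have "St d = 0" "St' d = 1" using Wt by (simp_all add: St_def St'_def mult.commute)
    then show ?thesis using wronskian_const[OF SSt Yt(1) x d0(3)] by (simp add: algebra_simps)
  qed
  have sq: "(y d * yt x)\<^sup>2 = (yt d * y x)\<^sup>2" if x: "x \<in> {0..d}" for x
  proof -
    note e = I[OF x] I'[OF x] WS[OF x] WSt[OF x]
    have S'y: "S' x * y x = y d + S x * y' x" using e(3) by (simp add: algebra_simps)
    have St'y: "St' x * yt x = yt d + St x * yt' x" using e(4) by (simp add: algebra_simps)
    \<comment> \<open>The factor \<open>y x * yt x\<close> turns the derivatives into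
      \<open>S' x * y x\<close> and \<open>St' x * yt x\<close>, which the Wronskian relations can
      replace. The terms with \<open>y'\<close> and \<open>yt'\<close> then cancel by
      \<open>I\<close>.\<close>
    have "(y d * (S' x * yt x + S x * yt' x)) * (y x * yt x) = (yt d * (St' x * y x + St x * y' x)) * (y x * yt x)"
      using e(2) by simp
    then have "y d * yt x * yt x * (S' x * y x) + (y d * (S x * yt x)) * yt' x * y x
        = yt d * y x * y x * (St' x * yt x) + (yt d * (St x * y x)) * y' x * yt x" by (simp add: algebra_simps)
    then have "y d * yt x * yt x * y d + (y d * (S x * yt x)) * y' x * yt x + (y d * (S x * yt x)) * yt' x * y x
        = yt d * y x * y x * yt d + (yt d * (St x * y x)) * yt' x * y x + (yt d * (St x * y x)) * y' x * yt x"
      unfolding S'y St'y by (simp add: algebra_simps)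
    then show ?thesis unfolding e(1) by (simp add: power2_eq_square mult_ac)
  qed
  \<comment> \<open>The leading part \<open>cosh (n * x)\<close> is at least half of
    \<open>exp (n * x)\<close>, while the remainder and the term with \<open>h\<close> together are
    at most \<open>K / n\<close> times it.\<close>
  have nz: "y x \<noteq> 0" if x: "x \<in> {0..d}" for x
  proof
    assume y0: "y x = 0"
    let ?e = "exp (real n * x)"
    have x0: "0 \<le> x" using x by simp
    have "norm (y x - (y 0 * cos (\<rho> * of_real (x - 0)) + y' 0 * (sin (\<rho> * of_real (x - 0)) / \<rho>)))
      \<le> 2 * Q * (norm (y 0) + norm (y' 0) / norm \<rho>) / norm \<rho> * exp (\<bar>Im \<rho>\<bar> * \<bar>x - 0\<bar>)"
      by (rule sl_system_asymptotics(2)[OF q _ \<rho>(3,4) Q_def d0(4) x refl]) (use Y(1) in \<open>simp add: lam_def\<close>)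
    then have "norm (cos (\<rho> * of_real x) + h * (sin (\<rho> * of_real x) / \<rho>)) \<le> 2 * Q * (1 + norm h / real n) / real n * ?e"
      using x0 y0 Y \<rho> norm_minus_cancel[of "cos (\<rho> * of_real x) + h * (sin (\<rho> * of_real x) / \<rho>)"] by simp
    also have "\<dots> \<le> 2 * Q * (1 + norm h) / real n * ?e"
    proof -
      have "norm h / real n \<le> norm h" using \<rho>(5) by (simp add: divide_le_eq mult_le_cancel_left1)
      then show ?thesis using Q0 by (intro mult_right_mono divide_right_mono mult_left_mono) auto
    qed
    finally have 1: "norm (cos (\<rho> * of_real x) + h * (sin (\<rho> * of_real x) / \<rho>)) \<le> 2 * Q * (1 + norm h) / real n * ?e" .
    have "norm (sin (\<rho> * of_real x)) \<le> ?e" using norm_sin_le_exp[of "\<rho> * of_real x"] x0 \<rho> by (simp add: abs_mult)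
    then have 2: "norm (h * (sin (\<rho> * of_real x) / \<rho>)) \<le> norm h / real n * ?e"
      unfolding norm_mult norm_divide \<rho>(1) using \<rho>(5)
      by (simp add: field_simps mult_left_mono)
    have "cos (\<rho> * of_real x) = of_real ((?e + exp (- (real n * x))) / 2)"
      unfolding cos_exp_eq by (simp add: \<rho>_def mult.assoc[symmetric] exp_of_real[symmetric] add.commute)
    then have "norm (cos (\<rho> * of_real x)) = (?e + exp (- (real n * x))) / 2" by (simp only: norm_of_real) simp
    then have 3: "?e / 2 \<le> norm (cos (\<rho> * of_real x))" by simp
    have "norm (cos (\<rho> * of_real x)) \<le> norm (cos (\<rho> * of_real x) + h * (sin (\<rho> * of_real x) / \<rho>)) + norm (h * (sin (\<rho> * of_real x) / \<rho>))"
      using norm_triangle_ineq4[of "cos (\<rho> * of_real x) + h * (sin (\<rho> * of_real x) / \<rho>)" "h * (sin (\<rho> * of_real x) / \<rho>)"] by simp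
    with 1 2 3 have "?e / 2 \<le> 2 * Q * (1 + norm h) / real n * ?e + norm h / real n * ?e" by linarith
    also have "\<dots> = K / real n * ?e" by (simp add: K_def add_divide_distrib distrib_right)
    finally have "1 / 2 * ?e \<le> K / real n * ?e" by simp
    then have "1 / 2 \<le> K / real n" by (rule mult_right_le_imp_le) simp
    then show False using n Q0 K0 \<rho>(5) by (simp add: field_simps)
  qed
  have nzd: "y d \<noteq> 0" by (rule nz[OF d0(3)])
  \<comment> \<open>At \<open>x = 0\<close> both solutions are 1, so the identity of squares fixes
    the unknown constants at \<open>d\<close>.\<close>
  have yy: "(y d)\<^sup>2 = (yt d)\<^sup>2" using sq[OF d0(4)] Y Yt by simp
  then have "yt d \<noteq> 0" using nzd by auto
  with yy have sq': "(yt x / y x)\<^sup>2 = 1" if x: "x \<in> {0..d}" for x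
    using sq[OF x] nz[OF x] nzd by (simp add: power_mult_distrib power_divide)
  \<comment> \<open>The sign is settled by continuity: the quotient takes values in
    \<open>{1, -1}\<close> on a connected interval and is 1 at 0.\<close>
  let ?f = "\<lambda>x. yt x / y x"
  have fc: "continuous_on {0..d} ?f"
    by (intro continuous_on_divide sl_systemD(3)[OF Y(1)] sl_systemD(3)[OF Yt(1)]) (use nz in auto)
  have "?f ` {0..d} \<subseteq> {1, -1}"
  proof
    fix v assume "v \<in> ?f ` {0..d}"
    then have "v\<^sup>2 = 1" using sq' by blast
    then show "v \<in> {1, -1}" by (simp add: power2_eq_1_iff)
  qed
  then have "finite (?f ` {0..d})" by (rule finite_subset) simp
  then have "?f constant_on {0..d}" by (intro continuous_finite_range_constant[OF _ fc]) auto
  then have f1: "?f x = 1" if "x \<in> {0..d}" for x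
    using that d0(4) Y Yt unfolding constant_on_def by (metis div_by_1)
  have eq: "y x = yt x" if "x \<in> {0..d}" for x using f1[OF that] nz[OF that] by simp
  have eq': "y' x = yt' x" if x: "x \<in> {0..d}" for x
    by (rule vector_derivative_unique_within_interval[OF d0(1) x der[OF Y(1) x] der[OF Yt(1) x] eq])
  have hh: "h = ht" using eq'[OF d0(4)] Y Yt by simp
  have "indef_integral 0 d (\<lambda>x. y' x - yt' x) (\<lambda>x. (q x - lam) * y x - (qt x - lam) * yt x)"
    by (rule indef_integral_diff[OF sl_systemD(2)[OF Y(1)] sl_systemD(2)[OF Yt(1)]])
  then have "indef_integral 0 d (\<lambda>x. 0) (\<lambda>x. (q x - qt x) * y x)"
    by (rule indef_integral_cong[OF _ _ negligible_empty]) (use eq eq' in \<open>auto simp: algebra_simps\<close>)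
  then obtain N where N: "negligible N" "\<And>x. x \<in> {0<..<d} - N \<Longrightarrow> (q x - qt x) * y x = 0"
    by (rule indef_integral_zero_imp_ae) blast
  show ?thesis
  proof (rule that[OF hh N(1)])
    fix x assume x: "x \<in> {0<..<d} - N"
    then show "q x = qt x" using N(2)[OF x] nz[of x] by auto
  qed
qed

section \<open>Conclusion\<close>

lemma char_formulas:
  assumes q: "q absolutely_integrable_on {0..pi}" and d: "0 < d" "d < pi"
    and C: "sl_system q lam d pi C C'" "C d = 1" "C' d = 0"
    and S: "sl_system q lam d pi S S'" "S d = 0" "S' d = 1"
  shows "Delta q h H \<beta> \<gamma> d lam = of_real \<beta> * fst (sl_sol q 0 d 1 h lam) d * (C' pi + H * C pi)
      + (inverse (of_real \<beta>) * snd (sl_sol q 0 d 1 h lam) d + \<gamma> * fst (sl_sol q 0 d 1 h lam) d) * (S' pi + H * S pi)"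
    and "Delta_inf q h \<beta> \<gamma> d lam = of_real \<beta> * fst (sl_sol q 0 d 1 h lam) d * (- C pi)
      + (inverse (of_real \<beta>) * snd (sl_sol q 0 d 1 h lam) d + \<gamma> * fst (sl_sol q 0 d 1 h lam) d) * (- S pi)"
proof -
  have qL: "q absolutely_integrable_on {0..d}"
    by (rule absolutely_integrable_on_subinterval[OF q]) (use d in auto)
  note A = sl_sol[OF qL less_imp_le[OF d(1)], where lam=lam and \<alpha>=1 and \<eta>=h]
  note p = phi_at_pi[OF q d A C S, of \<beta> \<gamma>]
  show "Delta q h H \<beta> \<gamma> d lam = of_real \<beta> * fst (sl_sol q 0 d 1 h lam) d * (C' pi + H * C pi)
      + (inverse (of_real \<beta>) * snd (sl_sol q 0 d 1 h lam) d + \<gamma> * fst (sl_sol q 0 d 1 h lam) d) * (S' pi + H * S pi)"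
    unfolding Delta_def p by (simp add: algebra_simps)
  show "Delta_inf q h \<beta> \<gamma> d lam = of_real \<beta> * fst (sl_sol q 0 d 1 h lam) d * (- C pi)
      + (inverse (of_real \<beta>) * snd (sl_sol q 0 d 1 h lam) d + \<gamma> * fst (sl_sol q 0 d 1 h lam) d) * (- S pi)"
    unfolding Delta_inf_def p by (simp add: algebra_simps)
qed

lemma sl_sol_bound_imaginary:
  assumes q: "q absolutely_integrable_on {0..d}" and Q: "2 * integral {0..d} (\<lambda>t. norm (q t)) \<le> real n" "1 \<le> real n"
    and x: "x \<in> {0..d}"
  shows "norm (fst (sl_sol q 0 d 1 h (- (of_nat n)\<^sup>2)) x) \<le> 2 * (1 + norm h) * exp (real n * x)"
proof -
  define \<rho> where "\<rho> = \<i> * of_nat n"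
  have r: "\<rho>\<^sup>2 = - (of_nat n)\<^sup>2" "norm \<rho> = real n" "\<bar>Im \<rho>\<bar> = real n" "\<rho> \<noteq> 0"
    using Q by (auto simp: \<rho>_def power_mult_distrib norm_mult)
  have d: "0 \<le> d" "0 \<in> {0..d}" using x by auto
  note S = sl_sol[OF q d(1), where lam="\<rho>\<^sup>2" and \<alpha>=1 and \<eta>=h]
  have "norm (fst (sl_sol q 0 d 1 h (\<rho>\<^sup>2)) x) \<le> 2 * (1 + norm h / real n) * exp (\<bar>Im \<rho>\<bar> * \<bar>x - 0\<bar>)"
    by (rule sl_system_asymptotics(1)[OF q S(1) r(4) _ refl d(2) x]) (use Q r S in auto)
  also have "\<dots> = 2 * (1 + norm h / real n) * exp (real n * x)" using x r by simp
  also have "\<dots> \<le> 2 * (1 + norm h) * exp (real n * x)"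
  proof -
    have "norm h / real n \<le> norm h" using Q(2) by (simp add: divide_le_eq mult_le_cancel_left1)
    then show ?thesis by (intro mult_right_mono mult_left_mono add_left_mono) auto
  qed
  finally show ?thesis unfolding r(1) .
qed

text \<open>By Lagrange's identity \<open>F\<close> is its value \<open>ht - h\<close> at 0 plus the
  integral of \<open>(qt - q) * y * yt\<close>, and at \<open>lam = - n\<^sup>2\<close> the product
  of the solutions is at most \<open>K * exp (2 * n * x)\<close>. Dividing by
  \<open>exp (2 * d * n)\<close> removes the constant and leaves the Laplace integral with weight
  concentrated at \<open>d\<close>.\<close>

lemma wronskian_imaginary_limit:
  fixes q qt :: "real \<Rightarrow> complex"
  assumes q: "q absolutely_integrable_on {0..d}" and qt: "qt absolutely_integrable_on {0..d}" and d: "0 < d"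
    and lim: "(\<lambda>n. real n ^ j * integral {0..d} (\<lambda>x. norm (qt x - q x) * exp (2 * real n * (x - d)))) \<longlonglongrightarrow> 0"
    and F: "F = (\<lambda>lam. fst (sl_sol q 0 d 1 h lam) d * snd (sl_sol qt 0 d 1 ht lam) d
               - snd (sl_sol q 0 d 1 h lam) d * fst (sl_sol qt 0 d 1 ht lam) d)"
  shows "(\<lambda>n. real n ^ j * exp (- (2 * d * real n)) * norm (F (- (of_nat n)\<^sup>2))) \<longlonglongrightarrow> 0"
proof -
  define K where "K = 2 * (1 + norm h) * (2 * (1 + norm ht))"
  have K0: "0 \<le> K" by (simp add: K_def)
  let ?Q = "max 1 (max (2 * integral {0..d} (\<lambda>t. norm (q t))) (2 * integral {0..d} (\<lambda>t. norm (qt t))))"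
  let ?J = "\<lambda>n. integral {0..d} (\<lambda>x. norm (qt x - q x) * exp (2 * real n * (x - d)))"
  have d0: "0 \<le> d" "d \<in> {0..d}" "0 \<in> {0..d}" using d by auto
  have ra: "(\<lambda>x. qt x - q x) absolutely_integrable_on {0..d}" by (rule set_integral_diff(1)[OF qt q])
  have ri: "(\<lambda>x. norm (qt x - q x) * exp (2 * real n * (x - d))) integrable_on {0..d}" for n
  proof -
    have "(\<lambda>x. of_real (exp (2 * real n * (x - d))) * (qt x - q x)) absolutely_integrable_on {0..d}"
      by (rule absolutely_integrable_continuous_mult[OF _ ra]) (intro continuous_intros)
    from absolutely_integrable_norm'[OF this] show ?thesis by (simp add: norm_mult mult.commute)
  qed
  have bound: "norm (F (- (of_nat n)\<^sup>2)) \<le> norm (ht - h) + K * (exp (2 * d * real n) * ?J n)" if n: "?Q \<le> real n" for n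
  proof -
    let ?lam = "- (of_nat n)\<^sup>2 :: complex"
    note Y = sl_sol[OF q d0(1), where lam="?lam" and \<alpha>=1 and \<eta>=h]
    note Yt = sl_sol[OF qt d0(1), where lam="?lam" and \<alpha>=1 and \<eta>=ht]
    let ?y = "fst (sl_sol q 0 d 1 h ?lam)" and ?yt = "fst (sl_sol qt 0 d 1 ht ?lam)"
    note D = wronskian_deriv[OF Y(1) Yt(1)]
    define I where "I = integral {0..d} (\<lambda>x. (qt x - q x) * (?y x * ?yt x))"
    have FI: "F ?lam = (ht - h) + I"
      using indef_integral_eq[OF D d0(2)] Y(2,3) Yt(2,3) by (simp add: F I_def)
    have "norm (integral {0..d} (\<lambda>x. (qt x - q x) * (?y x * ?yt x)))
        \<le> integral {0..d} (\<lambda>x. (K * exp (2 * d * real n)) * (norm (qt x - q x) * exp (2 * real n * (x - d))))"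
    proof (rule integral_norm_bound_integral)
      show "(\<lambda>x. (qt x - q x) * (?y x * ?yt x)) integrable_on {0..d}" by (rule indef_integral_integrable[OF D])
      show "(\<lambda>x. (K * exp (2 * d * real n)) * (norm (qt x - q x) * exp (2 * real n * (x - d)))) integrable_on {0..d}"
        by (rule integrable_on_mult_right[OF ri])
      fix x assume x: "x \<in> {0..d}"
      have "norm (?y x) \<le> 2 * (1 + norm h) * exp (real n * x)"
        by (rule sl_sol_bound_imaginary[OF q _ _ x]) (use n in auto)
      moreover have "norm (?yt x) \<le> 2 * (1 + norm ht) * exp (real n * x)"
        by (rule sl_sol_bound_imaginary[OF qt _ _ x]) (use n in auto)
      ultimately have "norm (?y x * ?yt x) \<le> (2 * (1 + norm h) * exp (real n * x)) * (2 * (1 + norm ht) * exp (real n * x))"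
        unfolding norm_mult by (intro mult_mono) auto
      also have "\<dots> = K * (exp (real n * x) * exp (real n * x))" by (simp add: K_def)
      also have "\<dots> = K * (exp (2 * d * real n) * exp (2 * real n * (x - d)))"
        unfolding exp_add[symmetric] by (simp add: algebra_simps)
      finally have p: "norm (?y x * ?yt x) \<le> K * (exp (2 * d * real n) * exp (2 * real n * (x - d)))" .
      have "norm ((qt x - q x) * (?y x * ?yt x)) = norm (qt x - q x) * norm (?y x * ?yt x)" by (rule norm_mult)
      also have "\<dots> \<le> norm (qt x - q x) * (K * (exp (2 * d * real n) * exp (2 * real n * (x - d))))"
        by (rule mult_left_mono[OF p]) simp
      finally show "norm ((qt x - q x) * (?y x * ?yt x)) \<le> (K * exp (2 * d * real n)) * (norm (qt x - q x) * exp (2 * real n * (x - d)))"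
        by (simp only: mult_ac)
    qed
    then have "norm I \<le> K * (exp (2 * d * real n) * ?J n)"
      unfolding integral_mult_right I_def[symmetric] mult.assoc .
    then show ?thesis unfolding FI by (rule order_trans[OF norm_triangle_ineq add_left_mono])
  qed
  have "(\<lambda>n. real n ^ j * exp (- (2 * d * real n))) \<longlonglongrightarrow> 0" using d by real_asymp
  from tendsto_add[OF tendsto_mult_left[OF this, of "norm (ht - h)"] tendsto_mult_left[OF lim, of K]]
  have lim': "(\<lambda>n. norm (ht - h) * (real n ^ j * exp (- (2 * d * real n))) + K * (real n ^ j * ?J n)) \<longlonglongrightarrow> 0" by simp
  show ?thesis
  proof (rule Lim_null_comparison[OF _ lim'])
    show "\<forall>\<^sub>F n in sequentially. norm (real n ^ j * exp (- (2 * d * real n)) * norm (F (- (of_nat n)\<^sup>2)))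
        \<le> norm (ht - h) * (real n ^ j * exp (- (2 * d * real n))) + K * (real n ^ j * ?J n)"
    proof (rule eventually_sequentiallyI[of "nat \<lceil>?Q\<rceil>"])
      fix n assume "nat \<lceil>?Q\<rceil> \<le> n"
      then have n: "?Q \<le> real n" by linarith
      have "norm (real n ^ j * exp (- (2 * d * real n)) * norm (F (- (of_nat n)\<^sup>2)))
          = real n ^ j * exp (- (2 * d * real n)) * norm (F (- (of_nat n)\<^sup>2))" by (simp add: abs_mult)
      also have "\<dots> \<le> real n ^ j * exp (- (2 * d * real n)) * (norm (ht - h) + K * (exp (2 * d * real n) * ?J n))"
        by (rule mult_left_mono[OF bound[OF n]]) simp
      also have "\<dots> = norm (ht - h) * (real n ^ j * exp (- (2 * d * real n))) + K * (real n ^ j * ((exp (- (2 * d * real n)) * exp (2 * d * real n)) * ?J n))"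
        by (simp only: distrib_left mult_ac)
      also have "\<dots> = norm (ht - h) * (real n ^ j * exp (- (2 * d * real n))) + K * (real n ^ j * ?J n)"
        unfolding exp_add[symmetric] by simp
      finally show "norm (real n ^ j * exp (- (2 * d * real n)) * norm (F (- (of_nat n)\<^sup>2)))
        \<le> norm (ht - h) * (real n ^ j * exp (- (2 * d * real n))) + K * (real n ^ j * ?J n)" .
    qed
  qed
qed

lemma laplace_limit_of_smooth_difference:
  fixes q qt :: "real \<Rightarrow> complex" and m :: int
  assumes d: "0 < d" "d < e" and m: "- 1 \<le> m"
    and q: "q absolutely_integrable_on {0..d}" and qt: "qt absolutely_integrable_on {0..d}"
    and sm: "Cm_near m d q" "Cm_near m d qt" and right: "AE x in lebesgue. x \<in> {d..e} \<longrightarrow> q x = qt x"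
  shows "(\<lambda>n. real n ^ nat (m + 1) * integral {0..d} (\<lambda>x. norm (qt x - q x) * exp (2 * real n * (x - d)))) \<longlonglongrightarrow> 0"
proof -
  have "(\<lambda>x. qt x - q x) absolutely_integrable_on {0..d}" by (rule set_integral_diff(1)[OF qt q])
  then have r: "(\<lambda>x. norm (qt x - q x)) integrable_on {0..d}" by (rule absolutely_integrable_norm')
  show ?thesis
  proof (cases "m = - 1")
    case True
    then show ?thesis using laplace_limit[OF d(1) r] by simp
  next
    case False
    then have m0: "0 \<le> m" using m by simp
    have e: "nat (m + 1) = Suc (nat m)" using m0 by simp
    show ?thesis unfolding e
    proof (rule flat_laplace_limit[OF d(1) r])
      fix \<eta> :: real assume \<eta>: "\<eta> > 0"
      obtain \<delta> N where "0 < \<delta>" "negligible N" "\<And>x. d - \<delta> < x \<Longrightarrow> x \<le> d \<Longrightarrow> x \<notin> N \<Longrightarrow> norm (q x - qt x) \<le> \<eta> * (d - x) ^ nat m"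
        by (rule Cm_near_flat[OF m0 sm right d(2) \<eta>]) blast
      then show "\<exists>\<delta>>0. \<exists>N. negligible N \<and> (\<forall>x. d - \<delta> < x \<longrightarrow> x \<le> d \<longrightarrow> x \<notin> N \<longrightarrow> norm (qt x - q x) \<le> \<eta> * (d - x) ^ nat m)"
        by (intro exI[of _ \<delta>] conjI exI[of _ N]) (auto simp: norm_minus_commute)
    qed simp
  qed
qed

theorem corollary4:
  fixes q qt :: "real \<Rightarrow> complex" and h ht H \<gamma> :: complex and \<beta> d :: real and m :: int
  assumes d: "d = pi / 2"
    and beta: "\<beta> > 0"
    and q_L1: "q absolutely_integrable_on {0..pi}"
    and qt_L1: "qt absolutely_integrable_on {0..pi}"
    and m: "m \<ge> -1"
    and q_smooth: "Cm_near m (pi / 2) q"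
    and qt_smooth: "Cm_near m (pi / 2) qt"
    and right_half: "AE x in lebesgue. x \<in> {pi / 2..pi} \<longrightarrow> q x = qt x"
    and spectra:
      "(\<exists>l lt. eigenvalue_seq (Delta q h H \<beta> \<gamma> d) l \<and>
               eigenvalue_seq (Delta qt ht H \<beta> \<gamma> d) lt \<and>
               coincide_except (nat ((m + 2) div 2)) l lt)
       \<or>
       (\<exists>l lt. eigenvalue_seq (Delta_inf q h \<beta> \<gamma> d) l \<and>
               eigenvalue_seq (Delta_inf qt ht \<beta> \<gamma> d) lt \<and>
               coincide_except (nat ((m + 1) div 2)) l lt)"
  shows "h = ht \<and> (AE x in lebesgue. x \<in> {0..pi} \<longrightarrow> q x = qt x)"
proof -
  have d0: "0 < d" "d < pi" "0 \<le> d" "d \<le> pi" "d \<in> {0..d}" "pi \<in> {d..pi}" "pi - d = d"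
    using pi_gt_zero by (auto simp: d)
  have qL: "q absolutely_integrable_on {0..d}" and qtL: "qt absolutely_integrable_on {0..d}"
    and qR: "q absolutely_integrable_on {d..pi}"
    using d0 by (auto intro: absolutely_integrable_on_subinterval[OF q_L1] absolutely_integrable_on_subinterval[OF qt_L1])
  obtain NR where NR: "negligible NR" "{x. \<not> (x \<in> {pi / 2..pi} \<longrightarrow> q x = qt x)} \<subseteq> NR"
    using right_half unfolding eventually_ae_filter_negligible by blast
  have right: "q x = qt x" if "x \<in> {d..pi} - NR" for x using that NR(2) by (auto simp: d)
  define a where "a lam = fst (sl_sol q 0 d 1 h lam) d" for lam
  define a' where "a' lam = snd (sl_sol q 0 d 1 h lam) d" for lam
  define b where "b lam = fst (sl_sol qt 0 d 1 ht lam) d" for lam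
  define b' where "b' lam = snd (sl_sol qt 0 d 1 ht lam) d" for lam
  define C where "C lam = fst (sl_sol q d pi 1 0 lam)" for lam
  define C' where "C' lam = snd (sl_sol q d pi 1 0 lam)" for lam
  define S where "S lam = fst (sl_sol q d pi 0 1 lam)" for lam
  define S' where "S' lam = snd (sl_sol q d pi 0 1 lam)" for lam
  note CS = sl_sol[OF qR d0(4), where \<alpha>=1 and \<eta>=0, folded C_def C'_def]
  note SS = sl_sol[OF qR d0(4), where \<alpha>=0 and \<eta>=1, folded S_def S'_def]
  \<comment> \<open>On the right half the potentials agree almost everywhere, so the same pair of
    fundamental solutions serves both problems.\<close>
  have CSt: "sl_system qt lam d pi (C lam) (C' lam)" "sl_system qt lam d pi (S lam) (S' lam)" for lam
    by (rule sl_system_ae_cong[OF CS(1) NR(1) right] sl_system_ae_cong[OF SS(1) NR(1) right]; assumption)+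
  have hol: "a holomorphic_on UNIV" "a' holomorphic_on UNIV" "b holomorphic_on UNIV" "b' holomorphic_on UNIV"
    "(\<lambda>lam. C lam pi) holomorphic_on UNIV" "(\<lambda>lam. C' lam pi) holomorphic_on UNIV"
    "(\<lambda>lam. S lam pi) holomorphic_on UNIV" "(\<lambda>lam. S' lam pi) holomorphic_on UNIV"
    unfolding a_def[abs_def] a'_def[abs_def] b_def[abs_def] b'_def[abs_def] C_def C'_def S_def S'_def
    by (rule sl_sol_holomorphic[OF qL d0(3,5)] sl_sol_holomorphic[OF qtL d0(3,5)] sl_sol_holomorphic[OF qR d0(4,6)])+
  have W: "C lam pi * S' lam pi - C' lam pi * S lam pi = 1" for lam
    using wronskian_const[OF CS(1) SS(1), of pi d] d0 CS SS by simp
  have ag: "growth d (-1) (\<lambda>\<rho>. a (\<rho>\<^sup>2) - cos (\<rho> * of_real d))" "growth d 0 (\<lambda>\<rho>. a' (\<rho>\<^sup>2) - (- \<rho> * sin (\<rho> * of_real d)))"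
    using growth_sl_sol_cos[OF qL d0(5), of h] by (simp_all add: a_def a'_def)
  have bg: "growth d (-1) (\<lambda>\<rho>. b (\<rho>\<^sup>2) - cos (\<rho> * of_real d))" "growth d 0 (\<lambda>\<rho>. b' (\<rho>\<^sup>2) - (- \<rho> * sin (\<rho> * of_real d)))"
    using growth_sl_sol_cos[OF qtL d0(5), of ht] by (simp_all add: b_def b'_def)
  have Cg: "growth d (-1) (\<lambda>\<rho>. C (\<rho>\<^sup>2) pi - cos (\<rho> * of_real d))" "growth d 0 (\<lambda>\<rho>. C' (\<rho>\<^sup>2) pi - (- \<rho> * sin (\<rho> * of_real d)))"
    using growth_sl_sol_cos[OF qR d0(6), of 0] unfolding d0(7) by (simp_all add: C_def C'_def)
  have Sg: "growth d (-2) (\<lambda>\<rho>. S (\<rho>\<^sup>2) pi - sin (\<rho> * of_real d) / \<rho>)" "growth d (-1) (\<lambda>\<rho>. S' (\<rho>\<^sup>2) pi - cos (\<rho> * of_real d))"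
    using growth_sl_sol_sin[OF qR d0(6)] unfolding d0(7) by (simp_all add: S_def S'_def)
  define F where "F = (\<lambda>w. a w * b' w - a' w * b w)"
  have Fg: "growth (2 * d) 1 (\<lambda>\<rho>. F (\<rho>\<^sup>2))"
  proof -
    have "growth (d + d) (0 + 1) (\<lambda>\<rho>. a (\<rho>\<^sup>2) * b' (\<rho>\<^sup>2))"
      unfolding a_def b'_def by (rule growth_mult[OF growth_forward(1)[OF qL d0(5)] growth_forward(2)[OF qtL d0(5)]])
    moreover have "growth (d + d) (1 + 0) (\<lambda>\<rho>. a' (\<rho>\<^sup>2) * b (\<rho>\<^sup>2))"
      unfolding a'_def b_def by (rule growth_mult[OF growth_forward(2)[OF qL d0(5)] growth_forward(1)[OF qtL d0(5)]])
    ultimately show ?thesis unfolding F_def using growth_diff[of "d + d" 1] by simp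
  qed
  have Flim: "(\<lambda>n. real n ^ nat (m + 1) * exp (- (2 * d * real n)) * norm (F (- (of_nat n)\<^sup>2))) \<longlonglongrightarrow> 0"
  proof (rule wronskian_imaginary_limit[OF qL qtL d0(1)])
    show "(\<lambda>n. real n ^ nat (m + 1) * integral {0..d} (\<lambda>x. norm (qt x - q x) * exp (2 * real n * (x - d)))) \<longlonglongrightarrow> 0"
      by (rule laplace_limit_of_smooth_difference[OF d0(1,2) m qL qtL])
        (use q_smooth qt_smooth right_half in \<open>simp_all add: d\<close>)
    show "F = (\<lambda>lam. fst (sl_sol q 0 d 1 h lam) d * snd (sl_sol qt 0 d 1 ht lam) d
               - snd (sl_sol q 0 d 1 h lam) d * fst (sl_sol qt 0 d 1 ht lam) d)"
      by (simp add: F_def a_def a'_def b_def b'_def)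
  qed
  have F0: "F lam = 0" for lam
    using spectra
  proof
    assume "\<exists>l lt. eigenvalue_seq (Delta q h H \<beta> \<gamma> d) l \<and> eigenvalue_seq (Delta qt ht H \<beta> \<gamma> d) lt \<and>
               coincide_except (nat ((m + 2) div 2)) l lt"
    then obtain l lt where l: "eigenvalue_seq (Delta q h H \<beta> \<gamma> d) l" "eigenvalue_seq (Delta qt ht H \<beta> \<gamma> d) lt"
      "coincide_except (nat ((m + 2) div 2)) l lt" by blast
    \<comment> \<open>\<open>c\<close> and \<open>s\<close> are the boundary form at
      \<open>pi\<close> applied to the common fundamental solutions; the two problems differ only
      through the values of their left solutions at \<open>d\<close>.\<close>
    define c where "c w = C' w pi + H * C w pi" for w
    define s where "s w = S' w pi + H * S w pi" for w
    have X: "Delta q h H \<beta> \<gamma> d = (\<lambda>w. of_real \<beta> * a w * c w + (inverse (of_real \<beta>) * a' w + \<gamma> * a w) * s w)"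
      unfolding a_def a'_def c_def s_def
      by (rule ext) (rule char_formulas(1)[OF q_L1 d0(1,2) CS SS])
    have Xt: "Delta qt ht H \<beta> \<gamma> d = (\<lambda>w. of_real \<beta> * b w * c w + (inverse (of_real \<beta>) * b' w + \<gamma> * b w) * s w)"
      unfolding b_def b'_def c_def s_def
      by (rule ext) (rule char_formulas(1)[OF qt_L1 d0(1,2) CSt(1) CS(2,3) CSt(2) SS(2,3)])
    have cg: "growth d 0 (\<lambda>\<rho>. c (\<rho>\<^sup>2) - (- \<rho> * sin (\<rho> * of_real d)))"
    proof -
      have "growth d 0 (\<lambda>\<rho>. H * C (\<rho>\<^sup>2) pi)"
        by (rule growth_cmult[OF growth_of_add_diff[OF growth_mono[OF Cg(1)] growth_cos[OF d0(3)]]]) simp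
      from growth_add[OF Cg(2) this] show ?thesis by (simp add: c_def algebra_simps)
    qed
    have sg: "growth d (-1) (\<lambda>\<rho>. s (\<rho>\<^sup>2) - cos (\<rho> * of_real d))"
    proof -
      have "growth d (-1) (\<lambda>\<rho>. sin (\<rho> * of_real d) / \<rho>)"
        using growth_mult[OF growth_inverse growth_sin[OF d0(3)]] by simp
      then have "growth d (-1) (\<lambda>\<rho>. H * S (\<rho>\<^sup>2) pi)"
        by (intro growth_cmult growth_of_add_diff[OF growth_mono[OF Sg(1)]]) simp_all
      from growth_add[OF Sg(2) this] show ?thesis by (simp add: s_def algebra_simps)
    qed
    define good where "good \<rho> \<longleftrightarrow> cos (2 * Re (\<rho> * of_real d)) = 0 \<or> 2 \<le> \<bar>Im (\<rho> * of_real d)\<bar>" for \<rho> :: complex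
    obtain \<kappa> R where low: "\<kappa> > 0" "\<And>\<rho>. R \<le> norm \<rho> \<Longrightarrow> exp \<bar>Im (\<rho> * of_real d)\<bar> / 4 \<le> norm (sin (\<rho> * of_real d)) \<Longrightarrow>
      exp \<bar>Im (\<rho> * of_real d)\<bar> / 4 \<le> norm (cos (\<rho> * of_real d)) \<Longrightarrow>
      \<kappa> * norm \<rho> * exp (2 * d * \<bar>Im \<rho>\<bar>) \<le> norm (of_real \<beta> * a (\<rho>\<^sup>2) * c (\<rho>\<^sup>2) + (inverse (of_real \<beta>) * a' (\<rho>\<^sup>2) + \<gamma> * a (\<rho>\<^sup>2)) * s (\<rho>\<^sup>2))"
      by (rule char_robin_lower[OF d0(3) beta ag cg sg, of \<gamma>]) blast
    obtain \<kappa>t Rt where lowt: "\<kappa>t > 0" "\<And>\<rho>. Rt \<le> norm \<rho> \<Longrightarrow> exp \<bar>Im (\<rho> * of_real d)\<bar> / 4 \<le> norm (sin (\<rho> * of_real d)) \<Longrightarrow>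
      exp \<bar>Im (\<rho> * of_real d)\<bar> / 4 \<le> norm (cos (\<rho> * of_real d)) \<Longrightarrow>
      \<kappa>t * norm \<rho> * exp (2 * d * \<bar>Im \<rho>\<bar>) \<le> norm (of_real \<beta> * b (\<rho>\<^sup>2) * c (\<rho>\<^sup>2) + (inverse (of_real \<beta>) * b' (\<rho>\<^sup>2) + \<gamma> * b (\<rho>\<^sup>2)) * s (\<rho>\<^sup>2))"
      by (rule char_robin_lower[OF d0(3) beta bg cg sg, of \<gamma>]) blast
    \<comment> \<open>On the imaginary axis \<open>cos (2 * Re (\<rho> * d))\<close> is 1, not 0, so
      only a large imaginary part makes these points good.\<close>
    have im: "good (\<i> * of_nat n)" if "2 \<le> n" for n
    proof -
      have "2 * 1 \<le> real n * (pi / 2)" using that pi_ge_two by (intro mult_mono) auto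
      then show ?thesis by (simp add: good_def d)
    qed
    \<comment> \<open>A nonzero value far out on the imaginary axis shows that the second
      characteristic function is not identically zero, so its zeros have finite orders.\<close>
    obtain n :: nat where n: "max 2 Rt < real n" using reals_Archimedean2 by blast
    have "0 < \<kappa>t * norm (\<i> * of_nat n) * exp (2 * d * \<bar>Im (\<i> * of_nat n)\<bar>)"
      using lowt(1) n by (intro mult_pos_pos) (auto simp: norm_mult)
    also have "\<dots> \<le> norm (Delta qt ht H \<beta> \<gamma> d ((\<i> * of_nat n)\<^sup>2))"
    proof -
      have g: "good (\<i> * of_nat n)" by (rule im) (use n in auto)
      have "Rt \<le> norm (\<i> * of_nat n)" using n by (simp add: norm_mult)
      from lowt(2)[OF this norm_sin_cos_lower[OF g[unfolded good_def]]] show ?thesis unfolding Xt .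
    qed
    finally have Xtnz: "Delta qt ht H \<beta> \<gamma> d ((\<i> * of_nat n)\<^sup>2) \<noteq> 0" by auto
    \<comment> \<open>If both vanished, \<open>C\<close> and \<open>S\<close> would satisfy the same
      condition at \<open>pi\<close> and their Wronskian would be 0 instead of 1.\<close>
    have nz: "c w \<noteq> 0 \<or> s w \<noteq> 0" for w
    proof (rule ccontr)
      assume "\<not> (c w \<noteq> 0 \<or> s w \<noteq> 0)"
      then have "C' w pi = - H * C w pi" "S' w pi = - H * S w pi"
        by (simp_all add: c_def s_def add_eq_0_iff2)
      then show False using W[of w] by simp
    qed
    show ?thesis
    proof (rule wronskian_vanishes[OF hol(1-4) _ _ nz beta X Xt F_def l Xtnz low(1), where e=1 and good=good and \<theta>="1/2" and j="nat (m+1)"])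
      show "c holomorphic_on UNIV" "s holomorphic_on UNIV"
        unfolding c_def[abs_def] s_def[abs_def] by (intro holomorphic_intros hol)+
      show "\<kappa> * norm \<rho> ^ 1 * exp (2 * d * \<bar>Im \<rho>\<bar>) \<le> norm (Delta q h H \<beta> \<gamma> d (\<rho>\<^sup>2))" if "R \<le> norm \<rho>" "good \<rho>" for \<rho>
        using low(2)[OF that(1) norm_sin_cos_lower[OF that(2)[unfolded good_def]]] unfolding X by simp
      show "good \<rho>" if "1 \<le> N" "max \<bar>Re \<rho>\<bar> \<bar>Im \<rho>\<bar> = 2 * real N + 1/2" for N \<rho>
        using square_contour_sin_cos[OF that] by (simp add: good_def d)
      \<comment> \<open>The factor \<open>\<rho>\<close> in the lower bound for
        \<open>Delta\<close>, \<open>e = 1\<close>, pays for the integer part of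
        \<open>(m + 2) / 2\<close>.\<close>
      show "2 * nat ((m + 2) div 2) \<le> nat (m + 1) + 1" using m by linarith
    qed (use Fg Flim im in auto)
  next
    assume "\<exists>l lt. eigenvalue_seq (Delta_inf q h \<beta> \<gamma> d) l \<and> eigenvalue_seq (Delta_inf qt ht \<beta> \<gamma> d) lt \<and>
               coincide_except (nat ((m + 1) div 2)) l lt"
    then obtain l lt where l: "eigenvalue_seq (Delta_inf q h \<beta> \<gamma> d) l" "eigenvalue_seq (Delta_inf qt ht \<beta> \<gamma> d) lt"
      "coincide_except (nat ((m + 1) div 2)) l lt" by blast
    define c where "c w = - C w pi" for w
    define s where "s w = - S w pi" for w
    have X: "Delta_inf q h \<beta> \<gamma> d = (\<lambda>w. of_real \<beta> * a w * c w + (inverse (of_real \<beta>) * a' w + \<gamma> * a w) * s w)"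
      unfolding a_def a'_def c_def s_def
      by (rule ext) (rule char_formulas(2)[OF q_L1 d0(1,2) CS SS])
    have Xt: "Delta_inf qt ht \<beta> \<gamma> d = (\<lambda>w. of_real \<beta> * b w * c w + (inverse (of_real \<beta>) * b' w + \<gamma> * b w) * s w)"
      unfolding b_def b'_def c_def s_def
      by (rule ext) (rule char_formulas(2)[OF qt_L1 d0(1,2) CSt(1) CS(2,3) CSt(2) SS(2,3)])
    define good where "good \<rho> \<longleftrightarrow> cos (2 * Re (\<rho> * of_real d)) = 1 \<or> 2 \<le> \<bar>Im (\<rho> * of_real d)\<bar>" for \<rho> :: complex
    obtain \<kappa> R where low: "\<kappa> > 0" "\<And>\<rho>. R \<le> norm \<rho> \<Longrightarrow> 1 \<le> norm (cos (\<rho> * of_real d)) \<Longrightarrow>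
      exp \<bar>Im (\<rho> * of_real d)\<bar> / 4 \<le> norm (cos (\<rho> * of_real d)) \<Longrightarrow>
      \<kappa> * exp (2 * d * \<bar>Im \<rho>\<bar>) \<le> norm (of_real \<beta> * a (\<rho>\<^sup>2) * C (\<rho>\<^sup>2) pi + (inverse (of_real \<beta>) * a' (\<rho>\<^sup>2) + \<gamma> * a (\<rho>\<^sup>2)) * S (\<rho>\<^sup>2) pi)"
      by (rule char_dirichlet_lower[OF d0(3) beta ag Cg(1) Sg(1), of \<gamma>]) blast
    obtain \<kappa>t Rt where lowt: "\<kappa>t > 0" "\<And>\<rho>. Rt \<le> norm \<rho> \<Longrightarrow> 1 \<le> norm (cos (\<rho> * of_real d)) \<Longrightarrow>
      exp \<bar>Im (\<rho> * of_real d)\<bar> / 4 \<le> norm (cos (\<rho> * of_real d)) \<Longrightarrow>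
      \<kappa>t * exp (2 * d * \<bar>Im \<rho>\<bar>) \<le> norm (of_real \<beta> * b (\<rho>\<^sup>2) * C (\<rho>\<^sup>2) pi + (inverse (of_real \<beta>) * b' (\<rho>\<^sup>2) + \<gamma> * b (\<rho>\<^sup>2)) * S (\<rho>\<^sup>2) pi)"
      by (rule char_dirichlet_lower[OF d0(3) beta bg Cg(1) Sg(1), of \<gamma>]) blast
    \<comment> \<open>Both \<open>c\<close> and \<open>s\<close> carry the sign of
      \<open>Delta_inf\<close>, which the modulus removes.\<close>
    have neg: "norm (u * c w + v * s w) = norm (u * C w pi + v * S w pi)" for u v w
      using norm_minus_cancel[of "u * C w pi + v * S w pi"] by (simp add: c_def s_def)
    \<comment> \<open>Here the first alternative of \<open>good\<close> holds on the whole imaginary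
      axis.\<close>
    have im: "good (\<i> * of_nat n)" for n by (simp add: good_def)
    obtain n :: nat where n: "max 2 Rt < real n" using reals_Archimedean2 by blast
    have "0 < \<kappa>t * exp (2 * d * \<bar>Im (\<i> * of_nat n)\<bar>)" using lowt(1) by simp
    also have "\<dots> \<le> norm (Delta_inf qt ht \<beta> \<gamma> d ((\<i> * of_nat n)\<^sup>2))"
    proof -
      have "Rt \<le> norm (\<i> * of_nat n)" using n by (simp add: norm_mult)
      from lowt(2)[OF this norm_cos_lower[OF im[of n, unfolded good_def]]] show ?thesis unfolding Xt neg .
    qed
    finally have Xtnz: "Delta_inf qt ht \<beta> \<gamma> d ((\<i> * of_nat n)\<^sup>2) \<noteq> 0" by auto
    have nz: "c w \<noteq> 0 \<or> s w \<noteq> 0" for w using W[of w] by (auto simp: c_def s_def)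
    show ?thesis
    proof (rule wronskian_vanishes[OF hol(1-4) _ _ nz beta X Xt F_def l Xtnz low(1), where e=0 and good=good and \<theta>=0 and j="nat (m+1)" and ?n0.0=0])
      show "c holomorphic_on UNIV" "s holomorphic_on UNIV"
        unfolding c_def[abs_def] s_def[abs_def] by (intro holomorphic_intros hol)+
      show "\<kappa> * norm \<rho> ^ 0 * exp (2 * d * \<bar>Im \<rho>\<bar>) \<le> norm (Delta_inf q h \<beta> \<gamma> d (\<rho>\<^sup>2))" if "R \<le> norm \<rho>" "good \<rho>" for \<rho>
        using low(2)[OF that(1) norm_cos_lower[OF that(2)[unfolded good_def]]] unfolding X neg by simp
      show "good \<rho>" if "1 \<le> N" "max \<bar>Re \<rho>\<bar> \<bar>Im \<rho>\<bar> = 2 * real N + 0" for N \<rho>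
        using square_contour_cos[OF that] by (simp add: good_def d)
      \<comment> \<open>With \<open>e = 0\<close> only the decay of \<open>F\<close> is available,
        hence the integer part of \<open>(m + 1) / 2\<close>.\<close>
      show "2 * nat ((m + 1) div 2) \<le> nat (m + 1) + 0" using m by linarith
    qed (use Fg Flim im in auto)
  qed
  have Fz: "fst (sl_sol q 0 (pi/2) 1 h lam) (pi/2) * snd (sl_sol qt 0 (pi/2) 1 ht lam) (pi/2)
     = snd (sl_sol q 0 (pi/2) 1 h lam) (pi/2) * fst (sl_sol qt 0 (pi/2) 1 ht lam) (pi/2)" for lam
    using F0[of lam] by (simp add: F_def a_def a'_def b_def b'_def d)
  obtain N where N: "h = ht" "negligible N" "\<And>x. x \<in> {0<..<pi/2} - N \<Longrightarrow> q x = qt x"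
    by (rule half_interval_uniqueness[OF qL[unfolded d] qtL[unfolded d] Fz]) blast
  have "AE x in lebesgue. x \<in> {0..pi} \<longrightarrow> q x = qt x"
    unfolding eventually_ae_filter_negligible
  proof (intro exI[of _ "NR \<union> N \<union> {0}"] conjI subsetI)
    show "negligible (NR \<union> N \<union> {0})" by (intro negligible_Un NR(1) N(2)) auto
    fix x assume "x \<in> {x. \<not> (x \<in> {0..pi} \<longrightarrow> q x = qt x)}"
    then have x: "x \<in> {0..pi}" "q x \<noteq> qt x" by auto
    show "x \<in> NR \<union> N \<union> {0}"
    proof (cases "x < pi / 2")
      case True then show ?thesis using N(3)[of x] x by (cases "x = 0") auto
    next
      case False then show ?thesis using right[of x] x by (auto simp: d)
    qed
  qed
  with N(1) show ?thesis by simp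
qed

end
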